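(* Let $H$ be a finite-dimensional Hilbert space; let $N$ be a finite-dimensional $C^{*}$-algebra with a faithful state $\mu$ and nondegenerate faithful representations $\rho\colon N^{op}\to\mathcal{L}(H)$ and $\sigma,\widehat{\sigma}\colon N\to\mathcal{L}(H)$ such that $\rho(N^{op})$, $\sigma(N)$, $\widehat{\sigma}(N)$ commute pairwise; let $(\mathfrak{H},\mathfrak{B},\mathfrak{B}^{\dagger})$ be a finite-dimensional standard $C^{*}$-base with bicyclic vector $\zeta\in\mathfrak{H}$; let $\alpha$ be a $C^{*}$-factorization of $H$ with respect to $(\mathfrak{H},\mathfrak{B},\mathfrak{B}^{\dagger})$ and $\beta,\widehat{\beta}$ $C^{*}$-factorizations of $H$ with respect to $(\mathfrak{H},\mathfrak{B}^{\dagger},\mathfrak{B})$ such that $\alpha,\beta,\widehat{\beta}$ are pairwise compatible. Let $U\colon\mathfrak{H}\to H_{\mu}$ be a unitary such that $U\mathfrak{B}U^{*}=\pi_{\mu}(N)$, $U\mathfrak{B}^{\dagger}U^{*}=\pi_{\mu}^{op}(N^{op})$, $U\zeta=\zeta_{\mu}$, and $$\rho=\rho_{\alpha}\circ\mathrm{Ad}_{U^{*}}\circ\pi_{\mu}^{op},\quad\sigma=\rho_{\beta}\circ\mathrm{Ad}_{U^{*}}\circ\pi_{\mu},\quad\widehat{\sigma}=\rho_{\widehat{\beta}}\circ\mathrm{Ad}_{U^{*}}\circ\pi_{\mu}.$$ Identify $H\,{}_{\widehat{\sigma}}\underset{\mu}{\otimes}{}_{\rho}\,H\cong H\,{}_{\widehat{\beta}}\underset{\mathfrak{H}}{\otimes}{}_{\alpha}\,H$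 and $H\,{}_{\rho}\underset{\mu^{op}}{\otimes}{}_{\sigma}\,H\cong H\,{}_{\alpha}\underset{\mathfrak{H}}{\otimes}{}_{\beta}\,H$ via the canonical unitaries determined by $U$ and $\zeta$, and let $$V\colon H\,{}_{\widehat{\sigma}}\underset{\mu}{\otimes}{}_{\rho}\,H\cong H\,{}_{\widehat{\beta}}\underset{\mathfrak{H}}{\otimes}{}_{\alpha}\,H\to H\,{}_{\alpha}\underset{\mathfrak{H}}{\otimes}{}_{\beta}\,H\cong H\,{}_{\rho}\underset{\mu^{op}}{\otimes}{}_{\sigma}\,H$$ be a unitary. Then $V$ is a pseudo-multiplicative unitary if and only if it is a $C^{*}$-pseudo-multiplicative unitary.
   Context: Inner products are conjugate-linear in the first variable. $[Y]$ denotes the closed linear span; $XY$ the set of products; $\mathrm{Ad}_{U}(x)=UxU^{*}$. $C^{*}$-bases and factorizations. A $C^{*}$-base is a triple $(\mathfrak{H},\mathfrak{B},\mathfrak{B}^{\dagger})$ of a Hilbert space and two commuting nondegenerate $C^{*}$-algebras $\mathfrak{B},\mathfrak{B}^{\dagger}\subseteq\mathcal{L}(\mathfrak{H})$; it is finite-dimensional if $\dim\mathfrak{H}<\infty$, standard if there is a bicyclic vector (cyclic for both $\mathfrak{B}$ and $\mathfrak{B}^{\dagger}$). A $C^{*}$-factorization of a Hilbert space $H$ with respect to a $C^{*}$-base $(\mathfrak{H},\mathfrak{C},\mathfrak{C}^{\dagger})$ is a closed subspace $\gamma\subseteq\mathcal{L}(\mathfrak{H},H)$ with $[\gamma^{*}\gamma]=\mathfrak{C}$,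 $[\gamma\mathfrak{C}]=\gamma$, $[\gamma\mathfrak{H}]=H$; it determines a representation $\rho_{\gamma}\colon\mathfrak{C}^{\dagger}\to\mathcal{L}(H)$, $\rho_{\gamma}(c^{\dagger})\xi\omega=\xi c^{\dagger}\omega$ ($\xi\in\gamma$, $\omega\in\mathfrak{H}$). Here $(\mathfrak{C},\mathfrak{C}^{\dagger})$ is $(\mathfrak{B},\mathfrak{B}^{\dagger})$ or $(\mathfrak{B}^{\dagger},\mathfrak{B})$. Two $C^{*}$-factorizations $\gamma,\delta$ of $H$ (with respect to possibly different $C^{*}$-bases) are compatible if $\gamma$ is invariant under the algebra represented by $\rho_{\delta}$ and conversely, i.e. $[\rho_{\gamma}(\cdot)\delta]=\delta$ and $[\rho_{\delta}(\cdot)\gamma]=\gamma$, where $\rho_{\gamma}(\cdot)$, $\rho_{\delta}(\cdot)$ denote the full images of the representations. GNS. $(H_{\mu},\pi_{\mu},\zeta_{\mu})$ is a GNS-representation for $\mu$, $J_{\mu}$ the modular conjugation (antiunitary part of the polar decomposition of $\pi_{\mu}(b)\zeta_{\mu}\mapsto\pi_{\mu}(b^{*})\zeta_{\mu}$), $\pi_{\mu}^{op}(b^{op})=J_{\mu}\pi_{\mu}(b)^{*}J_{\mu}$. Relative tensor products. For a nondegenerate faithful representation $\rho$ of $N^{op}$ (resp. $\sigma$ of $N$) on a finite-dimensional Hilbert space $K$ and $\xi\in K$, put $R^{\rho}(\xi)\colon H_{\mu}\to K$, $\pi_{\mu}^{op}(b^{op})\zeta_{\mu}\mapsto\rho(b^{op})\xi$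 (resp. $R^{\sigma}(\xi)\colon\pi_{\mu}(b)\zeta_{\mu}\mapsto\sigma(b)\xi$). If $(\kappa,\lambda)$ is a pair of such representations on $K$ and $L$, one of $N$ and the other of $N^{op}$, then $K\,{}_{\kappa}\otimes{}_{\lambda}\,L$ is the quotient of $K\otimes L$ by the null space of $\langle\xi\otimes\eta|\xi'\otimes\eta'\rangle=\langle R^{\kappa}(\xi')^{*}R^{\kappa}(\xi)\zeta_{\mu}|R^{\lambda}(\eta)^{*}R^{\lambda}(\eta')\zeta_{\mu}\rangle$. It is written with $\underset{\mu}{\otimes}$ if $\kappa$ represents $N$ and $\lambda$ represents $N^{op}$, and with $\underset{\mu^{op}}{\otimes}$ if $\kappa$ represents $N^{op}$ and $\lambda$ represents $N$; the class of $\xi\otimes\eta$ is denoted with the same symbol. Operators $S,T$ intertwining the relevant representations induce $S\otimes T\colon\xi\otimes\eta\mapsto S\xi\otimes T\eta$. Iterated products are identified by $(\xi\otimes\eta)\otimes\vartheta\leftrightarrow\xi\otimes(\eta\otimes\vartheta)$. $C^{*}$-relative tensor products. For $C^{*}$-factorizations $\gamma$ of $K$ w.r.t. $(\mathfrak{H},\mathfrak{C},\mathfrak{C}^{\dagger})$ and $\delta$ of $L$ w.r.t. $(\mathfrak{H},\mathfrak{C}^{\dagger},\mathfrak{C})$, $K\,{}_{\gamma}\underset{\mathfrak{H}}{\otimes}{}_{\delta}\,L$ is the separated completion of the algebraic tensor product of $\gamma,\mathfrak{H},\delta$ for $\langle\xi\otimes\omega\otimes\eta|\xi'\otimes\omega'\otimes\eta'\rangle=\langle\omega|(\xi^{*}\xi')(\eta^{*}\eta')\omega'\rangle$.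 For $\xi\in\gamma$, $\eta\in\delta$ define $|\xi\rangle_{[1]}\colon L\to K\,{}_{\gamma}\underset{\mathfrak{H}}{\otimes}{}_{\delta}\,L$, $\eta'\omega\mapsto\xi\otimes\omega\otimes\eta'$, and $|\eta\rangle_{[2]}\colon K\to K\,{}_{\gamma}\underset{\mathfrak{H}}{\otimes}{}_{\delta}\,L$, $\xi'\omega\mapsto\xi'\otimes\omega\otimes\eta$ ($\xi'\in\gamma$, $\eta'\in\delta$, $\omega\in\mathfrak{H}$); $|\gamma\rangle_{[1]}$, $|\delta\rangle_{[2]}$ are the sets of these operators. For a $C^{*}$-factorization $\varepsilon$ of $L$ compatible with $\delta$ put $\gamma\triangleright\varepsilon=[|\gamma\rangle_{[1]}\varepsilon]$, and for a $C^{*}$-factorization $\varepsilon$ of $K$ compatible with $\gamma$ put $\varepsilon\triangleleft\delta=[|\delta\rangle_{[2]}\varepsilon]$; these are $C^{*}$-factorizations of $K\,{}_{\gamma}\underset{\mathfrak{H}}{\otimes}{}_{\delta}\,L$, with associated representations $1\otimes\rho_{\varepsilon}(\cdot)$ and $\rho_{\varepsilon}(\cdot)\otimes1$, respectively. Operators $S,T$ mapping the relevant $C^{*}$-factorizations onto one another induce $S\underset{\mathfrak{H}}{\otimes}T\colon\xi\otimes\omega\otimes\eta\mapsto S\xi\otimes\omega\otimes T\eta$. For compatible $\delta,\varepsilon$ on $L$, the iterated products $(K\,{}_{\gamma}\underset{\mathfrak{H}}{\otimes}{}_{\delta}\,L)\,{}_{\gamma\triangleright\varepsilon}\underset{\mathfrak{H}}{\otimes}{}_{\varphi}\,M$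 and $K\,{}_{\gamma}\underset{\mathfrak{H}}{\otimes}{}_{\delta\triangleleft\varphi}(L\,{}_{\varepsilon}\underset{\mathfrak{H}}{\otimes}{}_{\varphi}\,M)$ are canonically identified by $|\eta\rangle_{[2]}|\xi\rangle_{[1]}x\leftrightarrow|\xi\rangle_{[1]}|\eta\rangle_{[2]}x$ ($\xi\in\gamma$, $x\in L$, $\eta\in\varphi$), and written $K\,{}_{\gamma}\underset{\mathfrak{H}}{\otimes}{}_{\delta}\,L\,{}_{\varepsilon}\underset{\mathfrak{H}}{\otimes}{}_{\varphi}\,M$. Identifications. The canonical unitaries are $H\,{}_{\widehat{\sigma}}\underset{\mu}{\otimes}{}_{\rho}\,H\to H\,{}_{\widehat{\beta}}\underset{\mathfrak{H}}{\otimes}{}_{\alpha}\,H$, $\xi\otimes\eta\mapsto R^{\widehat{\sigma}}(\xi)U\otimes\zeta\otimes R^{\rho}(\eta)U$, and $H\,{}_{\rho}\underset{\mu^{op}}{\otimes}{}_{\sigma}\,H\to H\,{}_{\alpha}\underset{\mathfrak{H}}{\otimes}{}_{\beta}\,H$, $\xi\otimes\eta\mapsto R^{\rho}(\xi)U\otimes\zeta\otimes R^{\sigma}(\eta)U$. Pseudo-multiplicative unitary. The unitary $V\colon H\,{}_{\widehat{\sigma}}\underset{\mu}{\otimes}{}_{\rho}\,H\to H\,{}_{\rho}\underset{\mu^{op}}{\otimes}{}_{\sigma}\,H$ is a pseudo-multiplicative unitary if for all $x\in N$, $y\in N^{op}$ $$V(\rho(y)\underset{\mu}{\otimes}1)=(1\underset{\mu^{op}}{\otimes}\rho(y))V,\quad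 V(\sigma(x)\underset{\mu}{\otimes}1)=(\sigma(x)\underset{\mu^{op}}{\otimes}1)V,$$ $$V(1\underset{\mu}{\otimes}\sigma(x))=(\widehat{\sigma}(x)\underset{\mu^{op}}{\otimes}1)V,\quad V(1\underset{\mu}{\otimes}\widehat{\sigma}(x))=(1\underset{\mu^{op}}{\otimes}\widehat{\sigma}(x))V,$$ and the following two composites from $H\,{}_{\widehat{\sigma}}\underset{\mu}{\otimes}{}_{\rho}\,H\,{}_{\widehat{\sigma}}\underset{\mu}{\otimes}{}_{\rho}\,H$ to $H\,{}_{\rho}\underset{\mu^{op}}{\otimes}{}_{\sigma}\,H\,{}_{\rho}\underset{\mu^{op}}{\otimes}{}_{\sigma}\,H$ agree. First composite: $$H\,{}_{\widehat{\sigma}}\underset{\mu}{\otimes}{}_{\rho}\,H\,{}_{\widehat{\sigma}}\underset{\mu}{\otimes}{}_{\rho}\,H\xrightarrow{V\otimes\mathrm{id}}H\,{}_{\rho}\underset{\mu^{op}}{\otimes}{}_{\sigma}\,H\,{}_{\widehat{\sigma}}\underset{\mu}{\otimes}{}_{\rho}\,H\xrightarrow{\mathrm{id}\otimes V}H\,{}_{\rho}\underset{\mu^{op}}{\otimes}{}_{\sigma}\,H\,{}_{\rho}\underset{\mu^{op}}{\otimes}{}_{\sigma}\,H.$$ Second composite: $$H\,{}_{\widehat{\sigma}}\underset{\mu}{\otimes}{}_{\rho}\,H\,{}_{\widehat{\sigma}}\underset{\mu}{\otimes}{}_{\rho}\,H\xrightarrow{\mathrm{id}\otimes V}H\,{}_{\widehat{\sigma}}\underset{\mu}{\otimes}{}_{\rho_{[2]}}(H\,{}_{\rho}\underset{\mu^{op}}{\otimes}{}_{\sigma}\,H)\xrightarrow{\mathrm{id}\otimes\Sigma^{\mu}}H\,{}_{\widehat{\sigma}}\underset{\mu}{\otimes}{}_{\rho}\,H\,{}_{\sigma}\underset{\mu}{\otimes}{}_{\rho}\,H$$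 $$\xrightarrow{V\otimes\mathrm{id}}(H\,{}_{\rho}\underset{\mu^{op}}{\otimes}{}_{\sigma}\,H)\,{}_{\widehat{\sigma}_{[1]}}\underset{\mu}{\otimes}{}_{\rho}\,H\xrightarrow{\Sigma^{\mu}_{[23]}}(H\,{}_{\widehat{\sigma}}\underset{\mu}{\otimes}{}_{\rho}\,H)\,{}_{\rho_{[1]}}\underset{\mu^{op}}{\otimes}{}_{\sigma}\,H\xrightarrow{V\otimes\mathrm{id}}H\,{}_{\rho}\underset{\mu^{op}}{\otimes}{}_{\sigma}\,H\,{}_{\rho}\underset{\mu^{op}}{\otimes}{}_{\sigma}\,H.$$ Here $\rho_{[2]}=1\otimes\rho(\cdot)$, $\rho_{[1]}=\rho(\cdot)\otimes1$, $\widehat{\sigma}_{[1]}=\widehat{\sigma}(\cdot)\otimes1$, and $\mathrm{id}\otimes\Sigma^{\mu}$, $\Sigma^{\mu}_{[23]}$ flip the second and third tensor components. $C^{*}$-pseudo-multiplicative unitary. The unitary $V\colon H\,{}_{\widehat{\beta}}\underset{\mathfrak{H}}{\otimes}{}_{\alpha}\,H\to H\,{}_{\alpha}\underset{\mathfrak{H}}{\otimes}{}_{\beta}\,H$ is a $C^{*}$-pseudo-multiplicative unitary if $$V(\alpha\triangleleft\alpha)=\alpha\triangleright\alpha,\quad V(\widehat{\beta}\triangleright\beta)=\widehat{\beta}\triangleleft\beta,\quad V(\widehat{\beta}\triangleright\widehat{\beta})=\alpha\triangleright\widehat{\beta},\quad V(\beta\triangleleft\alpha)=\beta\triangleleft\beta$$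 (left-hand factorizations are formed in $H\,{}_{\widehat{\beta}}\underset{\mathfrak{H}}{\otimes}{}_{\alpha}\,H$, right-hand ones in $H\,{}_{\alpha}\underset{\mathfrak{H}}{\otimes}{}_{\beta}\,H$) and the following two composites agree. First composite: $$H\,{}_{\widehat{\beta}}\underset{\mathfrak{H}}{\otimes}{}_{\alpha}\,H\,{}_{\widehat{\beta}}\underset{\mathfrak{H}}{\otimes}{}_{\alpha}\,H\xrightarrow{V\otimes\mathrm{id}}H\,{}_{\alpha}\underset{\mathfrak{H}}{\otimes}{}_{\beta}\,H\,{}_{\widehat{\beta}}\underset{\mathfrak{H}}{\otimes}{}_{\alpha}\,H\xrightarrow{\mathrm{id}\otimes V}H\,{}_{\alpha}\underset{\mathfrak{H}}{\otimes}{}_{\beta}\,H\,{}_{\alpha}\underset{\mathfrak{H}}{\otimes}{}_{\beta}\,H.$$ Second composite: $$H\,{}_{\widehat{\beta}}\underset{\mathfrak{H}}{\otimes}{}_{\alpha}\,H\,{}_{\widehat{\beta}}\underset{\mathfrak{H}}{\otimes}{}_{\alpha}\,H\xrightarrow{\mathrm{id}\otimes V}H\,{}_{\widehat{\beta}}\underset{\mathfrak{H}}{\otimes}{}_{\alpha\triangleright\alpha}(H\,{}_{\alpha}\underset{\mathfrak{H}}{\otimes}{}_{\beta}\,H)\xrightarrow{\mathrm{id}\otimes\Sigma^{\mathfrak{H}}}H\,{}_{\widehat{\beta}}\underset{\mathfrak{H}}{\otimes}{}_{\alpha}\,H\,{}_{\beta}\underset{\mathfrak{H}}{\otimes}{}_{\alpha}\,H$$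 $$\xrightarrow{V\otimes\mathrm{id}}(H\,{}_{\alpha}\underset{\mathfrak{H}}{\otimes}{}_{\beta}\,H)\,{}_{\widehat{\beta}\triangleleft\beta}\underset{\mathfrak{H}}{\otimes}{}_{\alpha}\,H\xrightarrow{\Sigma^{\mathfrak{H}}_{[23]}}(H\,{}_{\widehat{\beta}}\underset{\mathfrak{H}}{\otimes}{}_{\alpha}\,H)\,{}_{\alpha\triangleleft\alpha}\underset{\mathfrak{H}}{\otimes}{}_{\beta}\,H\xrightarrow{V\otimes\mathrm{id}}H\,{}_{\alpha}\underset{\mathfrak{H}}{\otimes}{}_{\beta}\,H\,{}_{\alpha}\underset{\mathfrak{H}}{\otimes}{}_{\beta}\,H.$$ Again $\mathrm{id}\otimes\Sigma^{\mathfrak{H}}$ and $\Sigma^{\mathfrak{H}}_{[23]}$ flip the second and third components: $\Sigma^{\mathfrak{H}}\colon\xi\otimes\omega\otimes\eta\mapsto\eta\otimes\omega\otimes\xi$, and $\Sigma^{\mathfrak{H}}_{[23]}$ is the unitary $|\eta\rangle_{[2]}|\xi\rangle_{[2]}x\mapsto|\xi\rangle_{[2]}|\eta\rangle_{[2]}x$ for $x\in H$, $\xi\in\beta$, $\eta\in\alpha$. *)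

theory Defs
  imports "HOL-Analysis.Analysis" "HOL-Library.Function_Algebras"
begin

text \<open>
  All Hilbert spaces and algebras in this theory are finite-dimensional. Hence every linear
  subspace that occurs is closed, completions are superfluous, and the closed linear span \<open>[Y]\<close>
  is the linear span \<open>cspan Y\<close>.
\<close>

section \<open>Complex vector spaces, Hilbert spaces and C*-algebras\<close>

class complex_vector = ab_group_add +
  fixes scaleC :: "complex \<Rightarrow> 'a \<Rightarrow> 'a"  (infixr \<open>*\<^sub>C\<close> 75)
  assumes scaleC_add_right: "a *\<^sub>C (x + y) = a *\<^sub>C x + a *\<^sub>C y"
    and scaleC_add_left: "(a + b) *\<^sub>C x = a *\<^sub>C x + b *\<^sub>C x"
    and scaleC_scaleC: "a *\<^sub>C b *\<^sub>C x = (a * b) *\<^sub>C x"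
    and scaleC_one: "1 *\<^sub>C x = x"

global_interpretation complex_vector: vector_space "scaleC :: complex \<Rightarrow> 'a \<Rightarrow> 'a::complex_vector"
  defines csubspace = complex_vector.subspace
    and cspan = complex_vector.span
  by unfold_locales (simp_all add: scaleC_add_right scaleC_add_left scaleC_scaleC scaleC_one)

abbreviation clinear :: "('a::complex_vector \<Rightarrow> 'b::complex_vector) \<Rightarrow> bool"
  where "clinear \<equiv> Vector_Spaces.linear scaleC scaleC"

instantiation complex :: complex_vector
begin
definition scaleC_complex_def: "c *\<^sub>C (z::complex) = c * z"
instance by standard (simp_all add: scaleC_complex_def algebra_simps)
end

instantiation prod :: (complex_vector, complex_vector) complex_vector
begin
definition scaleC_prod_def: "c *\<^sub>C p = (c *\<^sub>C fst p, c *\<^sub>C snd p)"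
instance by standard
  (simp_all add: scaleC_prod_def prod_eq_iff scaleC_add_right scaleC_add_left scaleC_scaleC scaleC_one)
end

instantiation "fun" :: (type, complex_vector) complex_vector
begin
definition scaleC_fun_def: "c *\<^sub>C f = (\<lambda>x. c *\<^sub>C f x)"
instance by standard
  (simp_all add: scaleC_fun_def fun_eq_iff scaleC_add_right scaleC_add_left scaleC_scaleC scaleC_one)
end

class fd_hilbert = complex_vector +
  fixes cinner :: "'a \<Rightarrow> 'a \<Rightarrow> complex"
  assumes cinner_commute: "cinner x y = cnj (cinner y x)"
    and cinner_add_right: "cinner x (y + z) = cinner x y + cinner x z"
    and cinner_scaleC_right: "cinner x (c *\<^sub>C y) = c * cinner x y"
    and cinner_ge_zero: "0 \<le> Re (cinner x x)"
    and cinner_eq_zero_iff: "cinner x x = 0 \<longleftrightarrow> x = 0"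
    and fd_hilbert_finite_dim: "\<exists>A. finite A \<and> (\<forall>x. \<exists>c. x = (\<Sum>a\<in>A. c a *\<^sub>C a))"

text \<open>No unit is required in a C*-algebra.\<close>

class fd_cstar_algebra = real_normed_algebra + banach + complex_vector +
  fixes star :: "'a \<Rightarrow> 'a"
  assumes scaleR_scaleC: "r *\<^sub>R x = of_real r *\<^sub>C x"
    and norm_scaleC: "norm (c *\<^sub>C x) = cmod c * norm x"
    and mult_scaleC_left: "(c *\<^sub>C x) * y = c *\<^sub>C (x * y)"
    and mult_scaleC_right: "x * (c *\<^sub>C y) = c *\<^sub>C (x * y)"
    and star_add: "star (x + y) = star x + star y"
    and star_scaleC: "star (c *\<^sub>C x) = cnj c *\<^sub>C star x"
    and star_mult: "star (x * y) = star y * star x"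
    and star_star: "star (star x) = x"
    and cstar_identity: "norm (star x * x) = (norm x)\<^sup>2"
    and fd_cstar_finite_dim: "\<exists>A. finite A \<and> (\<forall>x. \<exists>c. x = (\<Sum>a\<in>A. c a *\<^sub>C a))"

text \<open>
  The tensor products below depend on representations, so they are not types but Hilbert spaces
  carried by a linear subspace of some complex vector space type.
\<close>

record 'a hilb =
  carr :: "'a set"
  ip :: "'a \<Rightarrow> 'a \<Rightarrow> complex"

definition whole :: "'a::fd_hilbert hilb"
  where "whole = \<lparr>carr = UNIV, ip = cinner\<rparr>"

section \<open>Operators\<close>

text \<open>
  \<open>lin_ext G\<close> is the operator \<open>x \<mapsto> y\<close> for \<open>(x, y) \<in> G\<close>, extended linearly: its graph is the linear
  span of \<open>G\<close>. It is meaningful on the span of the first components, if the span of \<open>G\<close> is the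
  graph of a function.
\<close>

definition lin_ext :: "('a::complex_vector \<times> 'b::complex_vector) set \<Rightarrow> 'a \<Rightarrow> 'b"
  where "lin_ext G x = (THE y. (x, y) \<in> cspan G)"

definition adj :: "'a hilb \<Rightarrow> 'b hilb \<Rightarrow> ('a \<Rightarrow> 'b) \<Rightarrow> 'b \<Rightarrow> 'a"
  where "adj A B T y = (THE z. z \<in> carr A \<and> (\<forall>x\<in>carr A. ip A z x = ip B y (T x)))"

definition unitary_op :: "'a::complex_vector hilb \<Rightarrow> 'b::complex_vector hilb \<Rightarrow> ('a \<Rightarrow> 'b) \<Rightarrow> bool"
  where "unitary_op A B T \<longleftrightarrow>
    (\<forall>x\<in>carr A. \<forall>y\<in>carr A. T (x + y) = T x + T y) \<and>
    (\<forall>c. \<forall>x\<in>carr A. T (c *\<^sub>C x) = c *\<^sub>C T x) \<and>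
    bij_betw T (carr A) (carr B) \<and>
    (\<forall>x\<in>carr A. \<forall>y\<in>carr A. ip B (T x) (T y) = ip A x y)"

definition antiunitary :: "('a::fd_hilbert \<Rightarrow> 'a) \<Rightarrow> bool"
  where "antiunitary J \<longleftrightarrow>
    (\<forall>x y. J (x + y) = J x + J y) \<and> (\<forall>c x. J (c *\<^sub>C x) = cnj c *\<^sub>C J x) \<and>
    bij J \<and> (\<forall>x y. cinner (J x) (J y) = cinner y x)"

section \<open>Separation of a space with a positive semidefinite form\<close>

text \<open>
  Let \<open>k\<close> be a positive semidefinite kernel on \<open>X\<close>, conjugate-linearly extended in the first and
  linearly in the second variable to the free vector space over \<open>X\<close>. Mapping \<open>f\<close> to the function
  \<open>x \<mapsto> \<langle>x|f\<rangle>\<close> annihilates precisely the null space of this form, so the image is the quotient by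
  the null space; \<open>sep_class X k x\<close> is the class of the generator \<open>x\<close>. If \<open>X\<close> consists of tuples
  and \<open>k\<close> is (sesqui)linear in their components, the multilinearity relations lie in the null
  space, so starting from the free vector space instead of the algebraic tensor product makes no
  difference.

  The inner product is determined by \<open>\<langle>sep_class X k x|G\<rangle> = G x\<close> and conjugate-linearity in the
  first variable.
\<close>

definition sep_class :: "'x set \<Rightarrow> ('x \<Rightarrow> 'x \<Rightarrow> complex) \<Rightarrow> 'x \<Rightarrow> 'x \<Rightarrow> complex"
  where "sep_class X k x = (\<lambda>x'. if x' \<in> X then k x' x else 0)"

definition sep_space :: "'x set \<Rightarrow> ('x \<Rightarrow> 'x \<Rightarrow> complex) \<Rightarrow> ('x \<Rightarrow> complex) hilb"
  where "sep_space X k =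
    \<lparr>carr = cspan (sep_class X k ` X),
     ip = (\<lambda>F G. cnj (lin_ext {(sep_class X k x, cnj (G x)) | x. x \<in> X} F))\<rparr>"

section \<open>Representations and GNS-representations\<close>

definition cstar_rep :: "('n::fd_cstar_algebra \<Rightarrow> 'h::fd_hilbert \<Rightarrow> 'h) \<Rightarrow> bool"
  where "cstar_rep r \<longleftrightarrow> (\<forall>b. clinear (r b)) \<and> clinear r \<and>
    (\<forall>b c. r (b * c) = r b \<circ> r c) \<and> (\<forall>b. r (star b) = adj whole whole (r b))"

text \<open>
  The opposite algebra of \<open>N\<close> has the same elements with reversed multiplication; a representation
  of it is a function of \<open>b\<close> standing for \<open>b\<^sup>o\<^sup>p\<close>.
\<close>

definition cstar_opp_rep :: "('n::fd_cstar_algebra \<Rightarrow> 'h::fd_hilbert \<Rightarrow> 'h) \<Rightarrow> bool"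
  where "cstar_opp_rep r \<longleftrightarrow> (\<forall>b. clinear (r b)) \<and> clinear r \<and>
    (\<forall>b c. r (b * c) = r c \<circ> r b) \<and> (\<forall>b. r (star b) = adj whole whole (r b))"

definition nondegenerate :: "('n \<Rightarrow> 'h \<Rightarrow> 'h::fd_hilbert) \<Rightarrow> bool"
  where "nondegenerate r \<longleftrightarrow> cspan {r b x | b x. True} = UNIV"

definition faithful_state :: "('n::fd_cstar_algebra \<Rightarrow> complex) \<Rightarrow> bool"
  where "faithful_state \<mu> \<longleftrightarrow> clinear \<mu> \<and> (\<forall>b. \<mu> (star b * b) \<in> \<real>\<^sub>\<ge>\<^sub>0) \<and> onorm \<mu> = 1 \<and>
    (\<forall>b. \<mu> (star b * b) = 0 \<longrightarrow> b = 0)"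

text \<open>A GNS-representation is given as the pair of \<open>\<pi>\<^sub>\<mu>\<close> and \<open>\<zeta>\<^sub>\<mu>\<close>.\<close>

type_synonym ('n, 'm) gns = "('n \<Rightarrow> 'm \<Rightarrow> 'm) \<times> 'm"

definition gns_representation ::
    "('n::fd_cstar_algebra \<Rightarrow> complex) \<Rightarrow> ('n, 'm::fd_hilbert) gns \<Rightarrow> bool"
  where "gns_representation \<mu> g \<longleftrightarrow> (case g of (\<pi>, z) \<Rightarrow>
    cstar_rep \<pi> \<and> cspan {\<pi> b z | b. True} = UNIV \<and> (\<forall>b. \<mu> b = cinner z (\<pi> b z)))"

text \<open>
  In the polar decomposition \<open>S = J \<circ> P\<close> of \<open>S : \<pi>\<^sub>\<mu>(b)\<zeta>\<^sub>\<mu> \<mapsto> \<pi>\<^sub>\<mu>(b\<^sup>*)\<zeta>\<^sub>\<mu>\<close>, the operator \<open>P\<close> is positive.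
\<close>

definition modular_conj :: "('n::fd_cstar_algebra, 'm::fd_hilbert) gns \<Rightarrow> 'm \<Rightarrow> 'm"
  where "modular_conj g = (THE J. antiunitary J \<and>
    (\<exists>P. clinear P \<and> (\<forall>x. cinner x (P x) \<in> \<real>\<^sub>\<ge>\<^sub>0) \<and>
      (\<forall>b. J (P (fst g b (snd g))) = fst g (star b) (snd g))))"

definition gns_op :: "('n::fd_cstar_algebra, 'm::fd_hilbert) gns \<Rightarrow> 'n \<Rightarrow> 'm \<Rightarrow> 'm"
  where "gns_op g b = modular_conj g \<circ> adj whole whole (fst g b) \<circ> modular_conj g"

section \<open>Relative tensor products\<close>

text \<open>Whether a map on \<open>N\<close> is regarded as a representation of \<open>N\<close> or of \<open>N\<^sup>o\<^sup>p\<close>.\<close>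

datatype side = Alg | Opp

fun flip :: "side \<Rightarrow> side"
  where "flip Alg = Opp" | "flip Opp = Alg"

fun gns_side :: "('n::fd_cstar_algebra, 'm::fd_hilbert) gns \<Rightarrow> side \<Rightarrow> 'n \<Rightarrow> 'm \<Rightarrow> 'm"
  where "gns_side g Alg = fst g" | "gns_side g Opp = gns_op g"

type_synonym ('n, 'a) rep_space = "'a hilb \<times> ('n \<Rightarrow> 'a \<Rightarrow> 'a)"

text \<open>\<open>R_op g s \<kappa> \<xi>\<close> is \<open>R\<^sup>\<kappa>(\<xi>)\<close>, where \<open>s\<close> tells whether \<open>\<kappa>\<close> represents \<open>N\<close> or \<open>N\<^sup>o\<^sup>p\<close>.\<close>

definition R_op :: "('n::fd_cstar_algebra, 'm::fd_hilbert) gns \<Rightarrow> side \<Rightarrow>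
    ('n \<Rightarrow> 'a \<Rightarrow> 'a) \<Rightarrow> 'a \<Rightarrow> 'm \<Rightarrow> 'a::complex_vector"
  where "R_op g s \<kappa> \<xi> = lin_ext {(gns_side g s b (snd g), \<kappa> b \<xi>) | b. True}"

text \<open>
  The relative tensor product of \<open>P = (K, \<kappa>)\<close> and \<open>Q = (L, \<lambda>)\<close>: for \<open>s = Alg\<close>, \<open>\<kappa>\<close> represents \<open>N\<close> and
  \<open>\<lambda>\<close> represents \<open>N\<^sup>o\<^sup>p\<close> (tensor product over \<open>\<mu>\<close>); for \<open>s = Opp\<close> it is the other way round (tensor
  product over \<open>\<mu>\<^sup>o\<^sup>p\<close>).
\<close>

definition rel_kernel :: "('n::fd_cstar_algebra, 'm::fd_hilbert) gns \<Rightarrow> side \<Rightarrow>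
    ('n, 'a::complex_vector) rep_space \<Rightarrow> ('n, 'b::complex_vector) rep_space \<Rightarrow>
    'a \<times> 'b \<Rightarrow> 'a \<times> 'b \<Rightarrow> complex"
  where "rel_kernel g s P Q = (\<lambda>(\<xi>, \<eta>) (\<xi>', \<eta>').
    cinner (adj whole (fst P) (R_op g s (snd P) \<xi>') (R_op g s (snd P) \<xi> (snd g)))
      (adj whole (fst Q) (R_op g (flip s) (snd Q) \<eta>) (R_op g (flip s) (snd Q) \<eta>' (snd g))))"

definition rel_tensor :: "('n::fd_cstar_algebra, 'm::fd_hilbert) gns \<Rightarrow> side \<Rightarrow>
    ('n, 'a::complex_vector) rep_space \<Rightarrow> ('n, 'b::complex_vector) rep_space \<Rightarrow>
    ('a \<times> 'b \<Rightarrow> complex) hilb"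
  where "rel_tensor g s P Q = sep_space (carr (fst P) \<times> carr (fst Q)) (rel_kernel g s P Q)"

definition rel_vec :: "('n::fd_cstar_algebra, 'm::fd_hilbert) gns \<Rightarrow> side \<Rightarrow>
    ('n, 'a::complex_vector) rep_space \<Rightarrow> ('n, 'b::complex_vector) rep_space \<Rightarrow>
    'a \<Rightarrow> 'b \<Rightarrow> 'a \<times> 'b \<Rightarrow> complex"
  where "rel_vec g s P Q \<xi> \<eta> =
    sep_class (carr (fst P) \<times> carr (fst Q)) (rel_kernel g s P Q) (\<xi>, \<eta>)"

text \<open>\<open>S \<otimes> T\<close> as an operator from the tensor product of \<open>P, Q\<close> to that of \<open>P', Q'\<close>.\<close>

definition rel_op :: "('n::fd_cstar_algebra, 'm::fd_hilbert) gns \<Rightarrow> side \<Rightarrow>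
    ('n, 'a::complex_vector) rep_space \<Rightarrow> ('n, 'b::complex_vector) rep_space \<Rightarrow>
    ('n, 'c::complex_vector) rep_space \<Rightarrow> ('n, 'd::complex_vector) rep_space \<Rightarrow>
    ('a \<Rightarrow> 'c) \<Rightarrow> ('b \<Rightarrow> 'd) \<Rightarrow> ('a \<times> 'b \<Rightarrow> complex) \<Rightarrow> ('c \<times> 'd \<Rightarrow> complex)"
  where "rel_op g s P Q P' Q' S T = lin_ext
    {(rel_vec g s P Q \<xi> \<eta>, rel_vec g s P' Q' (S \<xi>) (T \<eta>)) | \<xi> \<eta>.
      \<xi> \<in> carr (fst P) \<and> \<eta> \<in> carr (fst Q)}"

text \<open>
  The tensor product of \<open>P, Q\<close> equipped with \<open>r\<^sub>[\<^sub>1\<^sub>] = r(\<cdot>) \<otimes> 1\<close> and with \<open>r\<^sub>[\<^sub>2\<^sub>] = 1 \<otimes> r(\<cdot>)\<close>, respectively.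
\<close>

definition rel_leg1 :: "('n::fd_cstar_algebra, 'm::fd_hilbert) gns \<Rightarrow> side \<Rightarrow>
    ('n, 'a::complex_vector) rep_space \<Rightarrow> ('n, 'b::complex_vector) rep_space \<Rightarrow>
    ('n \<Rightarrow> 'a \<Rightarrow> 'a) \<Rightarrow> ('n, 'a \<times> 'b \<Rightarrow> complex) rep_space"
  where "rel_leg1 g s P Q r = (rel_tensor g s P Q, \<lambda>n. rel_op g s P Q P Q (r n) id)"

definition rel_leg2 :: "('n::fd_cstar_algebra, 'm::fd_hilbert) gns \<Rightarrow> side \<Rightarrow>
    ('n, 'a::complex_vector) rep_space \<Rightarrow> ('n, 'b::complex_vector) rep_space \<Rightarrow>
    ('n \<Rightarrow> 'b \<Rightarrow> 'b) \<Rightarrow> ('n, 'a \<times> 'b \<Rightarrow> complex) rep_space"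
  where "rel_leg2 g s P Q r = (rel_tensor g s P Q, \<lambda>n. rel_op g s P Q P Q id (r n))"

text \<open>
  The identification \<open>(\<xi> \<otimes> \<eta>) \<otimes> \<theta> \<mapsto> \<xi> \<otimes> (\<eta> \<otimes> \<theta>)\<close> for three copies of \<open>H\<close>, where \<open>\<kappa>, \<tau>\<close> (of sides
  \<open>s, flip s\<close>) belong to the first and \<open>\<epsilon>, \<phi>\<close> (of sides \<open>t, flip t\<close>) to the second tensor sign.
\<close>

definition rel_assoc :: "('n::fd_cstar_algebra, 'm::fd_hilbert) gns \<Rightarrow>
    side \<Rightarrow> ('n \<Rightarrow> 'h \<Rightarrow> 'h) \<Rightarrow> ('n \<Rightarrow> 'h \<Rightarrow> 'h) \<Rightarrow>
    side \<Rightarrow> ('n \<Rightarrow> 'h \<Rightarrow> 'h) \<Rightarrow> ('n \<Rightarrow> 'h \<Rightarrow> 'h::fd_hilbert) \<Rightarrow>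
    (('h \<times> 'h \<Rightarrow> complex) \<times> 'h \<Rightarrow> complex) \<Rightarrow> ('h \<times> ('h \<times> 'h \<Rightarrow> complex) \<Rightarrow> complex)"
  where "rel_assoc g s \<kappa> \<tau> t \<epsilon> \<phi> = lin_ext
    {(rel_vec g t (rel_leg2 g s (whole, \<kappa>) (whole, \<tau>) \<epsilon>) (whole, \<phi>)
        (rel_vec g s (whole, \<kappa>) (whole, \<tau>) \<xi> \<eta>) \<theta>,
      rel_vec g s (whole, \<kappa>) (rel_leg1 g t (whole, \<epsilon>) (whole, \<phi>) \<tau>)
        \<xi> (rel_vec g t (whole, \<epsilon>) (whole, \<phi>) \<eta> \<theta>)) | \<xi> \<eta> \<theta>. True}"

text \<open>The inverse identification \<open>\<xi> \<otimes> (\<eta> \<otimes> \<theta>) \<mapsto> (\<xi> \<otimes> \<eta>) \<otimes> \<theta>\<close>.\<close>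

definition rel_assoc_inv :: "('n::fd_cstar_algebra, 'm::fd_hilbert) gns \<Rightarrow>
    side \<Rightarrow> ('n \<Rightarrow> 'h \<Rightarrow> 'h) \<Rightarrow> ('n \<Rightarrow> 'h \<Rightarrow> 'h) \<Rightarrow>
    side \<Rightarrow> ('n \<Rightarrow> 'h \<Rightarrow> 'h) \<Rightarrow> ('n \<Rightarrow> 'h \<Rightarrow> 'h::fd_hilbert) \<Rightarrow>
    ('h \<times> ('h \<times> 'h \<Rightarrow> complex) \<Rightarrow> complex) \<Rightarrow> (('h \<times> 'h \<Rightarrow> complex) \<times> 'h \<Rightarrow> complex)"
  where "rel_assoc_inv g s \<kappa> \<tau> t \<epsilon> \<phi> = lin_ext
    {(rel_vec g s (whole, \<kappa>) (rel_leg1 g t (whole, \<epsilon>) (whole, \<phi>) \<tau>)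
        \<xi> (rel_vec g t (whole, \<epsilon>) (whole, \<phi>) \<eta> \<theta>),
      rel_vec g t (rel_leg2 g s (whole, \<kappa>) (whole, \<tau>) \<epsilon>) (whole, \<phi>)
        (rel_vec g s (whole, \<kappa>) (whole, \<tau>) \<xi> \<eta>) \<theta>) | \<xi> \<eta> \<theta>. True}"

definition rel_flip :: "('n::fd_cstar_algebra, 'm::fd_hilbert) gns \<Rightarrow> side \<Rightarrow>
    ('n, 'h::fd_hilbert) rep_space \<Rightarrow> ('n, 'h) rep_space \<Rightarrow>
    ('h \<times> 'h \<Rightarrow> complex) \<Rightarrow> ('h \<times> 'h \<Rightarrow> complex)"
  where "rel_flip g s P Q = lin_ext
    {(rel_vec g s P Q \<xi> \<eta>, rel_vec g (flip s) Q P \<eta> \<xi>) | \<xi> \<eta>. True}"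

definition rel_flip23 :: "('n::fd_cstar_algebra, 'm::fd_hilbert) gns \<Rightarrow>
    ('n \<Rightarrow> 'h \<Rightarrow> 'h) \<Rightarrow> ('n \<Rightarrow> 'h \<Rightarrow> 'h) \<Rightarrow> ('n \<Rightarrow> 'h \<Rightarrow> 'h::fd_hilbert) \<Rightarrow>
    (('h \<times> 'h \<Rightarrow> complex) \<times> 'h \<Rightarrow> complex) \<Rightarrow> (('h \<times> 'h \<Rightarrow> complex) \<times> 'h \<Rightarrow> complex)"
  where "rel_flip23 g \<rho> \<sigma> \<sigma>h = lin_ext
    {(rel_vec g Alg (rel_leg1 g Opp (whole, \<rho>) (whole, \<sigma>) \<sigma>h) (whole, \<rho>)
        (rel_vec g Opp (whole, \<rho>) (whole, \<sigma>) \<xi> \<eta>) \<theta>,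
      rel_vec g Opp (rel_leg1 g Alg (whole, \<sigma>h) (whole, \<rho>) \<rho>) (whole, \<sigma>)
        (rel_vec g Alg (whole, \<sigma>h) (whole, \<rho>) \<xi> \<theta>) \<eta>) | \<xi> \<eta> \<theta>. True}"

section \<open>Pseudo-multiplicative unitaries\<close>

text \<open>
  Threefold products are represented with both bracketings. The composites start in the product
  bracketed to the left; the first one ends bracketed to the right, the second one bracketed to the
  left.
\<close>

definition pmu_first :: "('n::fd_cstar_algebra, 'm::fd_hilbert) gns \<Rightarrow>
    ('n \<Rightarrow> 'h \<Rightarrow> 'h) \<Rightarrow> ('n \<Rightarrow> 'h \<Rightarrow> 'h) \<Rightarrow> ('n \<Rightarrow> 'h \<Rightarrow> 'h::fd_hilbert) \<Rightarrow>
    (('h \<times> 'h \<Rightarrow> complex) \<Rightarrow> ('h \<times> 'h \<Rightarrow> complex)) \<Rightarrow>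
    (('h \<times> 'h \<Rightarrow> complex) \<times> 'h \<Rightarrow> complex) \<Rightarrow> ('h \<times> ('h \<times> 'h \<Rightarrow> complex) \<Rightarrow> complex)"
  where "pmu_first g \<rho> \<sigma> \<sigma>h V =
    (let R = (whole, \<rho>); S = (whole, \<sigma>); Sh = (whole, \<sigma>h) in
      rel_op g Opp R (rel_leg1 g Alg Sh R \<sigma>) R (rel_leg1 g Opp R S \<sigma>) id V \<circ>
      rel_assoc g Opp \<rho> \<sigma> Alg \<sigma>h \<rho> \<circ>
      rel_op g Alg (rel_leg2 g Alg Sh R \<sigma>h) R (rel_leg2 g Opp R S \<sigma>h) R V id)"

definition pmu_second :: "('n::fd_cstar_algebra, 'm::fd_hilbert) gns \<Rightarrow>
    ('n \<Rightarrow> 'h \<Rightarrow> 'h) \<Rightarrow> ('n \<Rightarrow> 'h \<Rightarrow> 'h) \<Rightarrow> ('n \<Rightarrow> 'h \<Rightarrow> 'h::fd_hilbert) \<Rightarrow>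
    (('h \<times> 'h \<Rightarrow> complex) \<Rightarrow> ('h \<times> 'h \<Rightarrow> complex)) \<Rightarrow>
    (('h \<times> 'h \<Rightarrow> complex) \<times> 'h \<Rightarrow> complex) \<Rightarrow> (('h \<times> 'h \<Rightarrow> complex) \<times> 'h \<Rightarrow> complex)"
  where "pmu_second g \<rho> \<sigma> \<sigma>h V =
    (let R = (whole, \<rho>); S = (whole, \<sigma>); Sh = (whole, \<sigma>h) in
      rel_op g Opp (rel_leg1 g Alg Sh R \<rho>) S (rel_leg2 g Opp R S \<rho>) S V id \<circ>
      rel_flip23 g \<rho> \<sigma> \<sigma>h \<circ>
      rel_op g Alg (rel_leg2 g Alg Sh R \<sigma>) R (rel_leg1 g Opp R S \<sigma>h) R V id \<circ>
      rel_assoc_inv g Alg \<sigma>h \<rho> Alg \<sigma> \<rho> \<circ>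
      rel_op g Alg Sh (rel_leg2 g Opp R S \<rho>) Sh (rel_leg1 g Alg S R \<rho>) id (rel_flip g Opp R S) \<circ>
      rel_op g Alg Sh (rel_leg1 g Alg Sh R \<rho>) Sh (rel_leg2 g Opp R S \<rho>) id V \<circ>
      rel_assoc g Alg \<sigma>h \<rho> Alg \<sigma>h \<rho>)"

definition pseudo_mult_unitary :: "('n::fd_cstar_algebra, 'm::fd_hilbert) gns \<Rightarrow>
    ('n \<Rightarrow> 'h \<Rightarrow> 'h) \<Rightarrow> ('n \<Rightarrow> 'h \<Rightarrow> 'h) \<Rightarrow> ('n \<Rightarrow> 'h \<Rightarrow> 'h::fd_hilbert) \<Rightarrow>
    (('h \<times> 'h \<Rightarrow> complex) \<Rightarrow> ('h \<times> 'h \<Rightarrow> complex)) \<Rightarrow> bool"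
  where "pseudo_mult_unitary g \<rho> \<sigma> \<sigma>h V \<longleftrightarrow>
    (let R = (whole, \<rho>); S = (whole, \<sigma>); Sh = (whole, \<sigma>h);
         A = rel_tensor g Alg Sh R; B = rel_tensor g Opp R S;
         left_A = (\<lambda>T. rel_op g Alg Sh R Sh R T id); right_A = (\<lambda>T. rel_op g Alg Sh R Sh R id T);
         left_B = (\<lambda>T. rel_op g Opp R S R S T id); right_B = (\<lambda>T. rel_op g Opp R S R S id T)
     in unitary_op A B V \<and>
      (\<forall>y. \<forall>v\<in>carr A. V (left_A (\<rho> y) v) = right_B (\<rho> y) (V v)) \<and>
      (\<forall>x. \<forall>v\<in>carr A. V (left_A (\<sigma> x) v) = left_B (\<sigma> x) (V v)) \<and>
      (\<forall>x. \<forall>v\<in>carr A. V (right_A (\<sigma> x) v) = left_B (\<sigma>h x) (V v)) \<and>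
      (\<forall>x. \<forall>v\<in>carr A. V (right_A (\<sigma>h x) v) = right_B (\<sigma>h x) (V v)) \<and>
      (\<forall>v\<in>carr (rel_tensor g Alg (rel_leg2 g Alg Sh R \<sigma>h) R).
        rel_assoc g Opp \<rho> \<sigma> Opp \<rho> \<sigma> (pmu_second g \<rho> \<sigma> \<sigma>h V v) = pmu_first g \<rho> \<sigma> \<sigma>h V v))"

section \<open>C*-bases and C*-factorizations\<close>

definition cstar_subalgebra :: "('k::fd_hilbert \<Rightarrow> 'k) set \<Rightarrow> bool"
  where "cstar_subalgebra C \<longleftrightarrow> csubspace C \<and>
    (\<forall>a\<in>C. clinear a \<and> adj whole whole a \<in> C \<and> (\<forall>b\<in>C. a \<circ> b \<in> C))"

definition cstar_base :: "('k::fd_hilbert \<Rightarrow> 'k) set \<Rightarrow> ('k \<Rightarrow> 'k) set \<Rightarrow> bool"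
  where "cstar_base C Cd \<longleftrightarrow> cstar_subalgebra C \<and> cstar_subalgebra Cd \<and>
    cspan {c \<omega> | c \<omega>. c \<in> C} = UNIV \<and> cspan {c \<omega> | c \<omega>. c \<in> Cd} = UNIV \<and>
    (\<forall>c\<in>C. \<forall>d\<in>Cd. c \<circ> d = d \<circ> c)"

definition bicyclic :: "('k::fd_hilbert \<Rightarrow> 'k) set \<Rightarrow> ('k \<Rightarrow> 'k) set \<Rightarrow> 'k \<Rightarrow> bool"
  where "bicyclic C Cd z \<longleftrightarrow> cspan {c z | c. c \<in> C} = UNIV \<and> cspan {c z | c. c \<in> Cd} = UNIV"

definition cstar_factorization :: "('k::fd_hilbert \<Rightarrow> 'k) set \<Rightarrow> ('k \<Rightarrow> 'k) set \<Rightarrow>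
    'a::complex_vector hilb \<Rightarrow> ('k \<Rightarrow> 'a) set \<Rightarrow> bool"
  where "cstar_factorization C Cd K \<gamma> \<longleftrightarrow> cstar_base C Cd \<and> csubspace \<gamma> \<and>
    (\<forall>\<xi>\<in>\<gamma>. clinear \<xi> \<and> range \<xi> \<subseteq> carr K) \<and>
    cspan {adj whole K \<xi> \<circ> \<xi>' | \<xi> \<xi>'. \<xi> \<in> \<gamma> \<and> \<xi>' \<in> \<gamma>} = C \<and>
    cspan {\<xi> \<circ> c | \<xi> c. \<xi> \<in> \<gamma> \<and> c \<in> C} = \<gamma> \<and>
    cspan {\<xi> \<omega> | \<xi> \<omega>. \<xi> \<in> \<gamma>} = carr K"

text \<open>The representation \<open>\<rho>\<^sub>\<gamma>\<close>, to be applied to the elements of the second algebra of the base.\<close>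

definition fact_rep :: "('k::fd_hilbert \<Rightarrow> 'a::complex_vector) set \<Rightarrow> ('k \<Rightarrow> 'k) \<Rightarrow> 'a \<Rightarrow> 'a"
  where "fact_rep \<gamma> c = lin_ext {(\<xi> \<omega>, \<xi> (c \<omega>)) | \<xi> \<omega>. \<xi> \<in> \<gamma>}"

text \<open>\<open>Cd\<close> and \<open>Dd\<close> are the domains of \<open>\<rho>\<^sub>\<gamma>\<close> and \<open>\<rho>\<^sub>\<delta>\<close>.\<close>

definition compatible :: "('k::fd_hilbert \<Rightarrow> 'k) set \<Rightarrow> ('k \<Rightarrow> 'a::complex_vector) set \<Rightarrow>
    ('k \<Rightarrow> 'k) set \<Rightarrow> ('k \<Rightarrow> 'a) set \<Rightarrow> bool"
  where "compatible Cd \<gamma> Dd \<delta> \<longleftrightarrow>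
    cspan {fact_rep \<gamma> c \<circ> \<eta> | c \<eta>. c \<in> Cd \<and> \<eta> \<in> \<delta>} = \<delta> \<and>
    cspan {fact_rep \<delta> d \<circ> \<xi> | d \<xi>. d \<in> Dd \<and> \<xi> \<in> \<gamma>} = \<gamma>"

section \<open>C*-relative tensor products\<close>

text \<open>A Hilbert space \<open>K\<close> together with a C*-factorization \<open>\<gamma>\<close> of it is given as the pair \<open>(K, \<gamma>)\<close>.\<close>

type_synonym ('k, 'a) fact_space = "'a hilb \<times> ('k \<Rightarrow> 'a) set"

type_synonym ('k, 'a, 'b) cten = "('k \<Rightarrow> 'a) \<times> 'k \<times> ('k \<Rightarrow> 'b) \<Rightarrow> complex"

definition c_kernel :: "('k::fd_hilbert, 'a) fact_space \<Rightarrow> ('k, 'b) fact_space \<Rightarrow>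
    ('k \<Rightarrow> 'a) \<times> 'k \<times> ('k \<Rightarrow> 'b) \<Rightarrow> ('k \<Rightarrow> 'a) \<times> 'k \<times> ('k \<Rightarrow> 'b) \<Rightarrow> complex"
  where "c_kernel P Q = (\<lambda>(\<xi>, \<omega>, \<eta>) (\<xi>', \<omega>', \<eta>').
    cinner \<omega> (adj whole (fst P) \<xi> (\<xi>' (adj whole (fst Q) \<eta> (\<eta>' \<omega>')))))"

definition c_tensor :: "('k::fd_hilbert, 'a) fact_space \<Rightarrow> ('k, 'b) fact_space \<Rightarrow>
    ('k, 'a, 'b) cten hilb"
  where "c_tensor P Q = sep_space (snd P \<times> UNIV \<times> snd Q) (c_kernel P Q)"

definition c_vec :: "('k::fd_hilbert, 'a) fact_space \<Rightarrow> ('k, 'b) fact_space \<Rightarrow>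
    ('k \<Rightarrow> 'a) \<Rightarrow> 'k \<Rightarrow> ('k \<Rightarrow> 'b) \<Rightarrow> ('k, 'a, 'b) cten"
  where "c_vec P Q \<xi> \<omega> \<eta> = sep_class (snd P \<times> UNIV \<times> snd Q) (c_kernel P Q) (\<xi>, \<omega>, \<eta>)"

definition ket1 :: "('k::fd_hilbert, 'a) fact_space \<Rightarrow> ('k, 'b::complex_vector) fact_space \<Rightarrow>
    ('k \<Rightarrow> 'a) \<Rightarrow> 'b \<Rightarrow> ('k, 'a, 'b) cten"
  where "ket1 P Q \<xi> = lin_ext {(\<eta> \<omega>, c_vec P Q \<xi> \<omega> \<eta>) | \<eta> \<omega>. \<eta> \<in> snd Q}"

definition ket2 :: "('k::fd_hilbert, 'a::complex_vector) fact_space \<Rightarrow> ('k, 'b) fact_space \<Rightarrow>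
    ('k \<Rightarrow> 'b) \<Rightarrow> 'a \<Rightarrow> ('k, 'a, 'b) cten"
  where "ket2 P Q \<eta> = lin_ext {(\<xi> \<omega>, c_vec P Q \<xi> \<omega> \<eta>) | \<xi> \<omega>. \<xi> \<in> snd P}"

text \<open>
  For \<open>P = (K, \<gamma>)\<close> and \<open>Q = (L, \<delta>)\<close>, these are the factorizations of the tensor product of \<open>P, Q\<close>
  usually denoted \<open>\<gamma> \<triangleright> \<epsilon>\<close> (for \<open>\<epsilon>\<close> on \<open>L\<close>) and \<open>\<epsilon> \<triangleleft> \<delta>\<close> (for \<open>\<epsilon>\<close> on \<open>K\<close>).
\<close>

definition fact_right :: "('k::fd_hilbert, 'a) fact_space \<Rightarrow> ('k, 'b::complex_vector) fact_space \<Rightarrow>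
    ('k \<Rightarrow> 'b) set \<Rightarrow> ('k \<Rightarrow> ('k, 'a, 'b) cten) set"
  where "fact_right P Q \<epsilon> = cspan {ket1 P Q \<xi> \<circ> e | \<xi> e. \<xi> \<in> snd P \<and> e \<in> \<epsilon>}"

definition fact_left :: "('k::fd_hilbert, 'a::complex_vector) fact_space \<Rightarrow> ('k, 'b) fact_space \<Rightarrow>
    ('k \<Rightarrow> 'a) set \<Rightarrow> ('k \<Rightarrow> ('k, 'a, 'b) cten) set"
  where "fact_left P Q \<epsilon> = cspan {ket2 P Q \<eta> \<circ> e | \<eta> e. \<eta> \<in> snd Q \<and> e \<in> \<epsilon>}"

definition c_leg1 :: "('k::fd_hilbert, 'a::complex_vector) fact_space \<Rightarrow> ('k, 'b) fact_space \<Rightarrow>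
    ('k \<Rightarrow> 'a) set \<Rightarrow> ('k, ('k, 'a, 'b) cten) fact_space"
  where "c_leg1 P Q \<epsilon> = (c_tensor P Q, fact_left P Q \<epsilon>)"

definition c_leg2 :: "('k::fd_hilbert, 'a) fact_space \<Rightarrow> ('k, 'b::complex_vector) fact_space \<Rightarrow>
    ('k \<Rightarrow> 'b) set \<Rightarrow> ('k, ('k, 'a, 'b) cten) fact_space"
  where "c_leg2 P Q \<epsilon> = (c_tensor P Q, fact_right P Q \<epsilon>)"

definition c_op :: "('k::fd_hilbert, 'a) fact_space \<Rightarrow> ('k, 'b) fact_space \<Rightarrow>
    ('k, 'c) fact_space \<Rightarrow> ('k, 'd) fact_space \<Rightarrow>
    ('a \<Rightarrow> 'c) \<Rightarrow> ('b \<Rightarrow> 'd) \<Rightarrow> ('k, 'a, 'b) cten \<Rightarrow> ('k, 'c, 'd) cten"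
  where "c_op P Q P' Q' S T = lin_ext
    {(c_vec P Q \<xi> \<omega> \<eta>, c_vec P' Q' (S \<circ> \<xi>) \<omega> (T \<circ> \<eta>)) | \<xi> \<omega> \<eta>. \<xi> \<in> snd P \<and> \<eta> \<in> snd Q}"

text \<open>
  The identification of the iterated products formed from \<open>\<gamma>, \<delta>\<close> (first tensor sign) and \<open>\<epsilon>, \<phi>\<close>
  (second tensor sign) on three copies of \<open>H\<close>, and its inverse.
\<close>

definition c_assoc ::
    "('k::fd_hilbert \<Rightarrow> 'h) set \<Rightarrow> ('k \<Rightarrow> 'h) set \<Rightarrow> ('k \<Rightarrow> 'h) set \<Rightarrow> ('k \<Rightarrow> 'h::fd_hilbert) set \<Rightarrow>
    ('k, ('k, 'h, 'h) cten, 'h) cten \<Rightarrow> ('k, 'h, ('k, 'h, 'h) cten) cten"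
  where "c_assoc \<gamma> \<delta> \<epsilon> \<phi> =
    (let C = (whole, \<gamma>); D = (whole, \<delta>); E = (whole, \<epsilon>); F = (whole, \<phi>) in lin_ext
      {(ket2 (c_leg2 C D \<epsilon>) F \<eta> (ket1 C D \<xi> x), ket1 C (c_leg1 E F \<delta>) \<xi> (ket2 E F \<eta> x)) | \<xi> \<eta> x.
        \<xi> \<in> \<gamma> \<and> \<eta> \<in> \<phi>})"

definition c_assoc_inv ::
    "('k::fd_hilbert \<Rightarrow> 'h) set \<Rightarrow> ('k \<Rightarrow> 'h) set \<Rightarrow> ('k \<Rightarrow> 'h) set \<Rightarrow> ('k \<Rightarrow> 'h::fd_hilbert) set \<Rightarrow>
    ('k, 'h, ('k, 'h, 'h) cten) cten \<Rightarrow> ('k, ('k, 'h, 'h) cten, 'h) cten"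
  where "c_assoc_inv \<gamma> \<delta> \<epsilon> \<phi> =
    (let C = (whole, \<gamma>); D = (whole, \<delta>); E = (whole, \<epsilon>); F = (whole, \<phi>) in lin_ext
      {(ket1 C (c_leg1 E F \<delta>) \<xi> (ket2 E F \<eta> x), ket2 (c_leg2 C D \<epsilon>) F \<eta> (ket1 C D \<xi> x)) | \<xi> \<eta> x.
        \<xi> \<in> \<gamma> \<and> \<eta> \<in> \<phi>})"

definition c_flip :: "('k::fd_hilbert, 'h) fact_space \<Rightarrow> ('k, 'h) fact_space \<Rightarrow>
    ('k, 'h, 'h) cten \<Rightarrow> ('k, 'h, 'h) cten"
  where "c_flip P Q = lin_ext
    {(c_vec P Q \<xi> \<omega> \<eta>, c_vec Q P \<eta> \<omega> \<xi>) | \<xi> \<omega> \<eta>. \<xi> \<in> snd P \<and> \<eta> \<in> snd Q}"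

definition c_flip23 ::
    "('k::fd_hilbert \<Rightarrow> 'h) set \<Rightarrow> ('k \<Rightarrow> 'h) set \<Rightarrow> ('k \<Rightarrow> 'h::fd_hilbert) set \<Rightarrow>
    ('k, ('k, 'h, 'h) cten, 'h) cten \<Rightarrow> ('k, ('k, 'h, 'h) cten, 'h) cten"
  where "c_flip23 \<alpha> \<beta> \<beta>h =
    (let A = (whole, \<alpha>); B = (whole, \<beta>); Bh = (whole, \<beta>h) in lin_ext
      {(ket2 (c_leg1 A B \<beta>h) A \<eta> (ket2 A B \<xi> x), ket2 (c_leg1 Bh A \<alpha>) B \<xi> (ket2 Bh A \<eta> x)) | \<xi> \<eta> x.
        \<xi> \<in> \<beta> \<and> \<eta> \<in> \<alpha>})"

section \<open>C*-pseudo-multiplicative unitaries\<close>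

text \<open>The bracketings are as for pseudo-multiplicative unitaries.\<close>

definition c_pmu_first ::
    "('k::fd_hilbert \<Rightarrow> 'h) set \<Rightarrow> ('k \<Rightarrow> 'h) set \<Rightarrow> ('k \<Rightarrow> 'h::fd_hilbert) set \<Rightarrow>
    (('k, 'h, 'h) cten \<Rightarrow> ('k, 'h, 'h) cten) \<Rightarrow>
    ('k, ('k, 'h, 'h) cten, 'h) cten \<Rightarrow> ('k, 'h, ('k, 'h, 'h) cten) cten"
  where "c_pmu_first \<alpha> \<beta> \<beta>h V =
    (let A = (whole, \<alpha>); B = (whole, \<beta>); Bh = (whole, \<beta>h) in
      c_op A (c_leg1 Bh A \<beta>) A (c_leg1 A B \<beta>) id V \<circ>
      c_assoc \<alpha> \<beta> \<beta>h \<alpha> \<circ>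
      c_op (c_leg2 Bh A \<beta>h) A (c_leg2 A B \<beta>h) A V id)"

definition c_pmu_second ::
    "('k::fd_hilbert \<Rightarrow> 'h) set \<Rightarrow> ('k \<Rightarrow> 'h) set \<Rightarrow> ('k \<Rightarrow> 'h::fd_hilbert) set \<Rightarrow>
    (('k, 'h, 'h) cten \<Rightarrow> ('k, 'h, 'h) cten) \<Rightarrow>
    ('k, ('k, 'h, 'h) cten, 'h) cten \<Rightarrow> ('k, ('k, 'h, 'h) cten, 'h) cten"
  where "c_pmu_second \<alpha> \<beta> \<beta>h V =
    (let A = (whole, \<alpha>); B = (whole, \<beta>); Bh = (whole, \<beta>h) in
      c_op (c_leg1 Bh A \<alpha>) B (c_leg2 A B \<alpha>) B V id \<circ>
      c_flip23 \<alpha> \<beta> \<beta>h \<circ>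
      c_op (c_leg2 Bh A \<beta>) A (c_leg1 A B \<beta>h) A V id \<circ>
      c_assoc_inv \<beta>h \<alpha> \<beta> \<alpha> \<circ>
      c_op Bh (c_leg2 A B \<alpha>) Bh (c_leg1 B A \<alpha>) id (c_flip A B) \<circ>
      c_op Bh (c_leg1 Bh A \<alpha>) Bh (c_leg2 A B \<alpha>) id V \<circ>
      c_assoc \<beta>h \<alpha> \<beta>h \<alpha>)"

definition cstar_pseudo_mult_unitary ::
    "('k::fd_hilbert \<Rightarrow> 'h) set \<Rightarrow> ('k \<Rightarrow> 'h) set \<Rightarrow> ('k \<Rightarrow> 'h::fd_hilbert) set \<Rightarrow>
    (('k, 'h, 'h) cten \<Rightarrow> ('k, 'h, 'h) cten) \<Rightarrow> bool"
  where "cstar_pseudo_mult_unitary \<alpha> \<beta> \<beta>h V \<longleftrightarrow>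
    (let A = (whole, \<alpha>); B = (whole, \<beta>); Bh = (whole, \<beta>h) in
      unitary_op (c_tensor Bh A) (c_tensor A B) V \<and>
      (\<lambda>\<xi>. V \<circ> \<xi>) ` fact_left Bh A \<alpha> = fact_right A B \<alpha> \<and>
      (\<lambda>\<xi>. V \<circ> \<xi>) ` fact_right Bh A \<beta> = fact_left A B \<beta>h \<and>
      (\<lambda>\<xi>. V \<circ> \<xi>) ` fact_right Bh A \<beta>h = fact_right A B \<beta>h \<and>
      (\<lambda>\<xi>. V \<circ> \<xi>) ` fact_left Bh A \<beta> = fact_left A B \<beta> \<and>
      (\<forall>v\<in>carr (c_tensor (c_leg2 Bh A \<beta>h) A).
        c_assoc \<alpha> \<beta> \<alpha> \<beta> (c_pmu_second \<alpha> \<beta> \<beta>h V v) = c_pmu_first \<alpha> \<beta> \<beta>h V v))"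

section \<open>The canonical unitaries\<close>

text \<open>For \<open>s = Alg\<close> and \<open>s = Opp\<close>, respectively, \<open>\<kappa>\<close> represents \<open>N\<close> and \<open>N\<^sup>o\<^sup>p\<close>, as in \<open>rel_tensor\<close>.\<close>

definition canonical_unitary :: "('n::fd_cstar_algebra, 'm::fd_hilbert) gns \<Rightarrow>
    ('k::fd_hilbert \<Rightarrow> 'm) \<Rightarrow> 'k \<Rightarrow> side \<Rightarrow>
    ('n \<Rightarrow> 'h \<Rightarrow> 'h) \<Rightarrow> ('n \<Rightarrow> 'h \<Rightarrow> 'h) \<Rightarrow> ('k \<Rightarrow> 'h) set \<Rightarrow> ('k \<Rightarrow> 'h::fd_hilbert) set \<Rightarrow>
    ('h \<times> 'h \<Rightarrow> complex) \<Rightarrow> ('k, 'h, 'h) cten"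
  where "canonical_unitary g U z s \<kappa> \<tau> \<gamma> \<delta> = lin_ext
    {(rel_vec g s (whole, \<kappa>) (whole, \<tau>) \<xi> \<eta>,
      c_vec (whole, \<gamma>) (whole, \<delta>) (R_op g s \<kappa> \<xi> \<circ> U) z (R_op g (flip s) \<tau> \<eta> \<circ> U)) | \<xi> \<eta>. True}"

end

theory Submission
  imports Defs
begin

text \<open>
  Since \<open>\<zeta>\<close> is bicyclic, evaluation at \<open>\<zeta>\<close> identifies a C*-factorization with the Hilbert space on
  which it lives, and the factorization is the space of all operators intertwining the represented
  algebra. Hence a unitary maps one factorization onto another if and only if it intertwines the
  two representations, which matches the four conditions on \<open>V\<close> in both definitions. The operators
  \<open>R(\<xi>)\<^sup>* R(\<xi>')\<close> lie in the commutant of \<open>N\<close>, hence in the opposite algebra, which lets the inner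
  products on both relative tensor products be computed by the same formula. The canonical
  unitaries therefore exist for all twofold and threefold products, and they carry each factor of
  the composites in one definition to the corresponding factor in the other.
\<close>

section \<open>Linear extensions and Hermitian spaces\<close>

text \<open>The obstacle is that nearly every map here is a \<open>lin_ext\<close>, a definite
  description over the span of a set of pairs, which means something only once that span is
  single-valued. Single-valuedness comes mainly from an adjoint given on generators
  (\<open>well_defI\<close>) or from equality of two Gram matrices (\<open>well_def_gram\<close>).
  For the arrows of the composites it is proved on relative tensor products only:
  \<open>lin_ext_transport\<close> identifies an operator on the C*-side as soon as its graph is the
  image of a known graph under the canonical unitaries. Graphs on the C*-side often carry an extra
  middle vector; absorbing it into a neighbouring factor (\<open>c_vec_left\<close>,
  \<open>c_vec_right\<close>) makes the graphs coincide. An induced operator such as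
  \<open>V\<close> tensor identity is under control once \<open>V\<close> intertwines the
  representations involved. The pentagons are therefore compared under the four intertwining
  conditions, each of which is matched separately.\<close>

lemma clinear_iff:
  "clinear f \<longleftrightarrow> (\<forall>x y. f (x + y) = f x + f y) \<and> (\<forall>c x. f (c *\<^sub>C x) = c *\<^sub>C f x)"
  by (simp add: Vector_Spaces.linear_iff complex_vector.vector_space_axioms)

lemma clinear_add: "clinear f \<Longrightarrow> f (x + y) = f x + f y"
  and clinear_scale: "clinear f \<Longrightarrow> f (c *\<^sub>C x) = c *\<^sub>C f x"
  by (simp_all add: clinear_iff)

lemma clinear_zero: "clinear f \<Longrightarrow> f 0 = 0"
  by (metis clinear_scale complex_vector.scale_zero_left)

lemma clinear_diff: "clinear f \<Longrightarrow> f (x - y) = f x - f y"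
  by (metis add_diff_cancel clinear_add diff_add_cancel)

lemma clinear_compose: "clinear f \<Longrightarrow> clinear h \<Longrightarrow> clinear (\<lambda>x. h (f x))"
  by (simp add: clinear_iff)

text \<open>Testing over 0 is enough: the span is a subspace, so two values over one point differ by
  a value over 0.\<close>

definition well_def :: "('a::complex_vector \<times> 'b::complex_vector) set \<Rightarrow> bool"
  where "well_def G \<longleftrightarrow> (\<forall>y. (0, y) \<in> cspan G \<longrightarrow> y = 0)"

lemma lin_ext_eq:
  assumes "well_def G" "(x, y) \<in> cspan G"
  shows "lin_ext G x = y"
  unfolding lin_ext_def
proof (rule the_equality)
  fix y' assume "(x, y') \<in> cspan G"
  then have "(x, y') - (x, y) \<in> cspan G"
    using assms(2) by (rule complex_vector.span_diff)
  then have "(0, y' - y) \<in> cspan G" by simp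
  then have "y' - y = 0"
    using assms(1) unfolding well_def_def by blast
  then show "y' = y" by simp
qed (fact assms(2))

lemma lin_ext_base: "well_def G \<Longrightarrow> (x, y) \<in> G \<Longrightarrow> lin_ext G x = y"
  by (simp add: lin_ext_eq complex_vector.span_base)

lemma subspace_exists_pair:
  assumes "csubspace S"
  shows "csubspace {x. \<exists>y. (x, y) \<in> S}"
proof (rule complex_vector.subspaceI)
  show "0 \<in> {x. \<exists>y. (x, y) \<in> S}"
    using complex_vector.subspace_0[OF assms] by (auto simp: zero_prod_def)
next
  fix x y assume "x \<in> {x. \<exists>y. (x, y) \<in> S}" "y \<in> {x. \<exists>y. (x, y) \<in> S}"
  then obtain u v where "(x, u) \<in> S" "(y, v) \<in> S" by auto
  then have "(x, u) + (y, v) \<in> S" by (rule complex_vector.subspace_add[OF assms])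
  then show "x + y \<in> {x. \<exists>y. (x, y) \<in> S}" by auto
next
  fix c x assume "x \<in> {x. \<exists>y. (x, y) \<in> S}"
  then obtain u where "(x, u) \<in> S" by auto
  then have "c *\<^sub>C (x, u) \<in> S" by (rule complex_vector.subspace_scale[OF assms])
  then show "c *\<^sub>C x \<in> {x. \<exists>y. (x, y) \<in> S}" by (auto simp: scaleC_prod_def)
qed

lemma lin_ext_graph:
  assumes "well_def G" "x \<in> cspan (fst ` G)"
  shows "(x, lin_ext G x) \<in> cspan G"
proof -
  have "\<exists>y. (x, y) \<in> cspan G"
    using assms(2)
  proof (induction rule: complex_vector.span_induct)
    show "csubspace {x. \<exists>y. (x, y) \<in> cspan G}"
      by (intro subspace_exists_pair complex_vector.subspace_span)
  qed (force dest: complex_vector.span_base)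
  then show ?thesis using lin_ext_eq[OF assms(1)] by metis
qed

text \<open>Everything is restricted to the carriers because \<open>lin_ext\<close> and
  \<open>inv_into\<close> are unspecified outside them.\<close>

definition chom :: "'a::complex_vector hilb \<Rightarrow> 'b::complex_vector hilb \<Rightarrow> ('a \<Rightarrow> 'b) \<Rightarrow> bool"
  where "chom K L T \<longleftrightarrow> (\<forall>x\<in>carr K. T x \<in> carr L) \<and>
    (\<forall>x\<in>carr K. \<forall>y\<in>carr K. T (x + y) = T x + T y) \<and>
    (\<forall>c. \<forall>x\<in>carr K. T (c *\<^sub>C x) = c *\<^sub>C T x)"

lemma chom_carr: "chom K L T \<Longrightarrow> x \<in> carr K \<Longrightarrow> T x \<in> carr L"
  and chom_add: "chom K L T \<Longrightarrow> x \<in> carr K \<Longrightarrow> y \<in> carr K \<Longrightarrow> T (x + y) = T x + T y"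
  and chom_scale: "chom K L T \<Longrightarrow> x \<in> carr K \<Longrightarrow> T (c *\<^sub>C x) = c *\<^sub>C T x"
  by (simp_all add: chom_def)

lemma chom_compose: "chom K L S \<Longrightarrow> chom L M T \<Longrightarrow> chom K M (T \<circ> S)"
  by (simp add: chom_def)

lemma chom_whole: "chom whole whole T \<longleftrightarrow> clinear T"
  by (simp add: chom_def clinear_iff whole_def)

lemma chom_lin_ext:
  assumes "well_def G" "carr X = cspan (fst ` G)" "snd ` G \<subseteq> carr Y" "csubspace (carr Y)"
  shows "chom X Y (lin_ext G)"
proof -
  have snd: "y \<in> carr Y" if "(x, y) \<in> cspan G" for x y
  proof -
    have "snd (x, y) \<in> carr Y" using that
    proof (induction rule: complex_vector.span_induct)
      show "csubspace {p. snd p \<in> carr Y}"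
        using assms(4) by (auto simp: complex_vector.subspace_def scaleC_prod_def)
    qed (use assms(3) in auto)
    then show ?thesis by simp
  qed
  note graph = lin_ext_graph[OF assms(1), folded assms(2)]
  show ?thesis
    unfolding chom_def
  proof (intro conjI ballI allI)
    fix x assume "x \<in> carr X" then show "lin_ext G x \<in> carr Y" by (blast intro: snd graph)
  next
    fix x y assume "x \<in> carr X" "y \<in> carr X"
    then have "(x, lin_ext G x) + (y, lin_ext G y) \<in> cspan G"
      by (intro complex_vector.span_add graph)
    then show "lin_ext G (x + y) = lin_ext G x + lin_ext G y"
      by (intro lin_ext_eq[OF assms(1)]) simp
  next
    fix c x assume "x \<in> carr X"
    then have "c *\<^sub>C (x, lin_ext G x) \<in> cspan G"
      by (intro complex_vector.span_scale graph)
    then show "lin_ext G (c *\<^sub>C x) = c *\<^sub>C lin_ext G x"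
      by (intro lin_ext_eq[OF assms(1)]) (simp add: scaleC_prod_def)
  qed
qed

lemma subspace_chom_eq:
  assumes "csubspace (carr X)" "chom X Y S" "chom X Y T"
  shows "csubspace {x \<in> carr X. S x = T x}"
proof -
  have "S 0 = 0" "T 0 = 0"
    using assms chom_scale[of X Y _ 0 0] complex_vector.subspace_0[OF assms(1)] by auto
  then show ?thesis
    using assms by (auto simp: complex_vector.subspace_def chom_add chom_scale)
qed

lemma chom_eqI:
  assumes "carr X = cspan F" "chom X Y S" "chom X Y T" "\<And>x. x \<in> F \<Longrightarrow> S x = T x" "x \<in> carr X"
  shows "S x = T x"
proof -
  have F: "F \<subseteq> carr X" "csubspace (carr X)"
    using assms(1) complex_vector.span_superset[of F] complex_vector.subspace_span[of F] by auto
  have "cspan F \<subseteq> {x \<in> carr X. S x = T x}"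
    by (rule complex_vector.span_minimal[OF _ subspace_chom_eq[OF F(2) assms(2,3)]])
      (use F assms(4) in blast)
  then show ?thesis using assms(1,5) by blast
qed

text \<open>Applied to a pair-valued \<open>f\<close>, this says that a graph parametrized linearly
  by a subspace is its own span, so membership in \<open>cspan\<close> becomes explicit.\<close>

lemma cspan_linear_graph:
  assumes "csubspace S" "\<And>x y. x \<in> S \<Longrightarrow> y \<in> S \<Longrightarrow> f (x + y) = f x + f y"
    "\<And>c x. x \<in> S \<Longrightarrow> f (c *\<^sub>C x) = c *\<^sub>C f x"
  shows "cspan (f ` S) = f ` S"
proof (rule complex_vector.span_eq_iff[THEN iffD2], rule complex_vector.subspaceI)
  have "f 0 = 0" using assms(3)[of 0 0] complex_vector.subspace_0[OF assms(1)] by simp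
  then show "0 \<in> f ` S" using complex_vector.subspace_0[OF assms(1)] by (metis imageI)
next
  fix x y assume "x \<in> f ` S" "y \<in> f ` S"
  then show "x + y \<in> f ` S"
    using assms(2) complex_vector.subspace_add[OF assms(1)] by (auto simp flip: assms(2))
next
  fix c x assume "x \<in> f ` S"
  then show "c *\<^sub>C x \<in> f ` S"
    using complex_vector.subspace_scale[OF assms(1)] by (auto simp flip: assms(3))
qed

text \<open>The graph equals its span, and injectivity of \<open>f\<close> leaves only
  \<open>x = 0\<close> over 0; well-definedness comes without any inner product.\<close>

lemma lin_ext_linear_graph:
  assumes S: "csubspace S"
    and f: "\<And>x y. x \<in> S \<Longrightarrow> y \<in> S \<Longrightarrow> f (x + y) = f x + f y"
      "\<And>c x. x \<in> S \<Longrightarrow> f (c *\<^sub>C x) = c *\<^sub>C f x"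
    and h: "\<And>x y. x \<in> S \<Longrightarrow> y \<in> S \<Longrightarrow> h (x + y) = h x + h y"
      "\<And>c x. x \<in> S \<Longrightarrow> h (c *\<^sub>C x) = c *\<^sub>C h x"
    and inj: "\<And>x. x \<in> S \<Longrightarrow> f x = 0 \<Longrightarrow> x = 0"
    and x: "x \<in> S"
  shows "lin_ext ((\<lambda>x. (f x, h x)) ` S) (f x) = h x"
proof -
  let ?G = "(\<lambda>x. (f x, h x)) ` S"
  have span: "cspan ?G = ?G"
    by (rule cspan_linear_graph[OF S]) (simp_all add: f h scaleC_prod_def)
  have "h 0 = 0" using h(2)[of 0 0] complex_vector.subspace_0[OF S] by simp
  then have "well_def ?G"
    unfolding well_def_def span using inj by force
  then show ?thesis using x by (intro lin_ext_base) auto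
qed

text \<open>A nondegenerate Hermitian form is what uniqueness arguments and Gram matrices require,
  and the separated space of every Hermitian kernel carries one
  (\<open>hspace_sep_space\<close>).\<close>

definition hspace :: "'a::complex_vector hilb \<Rightarrow> bool"
  where "hspace K \<longleftrightarrow> csubspace (carr K) \<and>
    (\<forall>x\<in>carr K. \<forall>y\<in>carr K. \<forall>z\<in>carr K. ip K x (y + z) = ip K x y + ip K x z) \<and>
    (\<forall>c. \<forall>x\<in>carr K. \<forall>y\<in>carr K. ip K x (c *\<^sub>C y) = c * ip K x y) \<and>
    (\<forall>x\<in>carr K. \<forall>y\<in>carr K. cnj (ip K y x) = ip K x y) \<and>
    (\<forall>y\<in>carr K. (\<forall>x\<in>carr K. ip K x y = 0) \<longrightarrow> y = 0)"

lemma hspace_subspace: "hspace K \<Longrightarrow> csubspace (carr K)"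
  by (simp add: hspace_def)

lemma ip_add_right: "hspace K \<Longrightarrow> x \<in> carr K \<Longrightarrow> y \<in> carr K \<Longrightarrow> z \<in> carr K \<Longrightarrow>
    ip K x (y + z) = ip K x y + ip K x z"
  by (simp add: hspace_def)

lemma ip_scale_right: "hspace K \<Longrightarrow> x \<in> carr K \<Longrightarrow> y \<in> carr K \<Longrightarrow>
    ip K x (c *\<^sub>C y) = c * ip K x y"
  by (simp add: hspace_def)

lemma ip_commute: "hspace K \<Longrightarrow> x \<in> carr K \<Longrightarrow> y \<in> carr K \<Longrightarrow> ip K x y = cnj (ip K y x)"
  by (simp add: hspace_def)

lemma ip_nondegenerate: "hspace K \<Longrightarrow> y \<in> carr K \<Longrightarrow>
    (\<And>x. x \<in> carr K \<Longrightarrow> ip K x y = 0) \<Longrightarrow> y = 0"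
  by (simp add: hspace_def)

lemma hspace_add: "hspace K \<Longrightarrow> x \<in> carr K \<Longrightarrow> y \<in> carr K \<Longrightarrow> x + y \<in> carr K"
  by (rule complex_vector.subspace_add[OF hspace_subspace])

lemma hspace_scale: "hspace K \<Longrightarrow> x \<in> carr K \<Longrightarrow> c *\<^sub>C x \<in> carr K"
  by (rule complex_vector.subspace_scale[OF hspace_subspace])

lemma hspace_zero: "hspace K \<Longrightarrow> 0 \<in> carr K"
  by (rule complex_vector.subspace_0[OF hspace_subspace])

lemma ip_zero_right: "hspace K \<Longrightarrow> x \<in> carr K \<Longrightarrow> ip K x 0 = 0"
  using ip_scale_right[of K x 0 0] by (simp add: hspace_zero)

lemma ip_add_left: "hspace K \<Longrightarrow> x \<in> carr K \<Longrightarrow> y \<in> carr K \<Longrightarrow> z \<in> carr K \<Longrightarrow>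
    ip K (x + y) z = ip K x z + ip K y z"
  by (simp add: ip_commute[of K _ z] ip_add_right hspace_add)

lemma ip_scale_left: "hspace K \<Longrightarrow> x \<in> carr K \<Longrightarrow> y \<in> carr K \<Longrightarrow>
    ip K (c *\<^sub>C x) y = cnj c * ip K x y"
  by (simp add: ip_commute[of K _ y] ip_scale_right hspace_scale)

lemma cinner_zero_right: "cinner (x::'a::fd_hilbert) 0 = 0"
  using cinner_scaleC_right[of x 0 0] by simp

lemma hspace_whole: "hspace (whole :: 'a::fd_hilbert hilb)"
proof -
  have "cnj (cinner y x) = cinner x (y :: 'a)" for x y
    by (rule cinner_commute[symmetric])
  moreover have "y = 0" if "\<forall>x. cinner x y = 0" for y :: 'a
    using that cinner_eq_zero_iff by blast
  ultimately show ?thesis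
    by (simp add: hspace_def whole_def cinner_add_right cinner_scaleC_right)
qed

lemma cinner_add_left: "cinner (x + y) (z::'a::fd_hilbert) = cinner x z + cinner y z"
  using ip_add_left[OF hspace_whole, of x y z] by (simp add: whole_def)

lemma cinner_scaleC_left: "cinner (c *\<^sub>C x) (y::'a::fd_hilbert) = cnj c * cinner x y"
  using ip_scale_left[OF hspace_whole, of x y c] by (simp add: whole_def)

lemma cinner_eqI:
  assumes "\<And>x. cinner x y = cinner x (z::'a::fd_hilbert)"
  shows "y = z"
proof -
  have "cinner (y - z) (y - z) + cinner (y - z) z = cinner (y - z) z"
    using assms[of "y - z"] by (simp flip: cinner_add_right)
  then show ?thesis by (simp add: cinner_eq_zero_iff)
qed

lemma cinner_eqI_left:
  assumes "\<And>x. cinner y x = cinner (z::'a::fd_hilbert) x"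
  shows "y = z"
  using assms by (intro cinner_eqI) (metis cinner_commute)

lemma hspace_eqI:
  assumes K: "hspace K" and B: "carr K = cspan B" and x: "x \<in> carr K" and y: "y \<in> carr K"
    and eq: "\<And>b. b \<in> B \<Longrightarrow> ip K b x = ip K b y"
  shows "x = y"
proof -
  have d: "x - y \<in> carr K" by (rule complex_vector.subspace_diff[OF hspace_subspace[OF K] x y])
  have "ip K b (x - y) = 0" if b: "b \<in> carr K" for b
  proof -
    have 0: "ip K 0 z = 0" if "z \<in> carr K" for z
      using ip_scale_left[OF K that that, of 0] by simp
    have "b \<in> {b \<in> carr K. ip K b x = ip K b y}"
      using b[unfolded B]
    proof (induction rule: complex_vector.span_induct)
      show "csubspace {b. b \<in> {b \<in> carr K. ip K b x = ip K b y}}"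
        using K x y 0
        by (auto simp: complex_vector.subspace_def ip_add_left ip_scale_left hspace_add hspace_scale
            hspace_zero)
    qed (use eq B complex_vector.span_base in auto)
    then have "ip K b y = ip K b (y + (x - y))" by simp
    also have "\<dots> = ip K b y + ip K b (x - y)" by (rule ip_add_right[OF K b y d])
    finally show ?thesis by simp
  qed
  then have "x - y = 0" by (rule ip_nondegenerate[OF K d])
  then show ?thesis by simp
qed

lemma subspace_adjoint_pairs:
  assumes "hspace X" "hspace Y" "x' \<in> carr X" "y' \<in> carr Y"
  shows "csubspace {(x, y). x \<in> carr X \<and> y \<in> carr Y \<and> ip Y y' y = ip X x' x}"
  using assms
  by (auto simp: complex_vector.subspace_def scaleC_prod_def zero_prod_def ip_add_right
      ip_scale_right ip_zero_right hspace_add hspace_scale hspace_zero)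

text \<open>A formal adjoint on the spanning set \<open>B\<close> suffices. For fixed
  \<open>y'\<close> and \<open>x'\<close> the relation between \<open>x\<close> and \<open>y\<close>
  is linear, hence survives on \<open>cspan G\<close>; over \<open>x = 0\<close> it makes
  \<open>y\<close> orthogonal to \<open>B\<close>, and the form is nondegenerate.\<close>

lemma well_defI:
  assumes X: "hspace X" and Y: "hspace Y" and B: "carr Y = cspan B"
    and G: "\<And>x y. (x, y) \<in> G \<Longrightarrow> x \<in> carr X \<and> y \<in> carr Y"
    and adj: "\<And>y'. y' \<in> B \<Longrightarrow> \<exists>x'\<in>carr X. \<forall>(x, y)\<in>G. ip Y y' y = ip X x' x"
  shows "well_def G"
  unfolding well_def_def
proof (intro allI impI)
  fix y assume 0: "(0, y) \<in> cspan G"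
  have *: "y \<in> carr Y \<and> ip Y y' y = 0" if y': "y' \<in> B" for y'
  proof -
    obtain x' where x': "x' \<in> carr X" "\<forall>(x, y)\<in>G. ip Y y' y = ip X x' x"
      using adj[OF y'] by blast
    have "y' \<in> carr Y" using y' B complex_vector.span_base by blast
    then have "cspan G \<subseteq> {(x, y). x \<in> carr X \<and> y \<in> carr Y \<and> ip Y y' y = ip X x' x}"
      using x' G by (intro complex_vector.span_minimal subspace_adjoint_pairs[OF X Y]) auto
    then show ?thesis using 0 x' ip_zero_right[OF X] by auto
  qed
  show "y = 0"
  \<comment> \<open>Membership of \<open>y\<close> in \<open>carr Y\<close> is taken from
    \<open>*\<close>, which is void for empty \<open>B\<close>; in that case \<open>carr Y\<close>
    is the zero space.\<close>
  proof (cases "B = {}")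
    case True
    have "cspan G \<subseteq> {p. snd p \<in> carr Y}"
      using G hspace_subspace[OF Y]
      by (intro complex_vector.span_minimal) (auto simp: complex_vector.subspace_def scaleC_prod_def)
    then show ?thesis using 0 True B by auto
  next
    case False
    then have y: "y \<in> carr Y" using * by blast
    show ?thesis
    proof (rule hspace_eqI[OF Y B y hspace_zero[OF Y]])
      fix b assume "b \<in> B"
      then show "ip Y b y = ip Y b 0"
        using * B complex_vector.span_base[of b B] ip_zero_right[OF Y] by simp
    qed
  qed
qed

section \<open>Unitaries between carriers, and families with equal Gram matrices\<close>

lemma unitary_chom: "unitary_op X Y T \<Longrightarrow> chom X Y T"
  by (auto simp: unitary_op_def chom_def bij_betw_def)

lemma unitary_ip: "unitary_op X Y T \<Longrightarrow> x \<in> carr X \<Longrightarrow> y \<in> carr X \<Longrightarrow> ip Y (T x) (T y) = ip X x y"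
  and unitary_inj: "unitary_op X Y T \<Longrightarrow> x \<in> carr X \<Longrightarrow> y \<in> carr X \<Longrightarrow> T x = T y \<longleftrightarrow> x = y"
  and unitary_surj: "unitary_op X Y T \<Longrightarrow> T ` carr X = carr Y"
  by (auto simp: unitary_op_def bij_betw_def dest: inj_onD)

lemma unitary_carr: "unitary_op X Y T \<Longrightarrow> x \<in> carr X \<Longrightarrow> T x \<in> carr Y"
  by (auto dest: unitary_surj)

lemma unitary_add: "unitary_op X Y T \<Longrightarrow> x \<in> carr X \<Longrightarrow> y \<in> carr X \<Longrightarrow> T (x + y) = T x + T y"
  and unitary_scale: "unitary_op X Y T \<Longrightarrow> x \<in> carr X \<Longrightarrow> T (c *\<^sub>C x) = c *\<^sub>C T x"
  by (simp_all add: unitary_op_def)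

lemma unitary_id: "unitary_op X X (\<lambda>x. x)"
  by (auto simp: unitary_op_def bij_betw_def)

lemma unitary_compose: "unitary_op X Y S \<Longrightarrow> unitary_op Y Z T \<Longrightarrow> unitary_op X Z (T \<circ> S)"
  unfolding unitary_op_def by (auto intro: bij_betw_trans dest: bij_betwE)

lemma unitary_inv_into:
  assumes T: "unitary_op X Y T" and X: "csubspace (carr X)"
  shows "unitary_op Y X (inv_into (carr X) T)"
proof -
  let ?S = "inv_into (carr X) T"
  have bij: "bij_betw T (carr X) (carr Y)" using T by (simp add: unitary_op_def)
  have S: "?S y \<in> carr X" "T (?S y) = y" if "y \<in> carr Y" for y
    using that unitary_surj[OF T] by (auto intro: inv_into_into f_inv_into_f)
  have eqI: "?S y = x" if "x \<in> carr X" "T x = y" for x y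
    using that inv_into_f_f bij by (auto simp: bij_betw_def)
  show ?thesis
    unfolding unitary_op_def
  proof (intro conjI ballI allI)
    fix x y assume "x \<in> carr Y" "y \<in> carr Y"
    then show "?S (x + y) = ?S x + ?S y"
      using S X by (intro eqI) (auto simp: unitary_add[OF T] complex_vector.subspace_add)
    show "ip X (?S x) (?S y) = ip Y x y"
      using \<open>x \<in> carr Y\<close> \<open>y \<in> carr Y\<close> S unitary_ip[OF T, of "?S x" "?S y"] by simp
  next
    fix c x assume "x \<in> carr Y"
    then show "?S (c *\<^sub>C x) = c *\<^sub>C ?S x"
      using S X by (intro eqI) (auto simp: unitary_scale[OF T] complex_vector.subspace_scale)
  qed (rule bij_betw_inv_into[OF bij])
qed

text \<open>Both sides are conjugate-linear in \<open>x\<close> and linear in \<open>y\<close>, so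
  span induction runs over \<open>y\<close> with \<open>x\<close> a generator, then over
  \<open>x\<close>.\<close>

lemma sesquilinear_eqI:
  assumes X: "carr X = cspan F" and S: "chom X Y S" and T: "chom X Y T" and S': "chom X Z S'"
    and T': "chom X Z T'" and Y: "hspace Y" and Z: "hspace Z"
    and eq: "\<And>x y. x \<in> F \<Longrightarrow> y \<in> F \<Longrightarrow> ip Y (S x) (T y) = ip Z (S' x) (T' y)"
    and x: "x \<in> carr X" and y: "y \<in> carr X"
  shows "ip Y (S x) (T y) = ip Z (S' x) (T' y)"
proof -
  note [simp] = chom_add[OF S] chom_add[OF T] chom_add[OF S'] chom_add[OF T']
    chom_scale[OF S] chom_scale[OF T] chom_scale[OF S'] chom_scale[OF T']
    chom_carr[OF S] chom_carr[OF T] chom_carr[OF S'] chom_carr[OF T']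
    ip_add_right[OF Y] ip_scale_right[OF Y] ip_add_right[OF Z] ip_scale_right[OF Z]
    ip_add_left[OF Y] ip_scale_left[OF Y] ip_add_left[OF Z] ip_scale_left[OF Z]
  have sub: "csubspace (carr X)" unfolding X by (rule complex_vector.subspace_span)
  note [simp] = complex_vector.subspace_0[OF sub] complex_vector.subspace_add[OF sub]
    complex_vector.subspace_scale[OF sub]
  have 0: "S 0 = 0" "T 0 = 0" "S' 0 = 0" "T' 0 = 0"
    using chom_scale[OF S, of 0 0] chom_scale[OF T, of 0 0]
      chom_scale[OF S', of 0 0] chom_scale[OF T', of 0 0] by simp_all
  have z: "ip Y 0 y = 0" if "y \<in> carr Y" for y using ip_scale_left[OF Y that that, of 0] by simp
  have z': "ip Z 0 y = 0" if "y \<in> carr Z" for y using ip_scale_left[OF Z that that, of 0] by simp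
  have F: "x \<in> carr X" if "x \<in> F" for x
    unfolding X by (rule complex_vector.span_base[OF that])
  have 1: "y \<in> {y \<in> carr X. ip Y (S x) (T y) = ip Z (S' x) (T' y)}" if "x \<in> F" for x
    using y[unfolded X]
  proof (induction rule: complex_vector.span_induct)
    show "csubspace {y. y \<in> {y \<in> carr X. ip Y (S x) (T y) = ip Z (S' x) (T' y)}}"
      using F[OF that] by (simp add: complex_vector.subspace_def 0 ip_zero_right[OF Y] ip_zero_right[OF Z])
  qed (use eq that F in simp)
  have "x \<in> {x \<in> carr X. ip Y (S x) (T y) = ip Z (S' x) (T' y)}"
    using x[unfolded X]
  proof (induction rule: complex_vector.span_induct)
    show "csubspace {x. x \<in> {x \<in> carr X. ip Y (S x) (T y) = ip Z (S' x) (T' y)}}"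
      using y by (simp add: complex_vector.subspace_def 0 z z')
  qed (use 1 F in simp)
  then show ?thesis by simp
qed

lemma chom_id: "chom X X (\<lambda>x. x)"
  by (simp add: chom_def)

lemma cspan_image:
  assumes "\<And>x y. x \<in> cspan A \<Longrightarrow> y \<in> cspan A \<Longrightarrow> f (x + y) = f x + f y"
    "\<And>c x. x \<in> cspan A \<Longrightarrow> f (c *\<^sub>C x) = c *\<^sub>C f x"
  shows "cspan (f ` A) = f ` cspan A"
proof
  have span: "cspan (f ` cspan A) = f ` cspan A"
    by (rule cspan_linear_graph[OF complex_vector.subspace_span]) (fact assms)+
  show "cspan (f ` A) \<subseteq> f ` cspan A"
    using complex_vector.span_mono[OF image_mono[OF complex_vector.span_superset[of A]], of f] span
    by simp
  have f0: "f 0 = 0"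
    using assms(2)[OF complex_vector.span_zero, of 0] by simp
  have "cspan A \<subseteq> {x \<in> cspan A. f x \<in> cspan (f ` A)}"
    by (rule complex_vector.span_minimal)
      (auto simp: complex_vector.subspace_def assms f0 complex_vector.span_zero complex_vector.span_base
        complex_vector.span_add complex_vector.span_scale)
  then show "f ` cspan A \<subseteq> cspan (f ` A)" by auto
qed

text \<open>The adjoint demanded by \<open>well_defI\<close> is read off from the Gram matrix: the
  vector belonging to \<open>h i\<close> is \<open>f i\<close>.\<close>

lemma well_def_gram:
  assumes X: "hspace X" and Y: "hspace Y" and fI: "f ` I \<subseteq> carr X" and hI: "carr Y = cspan (h ` I)"
    and gram: "\<And>i j. i \<in> I \<Longrightarrow> j \<in> I \<Longrightarrow> ip Y (h i) (h j) = ip X (f i) (f j)"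
  shows "well_def ((\<lambda>i. (f i, h i)) ` I)"
proof (rule well_defI[OF X Y hI])
  show "x \<in> carr X \<and> y \<in> carr Y" if "(x, y) \<in> (\<lambda>i. (f i, h i)) ` I" for x y
    using that fI hI complex_vector.span_base[of _ "h ` I"] by auto
  show "\<exists>x'\<in>carr X. \<forall>(x, y)\<in>(\<lambda>i. (f i, h i)) ` I. ip Y y' y = ip X x' x" if y': "y' \<in> h ` I" for y'
  proof -
    obtain i where "i \<in> I" "y' = h i" using y' by auto
    then show ?thesis using gram fI by (intro bexI[of _ "f i"]) auto
  qed
qed

text \<open>Two generating families with the same Gram matrix differ by a unitary. This is the
  source of the canonical unitaries and of the flip.\<close>

lemma unitary_lin_ext:
  assumes X: "hspace X" and Y: "hspace Y" and fI: "carr X = cspan (f ` I)" and hI: "carr Y = cspan (h ` I)"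
    and gram: "\<And>i j. i \<in> I \<Longrightarrow> j \<in> I \<Longrightarrow> ip Y (h i) (h j) = ip X (f i) (f j)"
  shows "unitary_op X Y (lin_ext ((\<lambda>i. (f i, h i)) ` I))"
proof -
  let ?G = "(\<lambda>i. (f i, h i)) ` I" let ?T = "lin_ext ?G"
  have wd: "well_def ?G"
    using complex_vector.span_superset[of "f ` I"] gram fI by (intro well_def_gram[OF X Y _ hI]) auto
  have base: "?T (f i) = h i" if "i \<in> I" for i
    using that by (intro lin_ext_base[OF wd]) auto
  have hom: "chom X Y ?T"
    using fI hI complex_vector.span_superset hspace_subspace[OF Y]
    by (intro chom_lin_ext[OF wd]) (auto simp: image_image intro: complex_vector.span_base)
  have iso: "ip Y (?T x) (?T y) = ip X x y" if "x \<in> carr X" "y \<in> carr X" for x y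
    by (rule sesquilinear_eqI[OF fI hom hom chom_id chom_id Y X _ that]) (auto simp: base gram)
  have inj: "inj_on ?T (carr X)"
  proof (rule inj_onI)
    fix x y assume xy: "x \<in> carr X" "y \<in> carr X" "?T x = ?T y"
    show "x = y"
    proof (rule hspace_eqI[OF X fI xy(1,2)])
      fix b assume "b \<in> f ` I"
      then have "b \<in> carr X" using complex_vector.span_base[of b "f ` I"] fI by simp
      then show "ip X b x = ip X b y" using iso xy by (metis (full_types))
    qed
  qed
  have "carr Y \<subseteq> ?T ` carr X"
    unfolding hI
  proof (rule complex_vector.span_minimal)
    show "h ` I \<subseteq> ?T ` carr X"
    proof
      fix y assume "y \<in> h ` I"
      then obtain i where i: "i \<in> I" "y = h i" by auto
      then have "f i \<in> carr X" unfolding fI by (auto intro: complex_vector.span_base)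
      then show "y \<in> ?T ` carr X" using base[OF i(1)] i(2) by (metis imageI)
    qed
    have "cspan (?T ` carr X) = ?T ` carr X"
      by (rule cspan_linear_graph[OF hspace_subspace[OF X]])
        (auto simp: chom_add[OF hom] chom_scale[OF hom])
    then show "csubspace (?T ` carr X)"
      by (metis complex_vector.subspace_span)
  qed
  then have "?T ` carr X = carr Y" using chom_carr[OF hom] by auto
  then show ?thesis
    using hom inj iso by (simp add: unitary_op_def bij_betw_def chom_def)
qed

text \<open>Conjugating a graph by unitaries conjugates its span, and injectivity of
  \<open>S\<close> passes single-valuedness on. An operator given by the image graph then needs no
  separate well-definedness proof.\<close>

lemma lin_ext_transport:
  assumes wd: "well_def G" and Th: "unitary_op X X' S" "unitary_op Y Y' T"
    and G: "\<And>x y. (x, y) \<in> G \<Longrightarrow> x \<in> carr X \<and> y \<in> carr Y"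
    and XY: "hspace X" "hspace Y"
    and x: "x \<in> cspan (fst ` G)"
  shows "lin_ext ((\<lambda>(x, y). (S x, T y)) ` G) (S x) = T (lin_ext G x)"
proof -
  let ?H = "(\<lambda>(x, y). (S x, T y)) ` G"
  have sub: "cspan G \<subseteq> carr X \<times> carr Y"
    using G hspace_subspace[OF XY(1)] hspace_subspace[OF XY(2)]
    by (intro complex_vector.span_minimal)
      (auto simp: complex_vector.subspace_def scaleC_prod_def zero_prod_def)
  have mem: "fst p \<in> carr X" "snd p \<in> carr Y" if "p \<in> cspan G" for p
    using that sub by auto
  have H: "cspan ?H \<subseteq> (\<lambda>(x, y). (S x, T y)) ` cspan G"
  proof (rule complex_vector.span_minimal)
    show "?H \<subseteq> (\<lambda>(x, y). (S x, T y)) ` cspan G"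
      using complex_vector.span_superset by blast
    have "cspan ((\<lambda>(x, y). (S x, T y)) ` cspan G) = (\<lambda>(x, y). (S x, T y)) ` cspan G"
      by (rule cspan_linear_graph[OF complex_vector.subspace_span])
        (simp_all add: case_prod_beta scaleC_prod_def mem unitary_add[OF Th(1)] unitary_add[OF Th(2)]
            unitary_scale[OF Th(1)] unitary_scale[OF Th(2)])
    then show "csubspace ((\<lambda>(x, y). (S x, T y)) ` cspan G)"
      by (metis complex_vector.subspace_span)
  qed
  have S0: "S 0 = 0" "T 0 = 0"
    using unitary_scale[OF Th(1) hspace_zero[OF XY(1)], of 0]
      unitary_scale[OF Th(2) hspace_zero[OF XY(2)], of 0] by auto
  have "well_def ?H"
    unfolding well_def_def
  proof (intro allI impI)
    fix y assume "(0, y) \<in> cspan ?H"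
    then obtain u v where uv: "(u, v) \<in> cspan G" "S u = 0" "y = T v" using H by auto
    then have "u = 0"
      using sub S0 unitary_inj[OF Th(1), of u 0] hspace_zero[OF XY(1)] by auto
    then show "y = 0" using uv wd S0 by (auto simp: well_def_def)
  qed
  moreover have "(\<lambda>(x, y). (S x, T y)) ` cspan G \<subseteq> cspan ?H"
  proof -
    have "cspan G \<subseteq> {(x, y). (x, y) \<in> carr X \<times> carr Y \<and> (S x, T y) \<in> cspan ?H}"
    proof (rule complex_vector.span_minimal)
      show "G \<subseteq> {(x, y). (x, y) \<in> carr X \<times> carr Y \<and> (S x, T y) \<in> cspan ?H}"
        using G by (auto intro!: complex_vector.span_base)
      have add: "(a + c, b + d) \<in> cspan ?H" if "(a, b) \<in> cspan ?H" "(c, d) \<in> cspan ?H" for a b c d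
        using complex_vector.span_add[OF that] by simp
      have scale: "(r *\<^sub>C a, r *\<^sub>C b) \<in> cspan ?H" if "(a, b) \<in> cspan ?H" for r a b
        using complex_vector.span_scale[OF that, of r] by (simp add: scaleC_prod_def)
      have zero: "(0, 0) \<in> cspan ?H"
        using complex_vector.span_zero[of ?H] by (simp add: zero_prod_def)
      show "csubspace {(x, y). (x, y) \<in> carr X \<times> carr Y \<and> (S x, T y) \<in> cspan ?H}"
        using XY by (auto simp: complex_vector.subspace_def S0 zero_prod_def scaleC_prod_def
            hspace_add hspace_scale hspace_zero unitary_add[OF Th(1)] unitary_add[OF Th(2)]
            unitary_scale[OF Th(1)] unitary_scale[OF Th(2)] add scale zero)
    qed
    then show ?thesis by auto
  qed
  ultimately show ?thesis
    using lin_ext_graph[OF wd x] by (intro lin_ext_eq) auto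
qed

section \<open>Separated spaces\<close>

definition hermitian :: "'x set \<Rightarrow> ('x \<Rightarrow> 'x \<Rightarrow> complex) \<Rightarrow> bool"
  where "hermitian X k \<longleftrightarrow> (\<forall>x\<in>X. \<forall>y\<in>X. cnj (k y x) = k x y)"

text \<open>\<open>\<phi>\<close> is pairing with \<open>F\<close> from the left. For a generator
  \<open>sep_class X k y\<close> it is evaluation at \<open>y\<close>, because Hermitian symmetry
  turns \<open>k y x\<close> into \<open>cnj (k x y)\<close>; sums and conjugated multiples cover
  the span.\<close>

lemma sep_functional:
  assumes herm: "hermitian X k"
    and F: "F \<in> carr (sep_space X k)"
  shows "\<exists>\<phi>. clinear \<phi> \<and> (\<forall>x\<in>X. \<phi> (sep_class X k x) = cnj (F x))"
proof -
  have "F \<in> cspan (sep_class X k ` X)" using F by (simp add: sep_space_def)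
  then show ?thesis
  proof (induction rule: complex_vector.span_induct)
    case base
    show ?case
    proof (rule complex_vector.subspaceI; clarsimp)
      show "\<exists>\<phi>. clinear \<phi> \<and> (\<forall>x\<in>X. \<phi> (sep_class X k x) = 0)"
        by (rule exI[of _ "\<lambda>_. 0"]) (simp add: clinear_iff)
    next
      fix F G \<phi> \<psi>
      assume "clinear \<phi>" "\<forall>x\<in>X. \<phi> (sep_class X k x) = cnj (F x)"
        "clinear \<psi>" "\<forall>x\<in>X. \<psi> (sep_class X k x) = cnj (G x)"
      then show "\<exists>\<phi>. clinear \<phi> \<and> (\<forall>x\<in>X. \<phi> (sep_class X k x) = cnj (F x) + cnj (G x))"
        by (intro exI[of _ "\<lambda>p. \<phi> p + \<psi> p"]) (auto simp: clinear_iff scaleC_add_right)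
    next
      fix c F \<phi>
      assume "clinear \<phi>" "\<forall>x\<in>X. \<phi> (sep_class X k x) = cnj (F x)"
      then show "\<exists>\<phi>. clinear \<phi> \<and> (\<forall>x\<in>X. \<phi> (sep_class X k x) = cnj ((c *\<^sub>C F) x))"
        by (intro exI[of _ "\<lambda>p. cnj c * \<phi> p"])
          (auto simp: clinear_iff scaleC_fun_def scaleC_complex_def algebra_simps)
    qed
  next
    case (step F)
    then obtain y where y: "y \<in> X" "F = sep_class X k y" by auto
    have "clinear (\<lambda>p. p y)" by (simp add: clinear_iff scaleC_fun_def)
    moreover have "k y x = cnj (k x y)" if "x \<in> X" for x using herm y(1) that by (simp add: hermitian_def)
    ultimately show ?case
      using y by (intro exI[of _ "\<lambda>p. p y"]) (simp add: sep_class_def)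
  qed
qed

text \<open>The graph in the definition of the inner product lies on the graph of the linear
  functional \<open>\<phi>\<close>, hence defines its restriction.\<close>

lemma sep_ip:
  assumes herm: "hermitian X k"
    and \<phi>: "clinear \<phi>" "\<And>x. x \<in> X \<Longrightarrow> \<phi> (sep_class X k x) = cnj (G x)"
    and F: "F \<in> carr (sep_space X k)"
  shows "ip (sep_space X k) F G = cnj (\<phi> F)"
proof -
  let ?G = "{(sep_class X k x, cnj (G x)) | x. x \<in> X}"
  have eq: "?G = (\<lambda>p. (p, \<phi> p)) ` sep_class X k ` X" using \<phi>(2) by (auto simp: image_iff)
  have "cspan ?G \<subseteq> (\<lambda>p. (p, \<phi> p)) ` UNIV"
    by (rule complex_vector.span_minimal)
      (auto simp: eq complex_vector.subspace_def zero_prod_def clinear_zero[OF \<phi>(1)]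
        clinear_add[OF \<phi>(1)] clinear_scale[OF \<phi>(1)] scaleC_prod_def)
  then have sub: "q = \<phi> p" if "(p, q) \<in> cspan ?G" for p q using that by auto
  then have wd: "well_def ?G" using clinear_zero[OF \<phi>(1)] by (auto simp: well_def_def)
  have "F \<in> cspan (fst ` ?G)"
    using F by (simp add: eq image_image sep_space_def)
  then have "lin_ext ?G F = \<phi> F" using lin_ext_graph[OF wd] sub by blast
  then show ?thesis by (simp add: sep_space_def)
qed

context
  fixes X :: "'x set" and k :: "'x \<Rightarrow> 'x \<Rightarrow> complex"
  assumes herm: "hermitian X k"
begin

lemma carr_sep_space: "carr (sep_space X k) = cspan (sep_class X k ` X)"
  by (simp add: sep_space_def)

lemma sep_class_carr: "x \<in> X \<Longrightarrow> sep_class X k x \<in> carr (sep_space X k)"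
  by (simp add: carr_sep_space complex_vector.span_base)

text \<open>Reproducing property: elements of the space are functions, and their values are inner
  products with the classes of generators.\<close>

lemma sep_ip_class_left:
  assumes "x \<in> X" "F \<in> carr (sep_space X k)"
  shows "ip (sep_space X k) (sep_class X k x) F = F x"
proof -
  obtain \<phi> where \<phi>: "clinear \<phi>" "\<And>x. x \<in> X \<Longrightarrow> \<phi> (sep_class X k x) = cnj (F x)"
    using sep_functional[OF herm assms(2)] by blast
  show ?thesis
    using sep_ip[OF herm \<phi> sep_class_carr[OF assms(1)]] \<phi>(2)[OF assms(1)]
    by simp
qed

lemma sep_ip_class: "x \<in> X \<Longrightarrow> y \<in> X \<Longrightarrow>
    ip (sep_space X k) (sep_class X k x) (sep_class X k y) = k x y"
  by (simp add: sep_ip_class_left sep_class_carr) (simp add: sep_class_def)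

lemma hspace_sep_space: "hspace (sep_space X k)"
proof -
  note ip = sep_ip[OF herm]
  let ?K = "sep_space X k"
  have fn: "\<exists>\<phi>. clinear \<phi> \<and> (\<forall>x\<in>X. \<phi> (sep_class X k x) = cnj (F x))" if "F \<in> carr ?K" for F
    using sep_functional[OF herm that] .
  have sub: "csubspace (carr ?K)" by (simp add: carr_sep_space complex_vector.subspace_span)
  have add: "ip ?K F (G + H) = ip ?K F G + ip ?K F H"
    if F: "F \<in> carr ?K" and G: "G \<in> carr ?K" and H: "H \<in> carr ?K" for F G H
  proof -
    obtain \<phi> \<psi> where p: "clinear \<phi>" "\<And>x. x \<in> X \<Longrightarrow> \<phi> (sep_class X k x) = cnj (G x)"
      and q: "clinear \<psi>" "\<And>x. x \<in> X \<Longrightarrow> \<psi> (sep_class X k x) = cnj (H x)"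
      using fn[OF G] fn[OF H] by blast
    have "ip ?K F (G + H) = cnj (\<phi> F + \<psi> F)"
      using p q F by (intro ip) (auto simp: clinear_iff scaleC_add_right)
    then show ?thesis using ip[OF p F] ip[OF q F] by simp
  qed
  have scale: "ip ?K F (c *\<^sub>C G) = c * ip ?K F G"
    if F: "F \<in> carr ?K" and G: "G \<in> carr ?K" for c F G
  proof -
    obtain \<phi> where p: "clinear \<phi>" "\<And>x. x \<in> X \<Longrightarrow> \<phi> (sep_class X k x) = cnj (G x)"
      using fn[OF G] by blast
    have "ip ?K F (c *\<^sub>C G) = cnj (cnj c * \<phi> F)"
      using p F by (intro ip) (auto simp: clinear_iff scaleC_fun_def scaleC_complex_def algebra_simps)
    then show ?thesis using ip[OF p F] by simp
  qed
  have comm: "ip ?K F G = cnj (ip ?K G F)" if F: "F \<in> carr ?K" and G: "G \<in> carr ?K" for F G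
  proof -
    obtain \<phi> where p: "clinear \<phi>" "\<And>x. x \<in> X \<Longrightarrow> \<phi> (sep_class X k x) = cnj (G x)"
      using fn[OF G] by blast
    have "F \<in> {F \<in> carr ?K. ip ?K F G = cnj (ip ?K G F)}"
      using F[unfolded carr_sep_space]
    proof (induction rule: complex_vector.span_induct)
      have "ip ?K G 0 = 0" using scale[OF G G, of 0] by simp
      then show "csubspace {F. F \<in> {F \<in> carr ?K. ip ?K F G = cnj (ip ?K G F)}}"
        using sub by (auto simp: complex_vector.subspace_def ip[OF p] clinear_zero[OF p(1), unfolded zero_fun_def]
            clinear_add[OF p(1), unfolded plus_fun_def] clinear_zero[OF p(1)] clinear_add[OF p(1)]
            clinear_scale[OF p(1)] add[OF G] scale[OF G] scaleC_complex_def)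
    next
      case (step F)
      then obtain x where x: "x \<in> X" "F = sep_class X k x" by auto
      have "k x y = cnj (k y x)" if "y \<in> X" for y using herm x(1) that by (simp add: hermitian_def)
      then have "ip ?K G F = cnj (G x)"
        using x G by (intro ip) (simp_all add: clinear_iff scaleC_fun_def sep_class_def)
      then show ?case
        using x sep_ip_class_left[OF x(1) G] sep_class_carr by simp
    qed
    then show ?thesis by simp
  qed
  \<comment> \<open>By the reproducing property, vanishing inner products make \<open>G\<close>
    vanish on \<open>X\<close>; outside \<open>X\<close> all classes are 0 by definition.\<close>
  have nondeg: "G = 0" if G: "G \<in> carr ?K" and 0: "\<forall>F\<in>carr ?K. ip ?K F G = 0" for G
  proof
    fix x
    show "G x = 0 x"
    proof (cases "x \<in> X")
      case True
      then show ?thesis using 0 sep_ip_class_left[OF True G] sep_class_carr by auto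
    next
      case False
      have "cspan (sep_class X k ` X) \<subseteq> {G. G x = 0}"
        using False by (intro complex_vector.span_minimal)
          (auto simp: complex_vector.subspace_def sep_class_def scaleC_fun_def)
      then show ?thesis using G[unfolded carr_sep_space] by auto
    qed
  qed
  show ?thesis
    unfolding hspace_def
  proof (intro conjI ballI allI impI)
    show "cnj (ip ?K G F) = ip ?K F G" if "F \<in> carr ?K" "G \<in> carr ?K" for F G
      using comm[OF that] by simp
  qed (use sub add scale nondeg in auto)
qed

end

section \<open>Adjoints\<close>

text \<open>Induction over a finite spanning set, with one Gram-Schmidt step for each new
  vector.\<close>

lemma riesz:
  assumes f: "clinear (f :: 'a::fd_hilbert \<Rightarrow> complex)"
  shows "\<exists>z. \<forall>x. f x = cinner z x"
proof -
  obtain A :: "'a set" where A: "finite A" "\<And>x. \<exists>c. x = (\<Sum>a\<in>A. c a *\<^sub>C a)"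
    using fd_hilbert_finite_dim by blast
  have "\<exists>z\<in>cspan A. \<forall>x\<in>cspan A. f x = cinner z x" if "clinear f" for f :: "'a \<Rightarrow> complex"
    using A(1) that
  proof (induction A arbitrary: f rule: finite_induct)
    case empty
    then show ?case by (auto simp: clinear_zero cinner_zero_right)
  next
    case (insert a A)
    have sub: "cspan A \<subseteq> cspan (insert a A)"
      by (rule complex_vector.span_mono) auto
    \<comment> \<open>The induction hypothesis also serves the functional of pairing with
      \<open>a\<close>: its representing vector \<open>p\<close> is the orthogonal projection of
      \<open>a\<close> onto \<open>cspan A\<close>, so \<open>e = a - p\<close> is orthogonal to
      \<open>cspan A\<close>.\<close>
    have "clinear (cinner a)"
      by (simp add: clinear_iff cinner_add_right cinner_scaleC_right scaleC_complex_def)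
    then obtain p where p: "p \<in> cspan A" "\<And>x. x \<in> cspan A \<Longrightarrow> cinner a x = cinner p x"
      using insert.IH by blast
    obtain z where z: "z \<in> cspan A" "\<And>x. x \<in> cspan A \<Longrightarrow> f x = cinner z x"
      using insert by blast
    define e where "e = a - p"
    have a: "a = p + e" by (simp add: e_def)
    have perp: "cinner e x = 0" if "x \<in> cspan A" for x
      using p(2)[OF that] by (simp add: a cinner_add_left)
    have perp': "cinner x e = 0" if "x \<in> cspan A" for x
      using perp[OF that] cinner_commute[of x e] by simp
    \<comment> \<open>Chosen so that \<open>?z\<close> pairs with \<open>e\<close> to
      \<open>f e\<close>. If \<open>e = 0\<close>, division by zero gives \<open>c = 0\<close>, and
      \<open>f e = 0\<close> as well.\<close>
    define c where "c = cnj (f e / cinner e e)"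
    let ?z = "z + c *\<^sub>C e"
    have fe: "f e = cinner ?z e"
    proof (cases "e = 0")
      case True
      then show ?thesis using insert.prems by (simp add: clinear_zero cinner_zero_right)
    next
      case False
      then show ?thesis
        using perp'[OF z(1)]
        by (simp add: cinner_add_left cinner_scaleC_left c_def cinner_eq_zero_iff)
    qed
    have fA: "f x = cinner ?z x" if "x \<in> cspan A" for x
      using z(2)[OF that] perp[OF that] by (simp add: cinner_add_left cinner_scaleC_left)
    have "f x = cinner ?z x" if x: "x \<in> cspan (insert a A)" for x
    proof -
      obtain k where k: "x - k *\<^sub>C a \<in> cspan A"
        using x complex_vector.span_breakdown_eq by blast
      then have "x - k *\<^sub>C a + k *\<^sub>C p \<in> cspan A"
        using p(1) by (intro complex_vector.span_add complex_vector.span_scale)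
      moreover have "x - k *\<^sub>C a + k *\<^sub>C p + k *\<^sub>C e = x"
        by (simp add: a scaleC_add_right)
      ultimately show ?thesis
        using fA fe clinear_add[OF insert.prems] clinear_scale[OF insert.prems]
        by (metis cinner_add_right cinner_scaleC_right scaleC_complex_def)
    qed
    moreover have "e \<in> cspan (insert a A)"
      unfolding e_def using p(1) sub
      by (intro complex_vector.span_diff) (auto intro: complex_vector.span_base)
    then have "?z \<in> cspan (insert a A)"
      using z(1) sub by (intro complex_vector.span_add complex_vector.span_scale) auto
    ultimately show ?case by blast
  qed
  then obtain z where z: "\<forall>x\<in>cspan A. f x = cinner z x" using f by blast
  have "x \<in> cspan A" for x
  proof -
    obtain c where "x = (\<Sum>a\<in>A. c a *\<^sub>C a)" using A(2) by blast
    then show ?thesis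
      by (auto intro: complex_vector.span_sum complex_vector.span_scale complex_vector.span_base)
  qed
  then show ?thesis using z by blast
qed

lemma adj_eqI:
  assumes "\<And>x. cinner z x = ip K y (T x)"
  shows "adj whole K T y = (z :: 'a::fd_hilbert)"
  unfolding adj_def
proof (rule the_equality)
  show "z \<in> carr whole \<and> (\<forall>x\<in>carr whole. ip whole z x = ip K y (T x))"
    using assms by (simp add: whole_def)
  fix z' assume "z' \<in> carr whole \<and> (\<forall>x\<in>carr whole. ip whole z' x = ip K y (T x))"
  then show "z' = z" using assms by (intro cinner_eqI_left) (simp add: whole_def)
qed

text \<open>\<open>adj\<close> is a definite description; Riesz representation provides the vector
  that it describes.\<close>

lemma cinner_adj:
  assumes K: "hspace K" and T: "clinear T" "range T \<subseteq> carr K" and y: "y \<in> carr K"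
  shows "cinner (adj whole K T y) (x :: 'a::fd_hilbert) = ip K y (T x)"
proof -
  have "T x \<in> carr K" for x using T(2) by auto
  then have "clinear (\<lambda>x. ip K y (T x))"
    using K T(1) y by (auto simp: clinear_iff ip_add_right ip_scale_right scaleC_complex_def)
  then obtain z where z: "\<And>x. ip K y (T x) = cinner z x" using riesz by blast
  then show ?thesis using adj_eqI[of z K y T] by simp
qed

section \<open>Modules over the algebra of a bicyclic vector\<close>

text \<open>The product of \<open>N\<close> or of its opposite on the same elements, so that one
  statement covers representations of both sides.\<close>

fun side_mult :: "side \<Rightarrow> 'n::times \<Rightarrow> 'n \<Rightarrow> 'n"
  where "side_mult Alg a b = a * b" | "side_mult Opp a b = b * a"

lemma carr_whole [simp]: "carr whole = UNIV" and ip_whole [simp]: "ip whole = cinner"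
  by (simp_all add: whole_def)

lemma flip_flip [simp]: "flip (flip s) = s"
  by (cases s) auto

text \<open>
  \<open>l Alg\<close> and \<open>l Opp\<close> are \<open>\<pi>\<^sub>\<mu>\<close> and its opposite, transported to the space of the base.
\<close>

locale bicyclic_frame =
  fixes g :: "('n::fd_cstar_algebra, 'm::fd_hilbert) gns" and U :: "'k::fd_hilbert \<Rightarrow> 'm"
    and z :: 'k and e :: 'n and l :: "side \<Rightarrow> 'n \<Rightarrow> 'k \<Rightarrow> 'k"
  assumes U: "unitary_op whole whole U"
    and U_z: "U z = snd g"
    and U_l: "gns_side g s b (U w) = U (l s b w)"
    and l_linear_left: "clinear (\<lambda>b. l s b w)"
    and l_mult: "l s (side_mult s a b) w = l s a (l s b w)"
    and l_star: "cinner (l s (star b) v) w = cinner v (l s b w)"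
    and l_commute: "l (flip s) a (l s b w) = l s b (l (flip s) a w)"
    and l_surj: "\<exists>b. l s b z = w"
    and l_inj: "l s b z = 0 \<Longrightarrow> b = 0"
    and l_unit: "l s e w = w"
begin

text \<open>Inverse of the bijection \<open>b\<close> to \<open>l s b z\<close>, available since
  \<open>z\<close> is cyclic and separating; it turns vectors of the base into algebra
  elements.\<close>

definition coord :: "side \<Rightarrow> 'k \<Rightarrow> 'n"
  where "coord s w = (THE b. l s b z = w)"

lemma l_inject: "l s a z = l s b z \<Longrightarrow> a = b"
  using l_inj[of s "a - b"] clinear_diff[OF l_linear_left, of s a b z] by simp

lemma l_coord: "l s (coord s w) z = w"
proof -
  obtain b where b: "l s b z = w" using l_surj by blast
  then have "coord s w = b"
    unfolding coord_def using l_inject by (intro the_equality) auto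
  then show ?thesis using b by simp
qed

lemma coord_l: "coord s (l s b z) = b"
  by (rule l_inject) (rule l_coord)

lemma coord_z: "coord s z = e"
  using coord_l[of s e] by (simp add: l_unit)

text \<open>Through \<open>coord\<close> the space of the base becomes the regular module of the
  algebra.\<close>

lemma coord_mult: "coord s (l s b w) = side_mult s b (coord s w)"
  by (rule l_inject[of s]) (simp add: l_coord l_mult)

lemma clinear_coord: "clinear (coord s)"
  unfolding clinear_iff
proof (intro conjI allI)
  show "coord s (v + w) = coord s v + coord s w" for v w
    by (rule l_inject[of s]) (simp add: l_coord clinear_add[OF l_linear_left])
  show "coord s (c *\<^sub>C w) = c *\<^sub>C coord s w" for c w
    by (rule l_inject[of s]) (simp add: l_coord clinear_scale[OF l_linear_left])
qed

lemma l_star': "cinner v (l s (star b) w) = cinner (l s b v) w"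
  using l_star[of s "star b" v w] by (simp add: star_star)

text \<open>Precomposition with \<open>U\<close> moves the source to the space of the base, which
  gives the operators that occur in \<open>canonical_unitary\<close>.\<close>

definition Rz :: "side \<Rightarrow> ('n \<Rightarrow> 'a \<Rightarrow> 'a) \<Rightarrow> 'a \<Rightarrow> 'k \<Rightarrow> 'a::complex_vector"
  where "Rz s \<kappa> \<xi> = R_op g s \<kappa> \<xi> \<circ> U"

text \<open>Unital star-modules over \<open>N\<close> or its opposite, on a carrier instead of a
  type so that tensor products qualify. Nondegeneracy takes the form that \<open>e\<close> acts as
  the identity.\<close>

definition rmod :: "side \<Rightarrow> ('n, 'a::complex_vector) rep_space \<Rightarrow> bool"
  where "rmod s P \<longleftrightarrow> hspace (fst P) \<and> (\<forall>b. chom (fst P) (fst P) (snd P b)) \<and>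
    (\<forall>\<xi>\<in>carr (fst P). clinear (\<lambda>b. snd P b \<xi>)) \<and>
    (\<forall>a b. \<forall>\<xi>\<in>carr (fst P). snd P (side_mult s a b) \<xi> = snd P a (snd P b \<xi>)) \<and>
    (\<forall>b. \<forall>\<xi>\<in>carr (fst P). \<forall>\<eta>\<in>carr (fst P).
      ip (fst P) (snd P (star b) \<xi>) \<eta> = ip (fst P) \<xi> (snd P b \<eta>)) \<and>
    (\<forall>\<xi>\<in>carr (fst P). snd P e \<xi> = \<xi>)"

context
  fixes s and P :: "('n, 'a::complex_vector) rep_space"
  assumes P: "rmod s P"
begin

lemma rmod_hspace: "hspace (fst P)"
  using P by (simp add: rmod_def)

lemma rmod_chom: "chom (fst P) (fst P) (snd P b)"
  using P by (simp add: rmod_def)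

lemmas rmod_carr = chom_carr[OF rmod_chom]

lemma rmod_linear: "\<xi> \<in> carr (fst P) \<Longrightarrow> clinear (\<lambda>b. snd P b \<xi>)"
  using P by (simp add: rmod_def)

lemma rmod_mult: "\<xi> \<in> carr (fst P) \<Longrightarrow> snd P (side_mult s a b) \<xi> = snd P a (snd P b \<xi>)"
  using P by (simp add: rmod_def)

lemma rmod_star: "\<xi> \<in> carr (fst P) \<Longrightarrow> \<eta> \<in> carr (fst P) \<Longrightarrow>
    ip (fst P) (snd P (star b) \<xi>) \<eta> = ip (fst P) \<xi> (snd P b \<eta>)"
  using P by (simp add: rmod_def)

lemma rmod_star': "\<xi> \<in> carr (fst P) \<Longrightarrow> \<eta> \<in> carr (fst P) \<Longrightarrow>
    ip (fst P) \<xi> (snd P (star b) \<eta>) = ip (fst P) (snd P b \<xi>) \<eta>"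
  using rmod_star[of \<xi> \<eta> "star b"] by (simp add: star_star)

lemma rmod_unit: "\<xi> \<in> carr (fst P) \<Longrightarrow> snd P e \<xi> = \<xi>"
  using P by (simp add: rmod_def)

text \<open>Seen through \<open>U\<close>, the defining graph of \<open>R_op\<close> pairs
  \<open>l s b z\<close> with the action of \<open>b\<close> on \<open>\<xi>\<close>. It is
  single-valued since \<open>l s b z\<close> determines \<open>b\<close>, and every \<open>w\<close>
  has this form with \<open>b = coord s w\<close>.\<close>

lemma Rz_eq:
  assumes "\<xi> \<in> carr (fst P)"
  shows "Rz s (snd P) \<xi> w = snd P (coord s w) \<xi>"
proof -
  let ?f = "\<lambda>b. U (l s b z)" and ?h = "\<lambda>b. snd P b \<xi>"
  have U': "clinear U" using unitary_chom[OF U] by (simp add: chom_whole)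
  have "lin_ext ((\<lambda>b. (?f b, ?h b)) ` UNIV) (?f (coord s w)) = ?h (coord s w)"
  proof (rule lin_ext_linear_graph)
    fix b assume "?f b = 0"
    then have "U (l s b z) = U 0" using clinear_zero[OF U'] by simp
    then have "l s b z = 0" using unitary_inj[OF U] by (simp add: whole_def)
    then show "b = 0" by (rule l_inj)
  qed (simp_all add: clinear_add[OF U'] clinear_scale[OF U'] clinear_add[OF l_linear_left]
      clinear_scale[OF l_linear_left] clinear_add[OF rmod_linear] clinear_scale[OF rmod_linear]
      assms complex_vector.subspace_UNIV)
  moreover have "{(gns_side g s b (snd g), snd P b \<xi>) | b. True} = (\<lambda>b. (?f b, ?h b)) ` UNIV"
    by (auto simp: U_l simp flip: U_z)
  ultimately show ?thesis by (simp add: Rz_def R_op_def l_coord)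
qed

lemma Rz_carr: "\<xi> \<in> carr (fst P) \<Longrightarrow> Rz s (snd P) \<xi> w \<in> carr (fst P)"
  by (simp add: Rz_eq rmod_carr)

lemma Rz_linear: "\<xi> \<in> carr (fst P) \<Longrightarrow> clinear (Rz s (snd P) \<xi>)"
  using clinear_compose[OF clinear_coord rmod_linear, of \<xi> s] Rz_eq[of \<xi>]
  by (simp add: clinear_iff)

lemma Rz_z: "\<xi> \<in> carr (fst P) \<Longrightarrow> Rz s (snd P) \<xi> z = \<xi>"
  by (simp add: Rz_eq coord_z rmod_unit)

lemma Rz_l: "\<xi> \<in> carr (fst P) \<Longrightarrow> Rz s (snd P) \<xi> (l s b w) = snd P b (Rz s (snd P) \<xi> w)"
  by (simp add: Rz_eq coord_mult rmod_mult)

lemma Rz_l_z: "\<xi> \<in> carr (fst P) \<Longrightarrow> Rz s (snd P) \<xi> (l s b z) = snd P b \<xi>"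
  by (simp add: Rz_l Rz_z)

lemma Rz_add: "\<xi> \<in> carr (fst P) \<Longrightarrow> \<eta> \<in> carr (fst P) \<Longrightarrow>
    Rz s (snd P) (\<xi> + \<eta>) w = Rz s (snd P) \<xi> w + Rz s (snd P) \<eta> w"
  by (simp add: Rz_eq chom_add[OF rmod_chom] hspace_add[OF rmod_hspace])

lemma Rz_scale: "\<xi> \<in> carr (fst P) \<Longrightarrow> Rz s (snd P) (c *\<^sub>C \<xi>) w = c *\<^sub>C Rz s (snd P) \<xi> w"
  by (simp add: Rz_eq chom_scale[OF rmod_chom] hspace_scale[OF rmod_hspace])

lemma cinner_adj_Rz: "\<xi> \<in> carr (fst P) \<Longrightarrow> y \<in> carr (fst P) \<Longrightarrow>
    cinner (adj whole (fst P) (Rz s (snd P) \<xi>) y) w = ip (fst P) y (Rz s (snd P) \<xi> w)"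
  by (rule cinner_adj[OF rmod_hspace Rz_linear]) (auto simp: Rz_carr)

lemma cinner_adj_Rz_right: "\<xi> \<in> carr (fst P) \<Longrightarrow> y \<in> carr (fst P) \<Longrightarrow>
    cinner w (adj whole (fst P) (Rz s (snd P) \<xi>) y) = ip (fst P) (Rz s (snd P) \<xi> w) y"
  using cinner_adj_Rz[of \<xi> y w] ip_commute[OF rmod_hspace, of y "Rz s (snd P) \<xi> w"]
  by (subst cinner_commute) (simp add: Rz_carr)

end

text \<open>
  The \<open>N\<close>-valued inner product: \<open>R(\<xi>)\<^sup>* R(\<xi>')\<close> commutes with \<open>l s\<close>, hence is \<open>l (flip s)\<close> of an element.
\<close>

definition bracket :: "side \<Rightarrow> ('n, 'a::complex_vector) rep_space \<Rightarrow> 'a \<Rightarrow> 'a \<Rightarrow> 'n"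
  where "bracket s P \<xi> \<xi>' = coord (flip s) (adj whole (fst P) (Rz s (snd P) \<xi>) \<xi>')"

text \<open>The bracket depends on its two vectors only through the functional pairing
  \<open>\<xi>'\<close> with the action of \<open>b\<close> on \<open>\<xi>\<close>, so brackets in
  different modules can be compared.\<close>

lemma bracket_cong:
  assumes P: "rmod s P" and Q: "rmod s Q"
    and c: "\<xi> \<in> carr (fst P)" "\<xi>' \<in> carr (fst P)" "\<eta> \<in> carr (fst Q)" "\<eta>' \<in> carr (fst Q)"
    and eq: "\<And>b. ip (fst P) \<xi>' (snd P b \<xi>) = ip (fst Q) \<eta>' (snd Q b \<eta>)"
  shows "bracket s P \<xi> \<xi>' = bracket s Q \<eta> \<eta>'"
proof -
  have "adj whole (fst P) (Rz s (snd P) \<xi>) \<xi>' = adj whole (fst Q) (Rz s (snd Q) \<eta>) \<eta>'"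
    using c eq
    by (intro cinner_eqI_left) (simp add: cinner_adj_Rz[OF P] cinner_adj_Rz[OF Q] Rz_eq[OF P] Rz_eq[OF Q])
  then show ?thesis by (simp add: bracket_def)
qed

text \<open>At \<open>z\<close> this is the definition of the bracket. The adjoint of an intertwiner
  intertwines the module action with \<open>l s\<close>, and \<open>l s\<close> commutes with
  \<open>l (flip s)\<close>; the vectors \<open>l s b z\<close> exhaust the space.\<close>

lemma adj_Rz:
  assumes P: "rmod s P" and c: "\<xi> \<in> carr (fst P)" "\<xi>' \<in> carr (fst P)"
  shows "adj whole (fst P) (Rz s (snd P) \<xi>) (Rz s (snd P) \<xi>' w) = l (flip s) (bracket s P \<xi> \<xi>') w"
proof -
  let ?A = "adj whole (fst P) (Rz s (snd P) \<xi>)"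
  define b where "b = coord s w"
  have "?A (snd P b \<xi>') = l s b (?A \<xi>')"
    using c by (intro cinner_eqI_left)
      (simp add: cinner_adj_Rz[OF P] rmod_carr[OF P] l_star'[symmetric] Rz_l[OF P]
        rmod_star'[OF P] Rz_carr[OF P])
  also have "?A \<xi>' = l (flip s) (bracket s P \<xi> \<xi>') z"
    by (simp add: bracket_def l_coord)
  also have "l s b \<dots> = l (flip s) (bracket s P \<xi> \<xi>') (l s b z)"
    by (simp add: l_commute)
  finally show ?thesis
    by (simp only: b_def l_coord Rz_eq[OF P c(2)])
qed

lemma adj_Rz_z:
  "rmod s P \<Longrightarrow> \<xi> \<in> carr (fst P) \<Longrightarrow> \<xi>' \<in> carr (fst P) \<Longrightarrow>
    adj whole (fst P) (Rz s (snd P) \<xi>) \<xi>' = l (flip s) (bracket s P \<xi> \<xi>') z"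
  by (simp add: bracket_def l_coord)

lemma bracket_star:
  assumes P: "rmod s P" and c: "\<xi> \<in> carr (fst P)" "\<xi>' \<in> carr (fst P)"
  shows "star (bracket s P \<xi> \<xi>') = bracket s P \<xi>' \<xi>"
proof (rule l_inject[of "flip s"], rule cinner_eqI_left)
  fix w
  have "cinner (l (flip s) (star (bracket s P \<xi> \<xi>')) z) w =
      cinner z (adj whole (fst P) (Rz s (snd P) \<xi>) (Rz s (snd P) \<xi>' w))"
    by (simp add: l_star adj_Rz[OF P c])
  also have "\<dots> = ip (fst P) \<xi> (Rz s (snd P) \<xi>' w)"
    using c by (simp add: cinner_adj_Rz_right[OF P] Rz_carr[OF P] Rz_z[OF P])
  also have "\<dots> = cinner (l (flip s) (bracket s P \<xi>' \<xi>) z) w"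
    using c by (simp add: cinner_adj_Rz[OF P] flip: adj_Rz_z[OF P])
  finally show "cinner (l (flip s) (star (bracket s P \<xi> \<xi>')) z) w =
      cinner (l (flip s) (bracket s P \<xi>' \<xi>) z) w" .
qed

section \<open>Relative tensor products\<close>

lemma R_op_z: "rmod s P \<Longrightarrow> \<xi> \<in> carr (fst P) \<Longrightarrow> R_op g s (snd P) \<xi> (snd g) = \<xi>"
  using Rz_z[of s P \<xi>] by (simp add: Rz_def U_z)

lemma adj_R_op:
  assumes P: "rmod s P" and c: "\<xi> \<in> carr (fst P)" "y \<in> carr (fst P)"
  shows "adj whole (fst P) (R_op g s (snd P) \<xi>) y = U (adj whole (fst P) (Rz s (snd P) \<xi>) y)"
proof (rule adj_eqI)
  fix x
  obtain x' where x: "x = U x'" using unitary_surj[OF U] by (auto simp: whole_def)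
  show "cinner (U (adj whole (fst P) (Rz s (snd P) \<xi>) y)) x = ip (fst P) y (R_op g s (snd P) \<xi> x)"
    using unitary_ip[OF U, of "adj whole (fst P) (Rz s (snd P) \<xi>) y" x'] cinner_adj_Rz[OF P c]
    by (simp add: whole_def x Rz_def)
qed

context
  fixes s and P :: "('n, 'a::complex_vector) rep_space" and Q :: "('n, 'b::complex_vector) rep_space"
  assumes P: "rmod s P" and Q: "rmod (flip s) Q"
begin

text \<open>This expression in the brackets is the common form of both kernels:
  \<open>c_kernel_eq\<close> has arbitrary middle vectors in the two places of
  \<open>z\<close>.\<close>

lemma rel_kernel_eq:
  assumes c: "\<xi> \<in> carr (fst P)" "\<xi>' \<in> carr (fst P)" "\<eta> \<in> carr (fst Q)" "\<eta>' \<in> carr (fst Q)"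
  shows "rel_kernel g s P Q (\<xi>, \<eta>) (\<xi>', \<eta>') =
    cinner z (l (flip s) (bracket s P \<xi> \<xi>') (l s (bracket (flip s) Q \<eta> \<eta>') z))"
proof -
  have "rel_kernel g s P Q (\<xi>, \<eta>) (\<xi>', \<eta>') = cinner (U (adj whole (fst P) (Rz s (snd P) \<xi>') \<xi>))
      (U (adj whole (fst Q) (Rz (flip s) (snd Q) \<eta>) \<eta>'))"
    using c by (simp add: rel_kernel_def R_op_z[OF P] R_op_z[OF Q] adj_R_op[OF P] adj_R_op[OF Q])
  also have "\<dots> = cinner (l (flip s) (bracket s P \<xi>' \<xi>) z) (l s (bracket (flip s) Q \<eta> \<eta>') z)"
    using unitary_ip[OF U] c by (simp add: adj_Rz_z[OF P] adj_Rz_z[OF Q])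
  also have "bracket s P \<xi>' \<xi> = star (bracket s P \<xi> \<xi>')"
    using c by (simp add: bracket_star[OF P])
  finally show ?thesis by (simp add: l_star)
qed

text \<open>The bracket \<open>a\<close> of the first legs acts on the second one. After the
  commuting factors are swapped, \<open>adj_Rz\<close> reads the outer factor as the adjoint of
  \<open>R(\<eta>)\<close> after \<open>R(\<eta>')\<close>, and \<open>R(\<eta>')\<close> turns
  \<open>l (flip s) a z\<close> into the action of \<open>a\<close> on
  \<open>\<eta>'\<close>.\<close>

lemma rel_kernel_right:
  assumes c: "\<xi> \<in> carr (fst P)" "\<xi>' \<in> carr (fst P)" "\<eta> \<in> carr (fst Q)" "\<eta>' \<in> carr (fst Q)"
  shows "rel_kernel g s P Q (\<xi>, \<eta>) (\<xi>', \<eta>') = ip (fst Q) \<eta> (snd Q (bracket s P \<xi> \<xi>') \<eta>')"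
proof -
  let ?a = "bracket s P \<xi> \<xi>'"
  have "l (flip s) ?a (l s (bracket (flip s) Q \<eta> \<eta>') z) =
      l (flip (flip s)) (bracket (flip s) Q \<eta> \<eta>') (l (flip s) ?a z)"
    by (simp add: l_commute)
  also have "\<dots> = adj whole (fst Q) (Rz (flip s) (snd Q) \<eta>) (snd Q ?a \<eta>')"
    using c by (simp add: Rz_l_z[OF Q] flip: adj_Rz[OF Q, unfolded flip_flip])
  finally show ?thesis
    using c by (simp add: rel_kernel_eq cinner_adj_Rz_right[OF Q] rmod_carr[OF Q] Rz_z[OF Q])
qed

lemma rel_kernel_left:
  assumes c: "\<xi> \<in> carr (fst P)" "\<xi>' \<in> carr (fst P)" "\<eta> \<in> carr (fst Q)" "\<eta>' \<in> carr (fst Q)"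
  shows "rel_kernel g s P Q (\<xi>, \<eta>) (\<xi>', \<eta>') = ip (fst P) \<xi> (snd P (bracket (flip s) Q \<eta> \<eta>') \<xi>')"
proof -
  let ?a = "bracket (flip s) Q \<eta> \<eta>'"
  have "l (flip s) (bracket s P \<xi> \<xi>') (l s ?a z) =
      adj whole (fst P) (Rz s (snd P) \<xi>) (snd P ?a \<xi>')"
    using c by (simp add: Rz_l_z[OF P] flip: adj_Rz[OF P])
  then show ?thesis
    using c by (simp add: rel_kernel_eq cinner_adj_Rz_right[OF P] rmod_carr[OF P] Rz_z[OF P])
qed

lemma hermitian_rel_kernel: "hermitian (carr (fst P) \<times> carr (fst Q)) (rel_kernel g s P Q)"
  unfolding hermitian_def
proof (intro ballI, clarify)
  fix \<xi> \<eta> \<xi>' \<eta>'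
  assume c: "\<xi> \<in> carr (fst P)" "\<xi>' \<in> carr (fst P)" "\<eta> \<in> carr (fst Q)" "\<eta>' \<in> carr (fst Q)"
  have "cnj (rel_kernel g s P Q (\<xi>', \<eta>') (\<xi>, \<eta>)) =
      cnj (ip (fst Q) \<eta>' (snd Q (bracket s P \<xi>' \<xi>) \<eta>))"
    using c by (simp add: rel_kernel_right)
  also have "\<dots> = ip (fst Q) (snd Q (bracket s P \<xi>' \<xi>) \<eta>) \<eta>'"
    using ip_commute[OF rmod_hspace[OF Q]] c rmod_carr[OF Q] by metis
  also have "\<dots> = rel_kernel g s P Q (\<xi>, \<eta>) (\<xi>', \<eta>')"
    using c by (simp add: rel_kernel_right bracket_star[OF P] flip: rmod_star'[OF Q])
  finally show "cnj (rel_kernel g s P Q (\<xi>', \<eta>') (\<xi>, \<eta>)) = rel_kernel g s P Q (\<xi>, \<eta>) (\<xi>', \<eta>')" .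
qed

lemma hspace_rel_tensor: "hspace (rel_tensor g s P Q)"
  unfolding rel_tensor_def by (rule hspace_sep_space[OF hermitian_rel_kernel])

lemma carr_rel_tensor:
  "carr (rel_tensor g s P Q) = cspan ((\<lambda>(\<xi>, \<eta>). rel_vec g s P Q \<xi> \<eta>) ` (carr (fst P) \<times> carr (fst Q)))"
  unfolding rel_tensor_def rel_vec_def carr_sep_space[OF hermitian_rel_kernel] by simp

lemma rel_vec_carr: "\<xi> \<in> carr (fst P) \<Longrightarrow> \<eta> \<in> carr (fst Q) \<Longrightarrow>
    rel_vec g s P Q \<xi> \<eta> \<in> carr (rel_tensor g s P Q)"
  unfolding carr_rel_tensor by (auto intro: complex_vector.span_base)

lemma rel_ip: "\<xi> \<in> carr (fst P) \<Longrightarrow> \<eta> \<in> carr (fst Q) \<Longrightarrow> \<xi>' \<in> carr (fst P) \<Longrightarrow> \<eta>' \<in> carr (fst Q) \<Longrightarrow>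
    ip (rel_tensor g s P Q) (rel_vec g s P Q \<xi> \<eta>) (rel_vec g s P Q \<xi>' \<eta>') =
      rel_kernel g s P Q (\<xi>, \<eta>) (\<xi>', \<eta>')"
  unfolding rel_tensor_def rel_vec_def by (rule sep_ip_class[OF hermitian_rel_kernel]) auto

lemma rel_vec_eqI:
  assumes "\<And>\<xi> \<eta>. \<xi> \<in> carr (fst P) \<Longrightarrow> \<eta> \<in> carr (fst Q) \<Longrightarrow>
      ip (rel_tensor g s P Q) (rel_vec g s P Q \<xi> \<eta>) v = ip (rel_tensor g s P Q) (rel_vec g s P Q \<xi> \<eta>) w"
    "v \<in> carr (rel_tensor g s P Q)" "w \<in> carr (rel_tensor g s P Q)"
  shows "v = w"
  using assms by (intro hspace_eqI[OF hspace_rel_tensor carr_rel_tensor]) auto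

text \<open>The generators are those of a free vector space, so bilinearity results from separation:
  both sides have the same inner products with all generators.\<close>

lemma rel_vec_add_left: "\<xi> \<in> carr (fst P) \<Longrightarrow> \<xi>' \<in> carr (fst P) \<Longrightarrow> \<eta> \<in> carr (fst Q) \<Longrightarrow>
    rel_vec g s P Q (\<xi> + \<xi>') \<eta> = rel_vec g s P Q \<xi> \<eta> + rel_vec g s P Q \<xi>' \<eta>"
  by (rule rel_vec_eqI) (simp_all add: rel_vec_carr hspace_add[OF hspace_rel_tensor]
      hspace_add[OF rmod_hspace[OF P]] ip_add_right[OF hspace_rel_tensor] rel_ip rel_kernel_left
      ip_add_right[OF rmod_hspace[OF P]] chom_add[OF rmod_chom[OF P]] rmod_carr[OF P])

lemma rel_vec_scale_left: "\<xi> \<in> carr (fst P) \<Longrightarrow> \<eta> \<in> carr (fst Q) \<Longrightarrow>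
    rel_vec g s P Q (c *\<^sub>C \<xi>) \<eta> = c *\<^sub>C rel_vec g s P Q \<xi> \<eta>"
  by (rule rel_vec_eqI) (simp_all add: rel_vec_carr hspace_scale[OF hspace_rel_tensor]
      hspace_scale[OF rmod_hspace[OF P]] ip_scale_right[OF hspace_rel_tensor] rel_ip rel_kernel_left
      ip_scale_right[OF rmod_hspace[OF P]] chom_scale[OF rmod_chom[OF P]] rmod_carr[OF P])

lemma rel_vec_add_right: "\<xi> \<in> carr (fst P) \<Longrightarrow> \<eta> \<in> carr (fst Q) \<Longrightarrow> \<eta>' \<in> carr (fst Q) \<Longrightarrow>
    rel_vec g s P Q \<xi> (\<eta> + \<eta>') = rel_vec g s P Q \<xi> \<eta> + rel_vec g s P Q \<xi> \<eta>'"
  by (rule rel_vec_eqI) (simp_all add: rel_vec_carr hspace_add[OF hspace_rel_tensor]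
      hspace_add[OF rmod_hspace[OF Q]] ip_add_right[OF hspace_rel_tensor] rel_ip rel_kernel_right
      ip_add_right[OF rmod_hspace[OF Q]] chom_add[OF rmod_chom[OF Q]] rmod_carr[OF Q])

lemma rel_vec_scale_right: "\<xi> \<in> carr (fst P) \<Longrightarrow> \<eta> \<in> carr (fst Q) \<Longrightarrow>
    rel_vec g s P Q \<xi> (c *\<^sub>C \<eta>) = c *\<^sub>C rel_vec g s P Q \<xi> \<eta>"
  by (rule rel_vec_eqI) (simp_all add: rel_vec_carr hspace_scale[OF hspace_rel_tensor]
      hspace_scale[OF rmod_hspace[OF Q]] ip_scale_right[OF hspace_rel_tensor] rel_ip rel_kernel_right
      ip_scale_right[OF rmod_hspace[OF Q]] chom_scale[OF rmod_chom[OF Q]] rmod_carr[OF Q])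

end

section \<open>Module maps and the operators they induce on relative tensor products\<close>

definition rhom :: "('n, 'a::complex_vector) rep_space \<Rightarrow> ('n, 'b::complex_vector) rep_space \<Rightarrow>
    ('a \<Rightarrow> 'b) \<Rightarrow> ('b \<Rightarrow> 'a) \<Rightarrow> bool"
  where "rhom P P' S S' \<longleftrightarrow> chom (fst P) (fst P') S \<and> chom (fst P') (fst P) S' \<and>
    (\<forall>b. \<forall>\<xi>\<in>carr (fst P). S (snd P b \<xi>) = snd P' b (S \<xi>)) \<and>
    (\<forall>\<xi>\<in>carr (fst P'). \<forall>\<eta>\<in>carr (fst P). ip (fst P') \<xi> (S \<eta>) = ip (fst P) (S' \<xi>) \<eta>)"

lemma rhom_intertwine: "rhom P P' S S' \<Longrightarrow> \<xi> \<in> carr (fst P) \<Longrightarrow> S (snd P b \<xi>) = snd P' b (S \<xi>)"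
  by (simp add: rhom_def)

lemma rhom_adjoint: "rhom P P' S S' \<Longrightarrow> \<xi> \<in> carr (fst P') \<Longrightarrow> \<eta> \<in> carr (fst P) \<Longrightarrow>
    ip (fst P') \<xi> (S \<eta>) = ip (fst P) (S' \<xi>) \<eta>"
  by (simp add: rhom_def)


definition commuting :: "('n, 'a::complex_vector) rep_space \<Rightarrow> ('n \<Rightarrow> 'a \<Rightarrow> 'a) \<Rightarrow> bool"
  where "commuting P r \<longleftrightarrow> (\<forall>a b. \<forall>\<xi>\<in>carr (fst P). r a (snd P b \<xi>) = snd P b (r a \<xi>))"

lemma commutingD: "commuting P r \<Longrightarrow> \<xi> \<in> carr (fst P) \<Longrightarrow> r a (snd P b \<xi>) = snd P b (r a \<xi>)"
  by (simp add: commuting_def)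

lemma rhom_id: "rhom P P id id"
  by (simp add: rhom_def chom_def)

lemma rhom_unitary:
  assumes W: "unitary_op (fst P) (fst P') W" and P: "hspace (fst P)"
    and "\<And>b \<xi>. \<xi> \<in> carr (fst P) \<Longrightarrow> W (snd P b \<xi>) = snd P' b (W \<xi>)"
  shows "rhom P P' W (inv_into (carr (fst P)) W)"
proof -
  have inv: "unitary_op (fst P') (fst P) (inv_into (carr (fst P)) W)"
    by (rule unitary_inv_into[OF W hspace_subspace[OF P]])
  have "ip (fst P') \<xi> (W \<eta>) = ip (fst P) (inv_into (carr (fst P)) W \<xi>) \<eta>"
    if "\<xi> \<in> carr (fst P')" "\<eta> \<in> carr (fst P)" for \<xi> \<eta>
    using unitary_ip[OF W unitary_carr[OF inv that(1)] that(2)] that unitary_surj[OF W]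
    by (simp add: f_inv_into_f)
  then show ?thesis
    using assms unitary_chom[OF W] unitary_chom[OF inv] by (simp add: rhom_def)
qed

lemma rhom_rmod:
  assumes r: "rmod t (fst P, r)" and comm: "commuting P r"
  shows "rhom P P (r a) (r (star a))"
  using rmod_chom[OF r] commutingD[OF comm]
  by (auto simp: rhom_def rmod_star[OF r, simplified])

text \<open>On generators the adjoint of \<open>S\<close> tensor \<open>T\<close> is
  \<open>S'\<close> tensor \<open>T'\<close>: \<open>T\<close> moves across the bracket by
  \<open>bracket_cong\<close>, then \<open>S\<close> across the inner product of the first leg. This
  is the adjoint that makes \<open>rel_op\<close> well defined.\<close>

lemma rel_op_adjoint:
  assumes P: "rmod s P" and P': "rmod s P'" and Q: "rmod (flip s) Q" and Q': "rmod (flip s) Q'"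
    and S: "rhom P P' S S'" and T: "rhom Q Q' T T'"
    and c: "\<xi> \<in> carr (fst P)" "\<eta> \<in> carr (fst Q)" "\<xi>' \<in> carr (fst P')" "\<eta>' \<in> carr (fst Q')"
  shows "rel_kernel g s P' Q' (\<xi>', \<eta>') (S \<xi>, T \<eta>) = rel_kernel g s P Q (S' \<xi>', T' \<eta>') (\<xi>, \<eta>)"
proof -
  have [simp]: "S \<xi> \<in> carr (fst P')" "T \<eta> \<in> carr (fst Q')" "S' \<xi>' \<in> carr (fst P)" "T' \<eta>' \<in> carr (fst Q)"
    using S T c by (auto simp: rhom_def dest: chom_carr)
  have "bracket (flip s) Q' (T \<eta>) \<eta>' = bracket (flip s) Q \<eta> (T' \<eta>')"
    using c by (intro bracket_cong[OF Q' Q])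
      (simp_all add: rmod_carr[OF Q] rhom_adjoint[OF T] flip: rhom_intertwine[OF T])
  then have "bracket (flip s) Q' \<eta>' (T \<eta>) = bracket (flip s) Q (T' \<eta>') \<eta>"
    using bracket_star[OF Q', of "T \<eta>" \<eta>'] bracket_star[OF Q, of \<eta> "T' \<eta>'"] c by simp
  then show ?thesis
    using c by (simp add: rel_kernel_left[OF P Q] rel_kernel_left[OF P' Q'] rmod_carr[OF P]
        rhom_adjoint[OF S] flip: rhom_intertwine[OF S])
qed

context
  fixes s and P :: "('n, 'a::complex_vector) rep_space" and Q :: "('n, 'b::complex_vector) rep_space"
    and P' :: "('n, 'c::complex_vector) rep_space" and Q' :: "('n, 'd::complex_vector) rep_space"
    and S T S' T'
  assumes P: "rmod s P" and Q: "rmod (flip s) Q" and P': "rmod s P'" and Q': "rmod (flip s) Q'"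
    and S: "rhom P P' S S'" and T: "rhom Q Q' T T'"
begin

abbreviation (input) "rel_op_graph \<equiv> (\<lambda>(\<xi>, \<eta>). (rel_vec g s P Q \<xi> \<eta>, rel_vec g s P' Q' (S \<xi>) (T \<eta>))) `
      (carr (fst P) \<times> carr (fst Q))"

lemma rhom_carr: "\<xi> \<in> carr (fst P) \<Longrightarrow> S \<xi> \<in> carr (fst P')" "\<eta> \<in> carr (fst Q) \<Longrightarrow> T \<eta> \<in> carr (fst Q')"
  "\<xi>' \<in> carr (fst P') \<Longrightarrow> S' \<xi>' \<in> carr (fst P)" "\<eta>' \<in> carr (fst Q') \<Longrightarrow> T' \<eta>' \<in> carr (fst Q)"
  using S T by (auto simp: rhom_def dest: chom_carr)

lemma well_def_rel_op: "well_def rel_op_graph"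
proof (rule well_defI[OF hspace_rel_tensor[OF P Q] hspace_rel_tensor[OF P' Q'] carr_rel_tensor[OF P' Q']])
  show "x \<in> carr (rel_tensor g s P Q) \<and> y \<in> carr (rel_tensor g s P' Q')" if "(x, y) \<in> rel_op_graph" for x y
    using that by (auto simp: rel_vec_carr[OF P Q] rel_vec_carr[OF P' Q'] rhom_carr)
next
  fix y assume "y \<in> (\<lambda>(\<xi>, \<eta>). rel_vec g s P' Q' \<xi> \<eta>) ` (carr (fst P') \<times> carr (fst Q'))"
  then obtain \<xi>' \<eta>' where y: "\<xi>' \<in> carr (fst P')" "\<eta>' \<in> carr (fst Q')" "y = rel_vec g s P' Q' \<xi>' \<eta>'"
    by auto
  then show "\<exists>x\<in>carr (rel_tensor g s P Q). \<forall>(u, v)\<in>rel_op_graph.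
      ip (rel_tensor g s P' Q') y v = ip (rel_tensor g s P Q) x u"
    by (intro bexI[of _ "rel_vec g s P Q (S' \<xi>') (T' \<eta>')"])
      (auto simp: rel_vec_carr[OF P Q] rhom_carr rel_ip[OF P Q] rel_ip[OF P' Q']
        rel_op_adjoint[OF P P' Q Q' S T])
qed

lemma rel_op_eq: "rel_op g s P Q P' Q' S T = lin_ext rel_op_graph"
  unfolding rel_op_def by (intro arg_cong[where f = lin_ext]) auto

lemma rel_op_vec: "\<xi> \<in> carr (fst P) \<Longrightarrow> \<eta> \<in> carr (fst Q) \<Longrightarrow>
    rel_op g s P Q P' Q' S T (rel_vec g s P Q \<xi> \<eta>) = rel_vec g s P' Q' (S \<xi>) (T \<eta>)"
  unfolding rel_op_eq by (rule lin_ext_base[OF well_def_rel_op]) auto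

lemma rel_op_chom: "chom (rel_tensor g s P Q) (rel_tensor g s P' Q') (rel_op g s P Q P' Q' S T)"
  unfolding rel_op_eq
  by (rule chom_lin_ext[OF well_def_rel_op _ _ hspace_subspace[OF hspace_rel_tensor[OF P' Q']]])
    (auto simp: carr_rel_tensor[OF P Q] image_image rel_vec_carr[OF P' Q'] rhom_carr case_prod_beta)

end

text \<open>Each axiom is an identity of linear or sesquilinear maps and may be tested on a spanning
  set, such as the elementary tensors.\<close>

lemma rmodI:
  assumes X: "hspace X" and F: "carr X = cspan F" and \<kappa>: "\<And>b. chom X X (\<kappa> b)"
    and lin: "\<And>x. x \<in> F \<Longrightarrow> clinear (\<lambda>b. \<kappa> b x)"
    and mult: "\<And>a b x. x \<in> F \<Longrightarrow> \<kappa> (side_mult t a b) x = \<kappa> a (\<kappa> b x)"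
    and star: "\<And>b x y. x \<in> F \<Longrightarrow> y \<in> F \<Longrightarrow> ip X (\<kappa> (star b) x) y = ip X x (\<kappa> b y)"
    and unit: "\<And>x. x \<in> F \<Longrightarrow> \<kappa> e x = x"
  shows "rmod t (X, \<kappa>)"
proof -
  have "clinear (\<lambda>b. \<kappa> b x)" if x: "x \<in> carr X" for x
  proof -
    have "\<kappa> (a + b) x = \<kappa> a x + \<kappa> b x" for a b
    proof (rule chom_eqI[OF F \<kappa> _ _ x])
      show "chom X X (\<lambda>x. \<kappa> a x + \<kappa> b x)"
        using \<kappa> hspace_add[OF X] by (auto simp: chom_def scaleC_add_right)
    qed (use lin clinear_add in blast)
    moreover have "\<kappa> (c *\<^sub>C b) x = c *\<^sub>C \<kappa> b x" for c b
    proof (rule chom_eqI[OF F \<kappa> _ _ x])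
      show "chom X X (\<lambda>x. c *\<^sub>C \<kappa> b x)"
        using \<kappa> hspace_scale[OF X] by (auto simp: chom_def scaleC_add_right scaleC_scaleC mult.commute)
    qed (use lin clinear_scale in blast)
    ultimately show ?thesis by (simp add: clinear_iff)
  qed
  moreover have "\<kappa> (side_mult t a b) x = \<kappa> a (\<kappa> b x)" if "x \<in> carr X" for a b x
    using chom_eqI[OF F \<kappa> chom_compose[OF \<kappa> \<kappa>] _ that, of _ a b] mult by simp
  moreover have "ip X (\<kappa> (star b) x) y = ip X x (\<kappa> b y)" if "x \<in> carr X" "y \<in> carr X" for b x y
    by (rule sesquilinear_eqI[OF F \<kappa> chom_id chom_id \<kappa> X X star that])
  moreover have "\<kappa> e x = x" if "x \<in> carr X" for x
    by (rule chom_eqI[OF F \<kappa> chom_id unit that])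
  ultimately show ?thesis using X \<kappa> by (simp add: rmod_def)
qed

section \<open>Actions on one leg of a relative tensor product\<close>

context
  fixes s and P :: "('n, 'a::complex_vector) rep_space" and Q :: "('n, 'b::complex_vector) rep_space"
  assumes P: "rmod s P" and Q: "rmod (flip s) Q"
begin

lemma fst_rel_leg [simp]: "fst (rel_leg1 g s P Q r) = rel_tensor g s P Q"
  "fst (rel_leg2 g s P Q r') = rel_tensor g s P Q"
  by (simp_all add: rel_leg1_def rel_leg2_def)

context
  fixes t r
  assumes r: "rmod t (fst P, r)"
    and comm: "commuting P r"
begin

lemma rel_leg1_vec: "\<xi> \<in> carr (fst P) \<Longrightarrow> \<eta> \<in> carr (fst Q) \<Longrightarrow>
    snd (rel_leg1 g s P Q r) b (rel_vec g s P Q \<xi> \<eta>) = rel_vec g s P Q (r b \<xi>) \<eta>"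
  using rel_op_vec[OF P Q P Q rhom_rmod[OF r comm] rhom_id] by (simp add: rel_leg1_def)

lemma rmod_rel_leg1: "rmod t (rel_leg1 g s P Q r)"
proof -
  note [simp] = rel_leg1_vec
  let ?\<kappa> = "snd (rel_leg1 g s P Q r)"
  have r_carr [simp]: "r b \<xi> \<in> carr (fst P)" if "\<xi> \<in> carr (fst P)" for b \<xi>
    using rmod_carr[OF r] that by simp
  have "rmod t (rel_tensor g s P Q, ?\<kappa>)"
  proof (rule rmodI[OF hspace_rel_tensor[OF P Q] carr_rel_tensor[OF P Q]])
    show "chom (rel_tensor g s P Q) (rel_tensor g s P Q) (?\<kappa> b)" for b
      using rel_op_chom[OF P Q P Q rhom_rmod[OF r comm] rhom_id] by (simp add: rel_leg1_def)
    fix x assume "x \<in> (\<lambda>(\<xi>, \<eta>). rel_vec g s P Q \<xi> \<eta>) ` (carr (fst P) \<times> carr (fst Q))"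
    then obtain \<xi> \<eta> where x: "\<xi> \<in> carr (fst P)" "\<eta> \<in> carr (fst Q)" "x = rel_vec g s P Q \<xi> \<eta>" by auto
    show "clinear (\<lambda>b. ?\<kappa> b x)"
      using x rmod_linear[OF r]
      by (auto simp: clinear_iff rel_vec_add_left[OF P Q] rel_vec_scale_left[OF P Q])
    show "?\<kappa> (side_mult t a b) x = ?\<kappa> a (?\<kappa> b x)" for a b
      using x rmod_mult[OF r] by simp
    show "?\<kappa> e x = x"
      using x rmod_unit[OF r] by simp
    fix y assume "y \<in> (\<lambda>(\<xi>, \<eta>). rel_vec g s P Q \<xi> \<eta>) ` (carr (fst P) \<times> carr (fst Q))"
    then obtain \<xi>' \<eta>' where y: "\<xi>' \<in> carr (fst P)" "\<eta>' \<in> carr (fst Q)" "y = rel_vec g s P Q \<xi>' \<eta>'"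
      by auto
    \<comment> \<open>\<open>rel_kernel_left\<close> makes the right legs act through
      \<open>snd P\<close>, and \<open>r b\<close> moves past that action because the two
      commute.\<close>
    show "ip (rel_tensor g s P Q) (?\<kappa> (star b) x) y = ip (rel_tensor g s P Q) x (?\<kappa> b y)" for b
      using x y rmod_star[OF r] rmod_carr[OF P]
      by (simp add: rel_ip[OF P Q] rel_kernel_left[OF P Q] flip: commutingD[OF comm])
  qed
  then show ?thesis by (simp add: rel_leg1_def)
qed

end

context
  fixes t r
  assumes r: "rmod t (fst Q, r)"
    and comm: "commuting Q r"
begin

lemma rel_leg2_vec: "\<xi> \<in> carr (fst P) \<Longrightarrow> \<eta> \<in> carr (fst Q) \<Longrightarrow>
    snd (rel_leg2 g s P Q r) b (rel_vec g s P Q \<xi> \<eta>) = rel_vec g s P Q \<xi> (r b \<eta>)"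
  using rel_op_vec[OF P Q P Q rhom_id rhom_rmod[OF r comm]] by (simp add: rel_leg2_def)

lemma rmod_rel_leg2: "rmod t (rel_leg2 g s P Q r)"
proof -
  note [simp] = rel_leg2_vec
  let ?\<kappa> = "snd (rel_leg2 g s P Q r)"
  have r_carr [simp]: "r b \<eta> \<in> carr (fst Q)" if "\<eta> \<in> carr (fst Q)" for b \<eta>
    using rmod_carr[OF r] that by simp
  have "rmod t (rel_tensor g s P Q, ?\<kappa>)"
  proof (rule rmodI[OF hspace_rel_tensor[OF P Q] carr_rel_tensor[OF P Q]])
    show "chom (rel_tensor g s P Q) (rel_tensor g s P Q) (?\<kappa> b)" for b
      using rel_op_chom[OF P Q P Q rhom_id rhom_rmod[OF r comm]] by (simp add: rel_leg2_def)
    fix x assume "x \<in> (\<lambda>(\<xi>, \<eta>). rel_vec g s P Q \<xi> \<eta>) ` (carr (fst P) \<times> carr (fst Q))"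
    then obtain \<xi> \<eta> where x: "\<xi> \<in> carr (fst P)" "\<eta> \<in> carr (fst Q)" "x = rel_vec g s P Q \<xi> \<eta>" by auto
    show "clinear (\<lambda>b. ?\<kappa> b x)"
      using x rmod_linear[OF r]
      by (auto simp: clinear_iff rel_vec_add_right[OF P Q] rel_vec_scale_right[OF P Q])
    show "?\<kappa> (side_mult t a b) x = ?\<kappa> a (?\<kappa> b x)" for a b
      using x rmod_mult[OF r] by simp
    show "?\<kappa> e x = x"
      using x rmod_unit[OF r] by simp
    fix y assume "y \<in> (\<lambda>(\<xi>, \<eta>). rel_vec g s P Q \<xi> \<eta>) ` (carr (fst P) \<times> carr (fst Q))"
    then obtain \<xi>' \<eta>' where y: "\<xi>' \<in> carr (fst P)" "\<eta>' \<in> carr (fst Q)" "y = rel_vec g s P Q \<xi>' \<eta>'"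
      by auto
    show "ip (rel_tensor g s P Q) (?\<kappa> (star b) x) y = ip (rel_tensor g s P Q) x (?\<kappa> b y)" for b
      using x y rmod_star[OF r] rmod_carr[OF Q]
      by (simp add: rel_ip[OF P Q] rel_kernel_right[OF P Q] flip: commutingD[OF comm])
  qed
  then show ?thesis by (simp add: rel_leg2_def)
qed

end

end

end

section \<open>C*-relative tensor products\<close>

lemma scaleC_fun_apply: "(c *\<^sub>C f) x = c *\<^sub>C f x"
  by (simp add: scaleC_fun_def)

context bicyclic_frame
begin

text \<open>
  Under \<open>\<Theta>\<close>, the factorization \<open>snd P'\<close> is the space of intertwiners from \<open>l s\<close> to \<open>snd P\<close>.
\<close>

definition match :: "side \<Rightarrow> ('n, 'a::complex_vector) rep_space \<Rightarrow> ('k, 'b::complex_vector) fact_space \<Rightarrow>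
    ('a \<Rightarrow> 'b) \<Rightarrow> bool"
  where "match s P P' \<Theta> \<longleftrightarrow> rmod s P \<and> hspace (fst P') \<and> unitary_op (fst P) (fst P') \<Theta> \<and>
    snd P' = (\<lambda>\<xi>. \<Theta> \<circ> Rz s (snd P) \<xi>) ` carr (fst P)"

lemma match_rmod: "match s P P' \<Theta> \<Longrightarrow> rmod s P"
  by (simp add: match_def)

lemma match_unitary: "match s P P' \<Theta> \<Longrightarrow> unitary_op (fst P) (fst P') \<Theta>"
  by (simp add: match_def)

lemma match_fact: "match s P P' \<Theta> \<Longrightarrow> snd P' = (\<lambda>\<xi>. \<Theta> \<circ> Rz s (snd P) \<xi>) ` carr (fst P)"
  by (simp add: match_def)

lemma adj_match:
  assumes M: "match s P P' \<Theta>" and c: "\<xi> \<in> carr (fst P)" "y \<in> carr (fst P)"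
  shows "adj whole (fst P') (\<Theta> \<circ> Rz s (snd P) \<xi>) (\<Theta> y) = adj whole (fst P) (Rz s (snd P) \<xi>) y"
  using c unitary_ip[OF match_unitary[OF M]]
  by (intro adj_eqI)
    (simp add: cinner_adj_Rz[OF match_rmod[OF M]] Rz_carr[OF match_rmod[OF M]])

text \<open>For identity maps this is \<open>canonical_unitary\<close>. The general form is for
  threefold products, where a factor is itself a tensor product, identified by an earlier
  \<open>can\<close>.\<close>

definition can :: "side \<Rightarrow> ('n, 'a::complex_vector) rep_space \<Rightarrow> ('n, 'b::complex_vector) rep_space \<Rightarrow>
    ('k, 'c::complex_vector) fact_space \<Rightarrow> ('k, 'd::complex_vector) fact_space \<Rightarrow>
    ('a \<Rightarrow> 'c) \<Rightarrow> ('b \<Rightarrow> 'd) \<Rightarrow> ('a \<times> 'b \<Rightarrow> complex) \<Rightarrow> ('k, 'c, 'd) cten"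
  where "can s P Q P' Q' \<Theta> \<Theta>' = lin_ext ((\<lambda>(\<xi>, \<eta>). (rel_vec g s P Q \<xi> \<eta>,
      c_vec P' Q' (\<Theta> \<circ> Rz s (snd P) \<xi>) z (\<Theta>' \<circ> Rz (flip s) (snd Q) \<eta>))) `
        (carr (fst P) \<times> carr (fst Q)))"

context
  fixes s and P :: "('n, 'a::complex_vector) rep_space" and Q :: "('n, 'b::complex_vector) rep_space"
    and P' :: "('k, 'c::complex_vector) fact_space" and Q' :: "('k, 'd::complex_vector) fact_space"
    and \<Theta> \<Theta>'
  assumes MP: "match s P P' \<Theta>" and MQ: "match (flip s) Q Q' \<Theta>'"
begin

lemmas P_mod = match_rmod[OF MP] and Q_mod = match_rmod[OF MQ]

text \<open>Both pairs of adjoint and operator collapse to brackets by \<open>adj_Rz\<close>. At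
  \<open>w = w' = z\<close> the result is that of \<open>rel_kernel_eq\<close>, so corresponding
  generators of the two tensor products have the same Gram matrix.\<close>

lemma c_kernel_eq:
  assumes c: "\<xi> \<in> carr (fst P)" "\<xi>' \<in> carr (fst P)" "\<eta> \<in> carr (fst Q)" "\<eta>' \<in> carr (fst Q)"
  shows "c_kernel P' Q' (\<Theta> \<circ> Rz s (snd P) \<xi>, w, \<Theta>' \<circ> Rz (flip s) (snd Q) \<eta>)
      (\<Theta> \<circ> Rz s (snd P) \<xi>', w', \<Theta>' \<circ> Rz (flip s) (snd Q) \<eta>') =
    cinner w (l (flip s) (bracket s P \<xi> \<xi>') (l s (bracket (flip s) Q \<eta> \<eta>') w'))"
  using c
  by (simp add: c_kernel_def adj_match[OF MP] adj_match[OF MQ] Rz_carr[OF P_mod] Rz_carr[OF Q_mod]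
      adj_Rz[OF P_mod] adj_Rz[OF Q_mod])

lemma c_tensor_generator:
  assumes "x \<in> snd P' \<times> UNIV \<times> snd Q'"
  obtains \<xi> w \<eta> where "\<xi> \<in> carr (fst P)" "\<eta> \<in> carr (fst Q)"
    "x = (\<Theta> \<circ> Rz s (snd P) \<xi>, w, \<Theta>' \<circ> Rz (flip s) (snd Q) \<eta>)"
  using assms by (auto simp: match_fact[OF MP] match_fact[OF MQ])

lemma generator_c_tensor: "\<xi> \<in> carr (fst P) \<Longrightarrow> \<eta> \<in> carr (fst Q) \<Longrightarrow>
    (\<Theta> \<circ> Rz s (snd P) \<xi>, w, \<Theta>' \<circ> Rz (flip s) (snd Q) \<eta>) \<in> snd P' \<times> UNIV \<times> snd Q'"
  by (auto simp: match_fact[OF MP] match_fact[OF MQ])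

lemma hermitian_c_kernel: "hermitian (snd P' \<times> UNIV \<times> snd Q') (c_kernel P' Q')"
  unfolding hermitian_def
proof (intro ballI)
  fix x y :: "('k \<Rightarrow> 'c) \<times> 'k \<times> ('k \<Rightarrow> 'd)"
  assume "x \<in> snd P' \<times> UNIV \<times> snd Q'" "y \<in> snd P' \<times> UNIV \<times> snd Q'"
  then obtain \<xi> w \<eta> \<xi>' w' \<eta>' where c: "\<xi> \<in> carr (fst P)" "\<eta> \<in> carr (fst Q)"
    "x = (\<Theta> \<circ> Rz s (snd P) \<xi>, w, \<Theta>' \<circ> Rz (flip s) (snd Q) \<eta>)"
    "\<xi>' \<in> carr (fst P)" "\<eta>' \<in> carr (fst Q)"
    "y = (\<Theta> \<circ> Rz s (snd P) \<xi>', w', \<Theta>' \<circ> Rz (flip s) (snd Q) \<eta>')"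
    by (elim c_tensor_generator)
  have "cnj (c_kernel P' Q' y x) =
      cinner (l (flip s) (bracket s P \<xi>' \<xi>) (l s (bracket (flip s) Q \<eta>' \<eta>) w)) w'"
    using c by (simp add: c_kernel_eq cinner_commute[symmetric])
  also have "\<dots> = cinner w (l s (bracket (flip s) Q \<eta> \<eta>') (l (flip s) (bracket s P \<xi> \<xi>') w'))"
    by (simp only: l_star bracket_star[OF P_mod c(1,4), symmetric] bracket_star[OF Q_mod c(2,5), symmetric])
  also have "\<dots> = c_kernel P' Q' x y"
    using c by (simp add: c_kernel_eq l_commute)
  finally show "cnj (c_kernel P' Q' y x) = c_kernel P' Q' x y" .
qed

lemma c_vec_eqI:
  assumes "\<And>\<xi> w \<eta>. \<xi> \<in> carr (fst P) \<Longrightarrow> \<eta> \<in> carr (fst Q) \<Longrightarrow>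
      c_kernel P' Q' (\<Theta> \<circ> Rz s (snd P) \<xi>, w, \<Theta>' \<circ> Rz (flip s) (snd Q) \<eta>) (x, v, y) =
      c_kernel P' Q' (\<Theta> \<circ> Rz s (snd P) \<xi>, w, \<Theta>' \<circ> Rz (flip s) (snd Q) \<eta>) (x', v', y')"
  shows "c_vec P' Q' x v y = c_vec P' Q' x' v' y'"
  unfolding c_vec_def sep_class_def
proof (rule ext)
  fix p
  show "(if p \<in> snd P' \<times> UNIV \<times> snd Q' then c_kernel P' Q' p (x, v, y) else 0) =
      (if p \<in> snd P' \<times> UNIV \<times> snd Q' then c_kernel P' Q' p (x', v', y') else 0)"
  proof (cases "p \<in> snd P' \<times> UNIV \<times> snd Q'")
    case True
    then show ?thesis using assms by (elim c_tensor_generator) simp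
  qed simp
qed

text \<open>The bracket of \<open>\<xi>'\<close> and \<open>\<xi>\<close>, acting on
  \<open>w\<close>, gives the same vector as the bracket of \<open>\<xi>'\<close> and
  \<open>Rz s (snd P) \<xi> w\<close> acting on \<open>z\<close>. So the middle vector can be
  absorbed on the left and replaced by \<open>z\<close>.\<close>

lemma c_vec_left:
  assumes c: "\<xi> \<in> carr (fst P)" "\<eta> \<in> carr (fst Q)"
  shows "c_vec P' Q' (\<Theta> \<circ> Rz s (snd P) \<xi>) w (\<Theta>' \<circ> Rz (flip s) (snd Q) \<eta>) =
    c_vec P' Q' (\<Theta> \<circ> Rz s (snd P) (Rz s (snd P) \<xi> w)) z (\<Theta>' \<circ> Rz (flip s) (snd Q) \<eta>)"
proof (rule c_vec_eqI)
  fix \<xi>' v \<eta>' assume c': "\<xi>' \<in> carr (fst P)" "\<eta>' \<in> carr (fst Q)"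
  let ?a = "bracket (flip s) Q \<eta>' \<eta>"
  have "l (flip s) (bracket s P \<xi>' \<xi>) (l s ?a w) = l s ?a (l (flip s) (bracket s P \<xi>' \<xi>) w)"
    by (rule l_commute)
  also have "l (flip s) (bracket s P \<xi>' \<xi>) w = l (flip s) (bracket s P \<xi>' (Rz s (snd P) \<xi> w)) z"
    using c c' by (simp add: Rz_carr[OF P_mod] Rz_z[OF P_mod] flip: adj_Rz[OF P_mod])
  also have "l s ?a \<dots> = l (flip s) (bracket s P \<xi>' (Rz s (snd P) \<xi> w)) (l s ?a z)"
    by (rule l_commute[symmetric])
  finally show "c_kernel P' Q' (\<Theta> \<circ> Rz s (snd P) \<xi>', v, \<Theta>' \<circ> Rz (flip s) (snd Q) \<eta>')
       (\<Theta> \<circ> Rz s (snd P) \<xi>, w, \<Theta>' \<circ> Rz (flip s) (snd Q) \<eta>) =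
      c_kernel P' Q' (\<Theta> \<circ> Rz s (snd P) \<xi>', v, \<Theta>' \<circ> Rz (flip s) (snd Q) \<eta>')
       (\<Theta> \<circ> Rz s (snd P) (Rz s (snd P) \<xi> w), z, \<Theta>' \<circ> Rz (flip s) (snd Q) \<eta>)"
    using c c' by (simp add: c_kernel_eq Rz_carr[OF P_mod])
qed

lemma c_vec_right:
  assumes c: "\<xi> \<in> carr (fst P)" "\<eta> \<in> carr (fst Q)"
  shows "c_vec P' Q' (\<Theta> \<circ> Rz s (snd P) \<xi>) w (\<Theta>' \<circ> Rz (flip s) (snd Q) \<eta>) =
    c_vec P' Q' (\<Theta> \<circ> Rz s (snd P) \<xi>) z (\<Theta>' \<circ> Rz (flip s) (snd Q) (Rz (flip s) (snd Q) \<eta> w))"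
proof (rule c_vec_eqI)
  fix \<xi>' v \<eta>' assume c': "\<xi>' \<in> carr (fst P)" "\<eta>' \<in> carr (fst Q)"
  have "l s (bracket (flip s) Q \<eta>' \<eta>) w = l s (bracket (flip s) Q \<eta>' (Rz (flip s) (snd Q) \<eta> w)) z"
    using c c' by (simp add: Rz_carr[OF Q_mod] Rz_z[OF Q_mod] flip: adj_Rz[OF Q_mod, unfolded flip_flip])
  then show "c_kernel P' Q' (\<Theta> \<circ> Rz s (snd P) \<xi>', v, \<Theta>' \<circ> Rz (flip s) (snd Q) \<eta>')
       (\<Theta> \<circ> Rz s (snd P) \<xi>, w, \<Theta>' \<circ> Rz (flip s) (snd Q) \<eta>) =
      c_kernel P' Q' (\<Theta> \<circ> Rz s (snd P) \<xi>', v, \<Theta>' \<circ> Rz (flip s) (snd Q) \<eta>')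
       (\<Theta> \<circ> Rz s (snd P) \<xi>, z, \<Theta>' \<circ> Rz (flip s) (snd Q) (Rz (flip s) (snd Q) \<eta> w))"
    using c c' by (simp add: c_kernel_eq Rz_carr[OF Q_mod])
qed

abbreviation (input) "cv \<equiv> \<lambda>\<xi> \<eta>. c_vec P' Q' (\<Theta> \<circ> Rz s (snd P) \<xi>) z (\<Theta>' \<circ> Rz (flip s) (snd Q) \<eta>)"

lemma hspace_c_tensor: "hspace (c_tensor P' Q')"
  unfolding c_tensor_def by (rule hspace_sep_space[OF hermitian_c_kernel])

text \<open>By \<open>c_vec_left\<close>, the classes with middle vector \<open>z\<close> are all
  the classes of generators.\<close>

lemma carr_c_tensor: "carr (c_tensor P' Q') = cspan ((\<lambda>(\<xi>, \<eta>). cv \<xi> \<eta>) ` (carr (fst P) \<times> carr (fst Q)))"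
proof -
  have "sep_class (snd P' \<times> UNIV \<times> snd Q') (c_kernel P' Q') ` (snd P' \<times> UNIV \<times> snd Q') =
      (\<lambda>(\<xi>, \<eta>). cv \<xi> \<eta>) ` (carr (fst P) \<times> carr (fst Q))" (is "?L = ?R")
  proof
    show "?L \<subseteq> ?R"
    proof
      fix v assume "v \<in> ?L"
      then obtain x where x: "x \<in> snd P' \<times> UNIV \<times> snd Q'"
          "v = sep_class (snd P' \<times> UNIV \<times> snd Q') (c_kernel P' Q') x" by auto
      from x(1) obtain \<xi> w \<eta> where c: "\<xi> \<in> carr (fst P)" "\<eta> \<in> carr (fst Q)"
        "x = (\<Theta> \<circ> Rz s (snd P) \<xi>, w, \<Theta>' \<circ> Rz (flip s) (snd Q) \<eta>)"
        by (rule c_tensor_generator)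
      then have "v = cv (Rz s (snd P) \<xi> w) \<eta>"
        by (simp add: x(2) c_vec_left[symmetric]) (simp add: c_vec_def)
      then show "v \<in> ?R" using c Rz_carr[OF P_mod] by auto
    qed
    show "?R \<subseteq> ?L"
      using generator_c_tensor by (auto simp: c_vec_def)
  qed
  then show ?thesis
    unfolding c_tensor_def carr_sep_space[OF hermitian_c_kernel] by simp
qed

lemma c_ip:
  assumes c: "\<xi> \<in> carr (fst P)" "\<xi>' \<in> carr (fst P)" "\<eta> \<in> carr (fst Q)" "\<eta>' \<in> carr (fst Q)"
  shows "ip (c_tensor P' Q') (cv \<xi> \<eta>) (cv \<xi>' \<eta>') = rel_kernel g s P Q (\<xi>, \<eta>) (\<xi>', \<eta>')"
  using c sep_ip_class[OF hermitian_c_kernel generator_c_tensor generator_c_tensor, of \<xi> \<eta> \<xi>' \<eta>' z z]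
  by (simp add: c_tensor_def c_vec_def c_kernel_eq rel_kernel_eq[OF P_mod Q_mod])

lemma can_unitary: "unitary_op (rel_tensor g s P Q) (c_tensor P' Q') (can s P Q P' Q' \<Theta> \<Theta>')"
  using unitary_lin_ext[OF hspace_rel_tensor[OF P_mod Q_mod] hspace_c_tensor
      carr_rel_tensor[OF P_mod Q_mod] carr_c_tensor]
  by (simp add: can_def case_prod_beta c_ip rel_ip[OF P_mod Q_mod] mem_Times_iff)

lemma can_vec: "\<xi> \<in> carr (fst P) \<Longrightarrow> \<eta> \<in> carr (fst Q) \<Longrightarrow>
    can s P Q P' Q' \<Theta> \<Theta>' (rel_vec g s P Q \<xi> \<eta>) = cv \<xi> \<eta>"
proof -
  have "well_def ((\<lambda>i. (case_prod (rel_vec g s P Q) i, case_prod cv i)) ` (carr (fst P) \<times> carr (fst Q)))"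
    by (rule well_def_gram[OF hspace_rel_tensor[OF P_mod Q_mod] hspace_c_tensor])
      (auto simp: rel_vec_carr[OF P_mod Q_mod] carr_c_tensor c_ip rel_ip[OF P_mod Q_mod])
  then show "\<xi> \<in> carr (fst P) \<Longrightarrow> \<eta> \<in> carr (fst Q) \<Longrightarrow>
      can s P Q P' Q' \<Theta> \<Theta>' (rel_vec g s P Q \<xi> \<eta>) = cv \<xi> \<eta>"
    unfolding can_def by (intro lin_ext_base) (auto simp: case_prod_beta intro!: image_eqI[of _ _ "(\<xi>, \<eta>)"])
qed

text \<open>Through the canonical unitaries a ket operator creates one leg. Absorbing the middle
  vector on the right turns its defining graph into a graph parametrized linearly by
  \<open>carr (fst Q)\<close>.\<close>

lemma ket1_eq:
  assumes \<xi>: "\<xi> \<in> carr (fst P)" and \<eta>: "\<eta> \<in> carr (fst Q)"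
  shows "ket1 P' Q' (\<Theta> \<circ> Rz s (snd P) \<xi>) (\<Theta>' \<eta>) = can s P Q P' Q' \<Theta> \<Theta>' (rel_vec g s P Q \<xi> \<eta>)"
proof -
  let ?c = "can s P Q P' Q' \<Theta> \<Theta>'"
  have "{(\<eta>' w, c_vec P' Q' (\<Theta> \<circ> Rz s (snd P) \<xi>) w \<eta>') | \<eta>' w. \<eta>' \<in> snd Q'} =
      (\<lambda>\<eta>. (\<Theta>' \<eta>, ?c (rel_vec g s P Q \<xi> \<eta>))) ` carr (fst Q)" (is "?L = ?R")
  proof
    show "?L \<subseteq> ?R"
      using \<xi> Rz_carr[OF Q_mod]
      by (auto simp: match_fact[OF MQ] c_vec_right can_vec intro!: image_eqI[OF _ Rz_carr[OF Q_mod]])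
    show "?R \<subseteq> ?L"
    proof
      fix x assume "x \<in> ?R"
      then obtain \<eta> where \<eta>: "\<eta> \<in> carr (fst Q)" "x = (\<Theta>' \<eta>, ?c (rel_vec g s P Q \<xi> \<eta>))" by auto
      then have "x = ((\<Theta>' \<circ> Rz (flip s) (snd Q) \<eta>) z, cv \<xi> \<eta>)"
        using \<xi> by (simp add: can_vec Rz_z[OF Q_mod])
      moreover have "\<Theta>' \<circ> Rz (flip s) (snd Q) \<eta> \<in> snd Q'" using \<eta> by (simp add: match_fact[OF MQ])
      ultimately show "x \<in> ?L" by blast
    qed
  qed
  moreover have "lin_ext ?R (\<Theta>' \<eta>) = ?c (rel_vec g s P Q \<xi> \<eta>)"
  proof (rule lin_ext_linear_graph[OF hspace_subspace[OF rmod_hspace[OF Q_mod]] _ _ _ _ _ \<eta>])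
    fix x assume "x \<in> carr (fst Q)" "\<Theta>' x = 0"
    moreover have "\<Theta>' 0 = 0"
      using unitary_scale[OF match_unitary[OF MQ] hspace_zero[OF rmod_hspace[OF Q_mod]], of 0] by simp
    ultimately show "x = 0"
      using unitary_inj[OF match_unitary[OF MQ] _ hspace_zero[OF rmod_hspace[OF Q_mod]]] by metis
  qed (simp_all add: \<xi> unitary_add[OF match_unitary[OF MQ]] unitary_scale[OF match_unitary[OF MQ]]
      rel_vec_add_right[OF P_mod Q_mod] rel_vec_scale_right[OF P_mod Q_mod]
      unitary_add[OF can_unitary] unitary_scale[OF can_unitary] rel_vec_carr[OF P_mod Q_mod])
  ultimately show ?thesis by (simp add: ket1_def)
qed

lemma ket2_eq:
  assumes \<xi>: "\<xi> \<in> carr (fst P)" and \<eta>: "\<eta> \<in> carr (fst Q)"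
  shows "ket2 P' Q' (\<Theta>' \<circ> Rz (flip s) (snd Q) \<eta>) (\<Theta> \<xi>) = can s P Q P' Q' \<Theta> \<Theta>' (rel_vec g s P Q \<xi> \<eta>)"
proof -
  let ?c = "can s P Q P' Q' \<Theta> \<Theta>'"
  have "{(\<xi>' w, c_vec P' Q' \<xi>' w (\<Theta>' \<circ> Rz (flip s) (snd Q) \<eta>)) | \<xi>' w. \<xi>' \<in> snd P'} =
      (\<lambda>\<xi>. (\<Theta> \<xi>, ?c (rel_vec g s P Q \<xi> \<eta>))) ` carr (fst P)" (is "?L = ?R")
  proof
    show "?L \<subseteq> ?R"
      using \<eta> Rz_carr[OF P_mod]
      by (auto simp: match_fact[OF MP] c_vec_left can_vec intro!: image_eqI[OF _ Rz_carr[OF P_mod]])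
    show "?R \<subseteq> ?L"
    proof
      fix x assume "x \<in> ?R"
      then obtain \<xi> where \<xi>: "\<xi> \<in> carr (fst P)" "x = (\<Theta> \<xi>, ?c (rel_vec g s P Q \<xi> \<eta>))" by auto
      then have "x = ((\<Theta> \<circ> Rz s (snd P) \<xi>) z, cv \<xi> \<eta>)"
        using \<eta> by (simp add: can_vec Rz_z[OF P_mod])
      moreover have "\<Theta> \<circ> Rz s (snd P) \<xi> \<in> snd P'" using \<xi> by (simp add: match_fact[OF MP])
      ultimately show "x \<in> ?L" by blast
    qed
  qed
  moreover have "lin_ext ?R (\<Theta> \<xi>) = ?c (rel_vec g s P Q \<xi> \<eta>)"
  proof (rule lin_ext_linear_graph[OF hspace_subspace[OF rmod_hspace[OF P_mod]] _ _ _ _ _ \<xi>])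
    fix x assume "x \<in> carr (fst P)" "\<Theta> x = 0"
    moreover have "\<Theta> 0 = 0"
      using unitary_scale[OF match_unitary[OF MP] hspace_zero[OF rmod_hspace[OF P_mod]], of 0] by simp
    ultimately show "x = 0"
      using unitary_inj[OF match_unitary[OF MP] _ hspace_zero[OF rmod_hspace[OF P_mod]]] by metis
  qed (simp_all add: \<eta> unitary_add[OF match_unitary[OF MP]] unitary_scale[OF match_unitary[OF MP]]
      rel_vec_add_left[OF P_mod Q_mod] rel_vec_scale_left[OF P_mod Q_mod]
      unitary_add[OF can_unitary] unitary_scale[OF can_unitary] rel_vec_carr[OF P_mod Q_mod])
  ultimately show ?thesis by (simp add: ket2_def)
qed

text \<open>\<open>Rz t (snd L) v\<close> is linear in \<open>v\<close>, so the intertwiners coming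
  from a spanning set \<open>A\<close> span the space of all of them.\<close>

lemma match_legI:
  assumes L: "rmod t L" and fst: "fst L = rel_tensor g s P Q" and A: "cspan A = carr (fst L)"
    and F: "F = cspan ((\<lambda>v. can s P Q P' Q' \<Theta> \<Theta>' \<circ> Rz t (snd L) v) ` A)"
  shows "match t L (c_tensor P' Q', F) (can s P Q P' Q' \<Theta> \<Theta>')"
proof -
  let ?c = "can s P Q P' Q' \<Theta> \<Theta>'"
  have c: "unitary_op (fst L) (c_tensor P' Q') ?c" unfolding fst by (rule can_unitary)
  have "F = (\<lambda>v. ?c \<circ> Rz t (snd L) v) ` carr (fst L)"
    unfolding F A[symmetric]
    by (rule cspan_image; intro ext)
      (simp_all add: A scaleC_fun_apply Rz_add[OF L] Rz_scale[OF L] unitary_add[OF c]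
        unitary_scale[OF c] Rz_carr[OF L])
  then show ?thesis using L c hspace_c_tensor by (simp add: match_def)
qed

text \<open>The ket of \<open>R(\<xi>)\<close> composed with \<open>R(\<eta>)\<close> is
  \<open>R\<close> of the elementary tensor, since \<open>r\<close> moves only the second leg;
  elementary tensors span.\<close>

lemma match_leg2:
  assumes M: "match t (fst Q, r) (fst Q', \<epsilon>) \<Theta>'" and comm: "commuting Q r"
  shows "match t (rel_leg2 g s P Q r) (c_leg2 P' Q' \<epsilon>) (can s P Q P' Q' \<Theta> \<Theta>')"
proof -
  note r = match_rmod[OF M]
  let ?c = "can s P Q P' Q' \<Theta> \<Theta>'" and ?L = "rel_leg2 g s P Q r"
  have L: "rmod t ?L" by (rule rmod_rel_leg2[OF P_mod Q_mod r comm])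
  have eq: "ket1 P' Q' (\<Theta> \<circ> Rz s (snd P) \<xi>) \<circ> (\<Theta>' \<circ> Rz t r \<eta>) =
      ?c \<circ> Rz t (snd ?L) (rel_vec g s P Q \<xi> \<eta>)" if "\<xi> \<in> carr (fst P)" "\<eta> \<in> carr (fst Q)" for \<xi> \<eta>
    using that Rz_eq[OF r] rmod_carr[OF r]
    by (simp add: fun_eq_iff ket1_eq Rz_eq[OF L] rel_vec_carr[OF P_mod Q_mod] fst_rel_leg[OF P_mod Q_mod]
        rel_leg2_vec[OF P_mod Q_mod r comm])
  have "{ket1 P' Q' \<xi> \<circ> y | \<xi> y. \<xi> \<in> snd P' \<and> y \<in> \<epsilon>} =
      (\<lambda>v. ?c \<circ> Rz t (snd ?L) v) ` (\<lambda>(\<xi>, \<eta>). rel_vec g s P Q \<xi> \<eta>) ` (carr (fst P) \<times> carr (fst Q))" (is "_ = ?R")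
  proof -
    have "\<epsilon> = (\<lambda>\<eta>. \<Theta>' \<circ> Rz t r \<eta>) ` carr (fst Q)" using match_fact[OF M] by simp
    then have "{ket1 P' Q' \<xi> \<circ> y | \<xi> y. \<xi> \<in> snd P' \<and> y \<in> \<epsilon>} =
        (\<lambda>(\<xi>, \<eta>). ket1 P' Q' (\<Theta> \<circ> Rz s (snd P) \<xi>) \<circ> (\<Theta>' \<circ> Rz t r \<eta>)) ` (carr (fst P) \<times> carr (fst Q))"
      unfolding match_fact[OF MP] by auto
    also have "\<dots> = ?R" unfolding image_image by (rule image_cong) (auto simp: eq)
    finally show ?thesis .
  qed
  then show ?thesis
    unfolding c_leg2_def fact_right_def
    by (intro match_legI[OF L]) (simp_all add: fst_rel_leg[OF P_mod Q_mod] carr_rel_tensor[OF P_mod Q_mod])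
qed

lemma match_leg1:
  assumes M: "match t (fst P, r) (fst P', \<epsilon>) \<Theta>" and comm: "commuting P r"
  shows "match t (rel_leg1 g s P Q r) (c_leg1 P' Q' \<epsilon>) (can s P Q P' Q' \<Theta> \<Theta>')"
proof -
  note r = match_rmod[OF M]
  let ?c = "can s P Q P' Q' \<Theta> \<Theta>'" and ?L = "rel_leg1 g s P Q r"
  have L: "rmod t ?L" by (rule rmod_rel_leg1[OF P_mod Q_mod r comm])
  have eq: "ket2 P' Q' (\<Theta>' \<circ> Rz (flip s) (snd Q) \<eta>) \<circ> (\<Theta> \<circ> Rz t r \<xi>) =
      ?c \<circ> Rz t (snd ?L) (rel_vec g s P Q \<xi> \<eta>)" if "\<xi> \<in> carr (fst P)" "\<eta> \<in> carr (fst Q)" for \<xi> \<eta>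
    using that Rz_eq[OF r] rmod_carr[OF r]
    by (simp add: fun_eq_iff ket2_eq Rz_eq[OF L] rel_vec_carr[OF P_mod Q_mod] fst_rel_leg[OF P_mod Q_mod]
        rel_leg1_vec[OF P_mod Q_mod r comm])
  have "{ket2 P' Q' \<eta> \<circ> y | \<eta> y. \<eta> \<in> snd Q' \<and> y \<in> \<epsilon>} =
      (\<lambda>v. ?c \<circ> Rz t (snd ?L) v) ` (\<lambda>(\<xi>, \<eta>). rel_vec g s P Q \<xi> \<eta>) ` (carr (fst P) \<times> carr (fst Q))" (is "_ = ?R")
  proof -
    have "\<epsilon> = (\<lambda>\<xi>. \<Theta> \<circ> Rz t r \<xi>) ` carr (fst P)" using match_fact[OF M] by simp
    then have "{ket2 P' Q' \<eta> \<circ> y | \<eta> y. \<eta> \<in> snd Q' \<and> y \<in> \<epsilon>} =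
        (\<lambda>(\<xi>, \<eta>). ket2 P' Q' (\<Theta>' \<circ> Rz (flip s) (snd Q) \<eta>) \<circ> (\<Theta> \<circ> Rz t r \<xi>)) ` (carr (fst P) \<times> carr (fst Q))"
      unfolding match_fact[OF MQ] by auto
    also have "\<dots> = ?R" unfolding image_image by (rule image_cong) (auto simp: eq)
    finally show ?thesis .
  qed
  then show ?thesis
    unfolding c_leg1_def fact_left_def
    by (intro match_legI[OF L]) (simp_all add: fst_rel_leg[OF P_mod Q_mod] carr_rel_tensor[OF P_mod Q_mod])
qed

end

text \<open>The factorizations consist of operators \<open>Rz t (snd M) x\<close> and
  \<open>Rz t (snd N) y\<close>. If composition with \<open>V\<close> sends one to the other,
  evaluation recovers \<open>y\<close> and the intertwining relation. Conversely an intertwining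
  \<open>W\<close> sends the operator of \<open>x\<close> to that of \<open>W x\<close>, and
  surjectivity of \<open>W\<close> yields the whole set.\<close>

lemma intertwine_iff:
  assumes M: "match t M M' \<Theta>" and N: "match t N N' \<Theta>'" and W: "unitary_op (fst M) (fst N) W"
    and V: "\<And>x. x \<in> carr (fst M) \<Longrightarrow> V (\<Theta> x) = \<Theta>' (W x)"
  shows "(\<lambda>\<xi>. V \<circ> \<xi>) ` snd M' = snd N' \<longleftrightarrow>
    (\<forall>b. \<forall>x\<in>carr (fst M). W (snd M b x) = snd N b (W x))" (is "?L \<longleftrightarrow> ?R")
proof
  note M_mod = match_rmod[OF M] and N_mod = match_rmod[OF N]
  note carr = Rz_carr[OF M_mod] Rz_carr[OF N_mod] unitary_carr[OF W]
  show ?R if L: ?L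
  proof (intro allI ballI)
    fix b x assume x: "x \<in> carr (fst M)"
    have "V \<circ> (\<Theta> \<circ> Rz t (snd M) x) \<in> snd N'"
      unfolding L[symmetric] using x by (auto simp: match_fact[OF M])
    then obtain y where y: "y \<in> carr (fst N)" "V \<circ> (\<Theta> \<circ> Rz t (snd M) x) = \<Theta>' \<circ> Rz t (snd N) y"
      by (auto simp: match_fact[OF N])
    have eq: "W (Rz t (snd M) x w) = Rz t (snd N) y w" for w
      using fun_cong[OF y(2), of w] x y(1) carr
      by (simp add: V unitary_inj[OF match_unitary[OF N]])
    \<comment> \<open>Evaluation at \<open>z\<close> returns the vector that labels an intertwiner;
      evaluation at \<open>l t b z\<close> below returns the action of \<open>b\<close> on
      it.\<close>
    have "y = W x" using eq[of z] x y(1) by (simp add: Rz_z[OF M_mod] Rz_z[OF N_mod])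
    then show "W (snd M b x) = snd N b (W x)"
      using eq[of "l t b z"] x y(1) by (simp add: Rz_l_z[OF M_mod] Rz_l_z[OF N_mod])
  qed
  show ?L if R: ?R
  proof -
    have "V \<circ> (\<Theta> \<circ> Rz t (snd M) x) = \<Theta>' \<circ> Rz t (snd N) (W x)" if "x \<in> carr (fst M)" for x
      using that R rmod_carr[OF M_mod]
      by (simp add: fun_eq_iff Rz_eq[OF M_mod] Rz_eq[OF N_mod] V carr)
    then have "(\<lambda>\<xi>. V \<circ> \<xi>) ` snd M' = (\<lambda>y. \<Theta>' \<circ> Rz t (snd N) y) ` W ` carr (fst M)"
      by (auto simp: match_fact[OF M] image_iff)
    then show ?thesis by (simp add: unitary_surj[OF W] match_fact[OF N])
  qed
qed

end

section \<open>Transport along the canonical unitaries\<close>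

text \<open>A commuting square: \<open>T\<close> and \<open>T'\<close> are one operator seen through
  the identifications. Preservation of carriers is included so that squares can be pasted.\<close>

definition transports :: "'a hilb \<Rightarrow> 'b hilb \<Rightarrow> ('a \<Rightarrow> 'c) \<Rightarrow> ('b \<Rightarrow> 'd) \<Rightarrow> ('a \<Rightarrow> 'b) \<Rightarrow> ('c \<Rightarrow> 'd) \<Rightarrow> bool"
  where "transports X Y \<Theta> \<Theta>' T T' \<longleftrightarrow> (\<forall>v\<in>carr X. T v \<in> carr Y \<and> T' (\<Theta> v) = \<Theta>' (T v))"

lemma transports_comp:
  "transports X Y \<Theta> \<Theta>' S S' \<Longrightarrow> transports Y Z \<Theta>' \<Theta>'' T T' \<Longrightarrow> transports X Z \<Theta> \<Theta>'' (T \<circ> S) (T' \<circ> S')"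
  by (simp add: transports_def)

lemma transports_lin_ext:
  assumes XY: "hspace X" "hspace Y" and \<Theta>: "unitary_op X X' \<Theta>" "unitary_op Y Y' \<Theta>'"
    and X: "carr X = cspan (f ` I)" and Y: "carr Y = cspan (h ` I)"
    and wd: "well_def ((\<lambda>i. (f i, h i)) ` I)"
    and G: "G = (\<lambda>i. (f i, h i)) ` I" and G': "G' = (\<lambda>i. (\<Theta> (f i), \<Theta>' (h i))) ` I"
  shows "transports X Y \<Theta> \<Theta>' (lin_ext G) (lin_ext G')"
  unfolding transports_def
proof (intro ballI conjI)
  fix v assume v: "v \<in> carr X"
  have *: "fst ` G = f ` I" "(\<lambda>(x, y). (\<Theta> x, \<Theta>' y)) ` G = G'"
    by (simp_all add: G G' image_image)
  have fh: "f i \<in> carr X \<and> h i \<in> carr Y" if "i \<in> I" for i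
    using that unfolding X Y by (auto intro: complex_vector.span_base)
  have GXY: "x \<in> carr X \<and> y \<in> carr Y" if "(x, y) \<in> G" for x y
    using that fh by (auto simp: G)
  have "chom X Y (lin_ext G)"
    using GXY
    by (intro chom_lin_ext[OF wd[folded G] _ _ hspace_subspace[OF XY(2)]]) (auto simp: *(1) X)
  then show "lin_ext G v \<in> carr Y" using v by (rule chom_carr)
  show "lin_ext G' (\<Theta> v) = \<Theta>' (lin_ext G v)"
    using lin_ext_transport[OF wd[folded G] \<Theta> GXY XY, of v] v by (simp add: * X)
qed

text \<open>\<open>\<Theta>'\<close> cancels by injectivity, and \<open>\<Theta>\<close> reaches all
  of \<open>carr X'\<close>, so an equation of composites holds on one side iff it holds on the
  other.\<close>

lemma transports_iff:
  assumes S: "transports X Y \<Theta> \<Theta>' S S'" and T: "transports X Y \<Theta> \<Theta>' T T'"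
    and \<Theta>: "unitary_op X X' \<Theta>" "unitary_op Y Y' \<Theta>'"
  shows "(\<forall>v\<in>carr X. S v = T v) \<longleftrightarrow> (\<forall>v\<in>carr X'. S' v = T' v)"
  using S T unitary_inj[OF \<Theta>(2)] by (simp add: transports_def flip: unitary_surj[OF \<Theta>(1)])

lemma set_triples: "{f x y z | x y z. True} = range (\<lambda>(x, y, z). f x y z)"
  by (auto simp: image_def)

lemma set_triples_range:
  assumes "A = range a" "B = range b"
  shows "{f x z y | x z y. x \<in> A \<and> z \<in> B} = range (\<lambda>(x, y, z). f (a x) (b z) y)"
  unfolding assms by (auto simp: image_iff) blast+

context bicyclic_frame
begin

lemma rhom_Rz:
  assumes "rmod s P" "rmod s M" "rhom P M S S'" "\<xi> \<in> carr (fst P)"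
  shows "S (Rz s (snd P) \<xi> w) = Rz s (snd M) (S \<xi>) w"
proof -
  have "S \<xi> \<in> carr (fst M)" using assms by (auto simp: rhom_def dest: chom_carr)
  then show ?thesis
    using assms by (simp add: Rz_eq[OF assms(1)] Rz_eq[OF assms(2)] rhom_intertwine[OF assms(3)])
qed

text \<open>Meant for threefold products: the inner tensor product is known by its elementary
  tensors, which merely span it.\<close>

lemma carr_rel_tensor_left:
  assumes P: "rmod s P" and Q: "rmod (flip s) Q" and A: "carr (fst P) = cspan A"
  shows "carr (rel_tensor g s P Q) = cspan ((\<lambda>(a, \<eta>). rel_vec g s P Q a \<eta>) ` (A \<times> carr (fst Q)))"
    (is "_ = cspan ?G")
proof
  have AP: "A \<subseteq> carr (fst P)" unfolding A by (rule complex_vector.span_superset)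
  show "cspan ?G \<subseteq> carr (rel_tensor g s P Q)"
    unfolding carr_rel_tensor[OF P Q] using AP by (intro complex_vector.span_mono image_mono) auto
  have "rel_vec g s P Q \<xi> \<eta> \<in> cspan ?G" if "\<xi> \<in> carr (fst P)" "\<eta> \<in> carr (fst Q)" for \<xi> \<eta>
  proof -
    note sub = hspace_subspace[OF rmod_hspace[OF P]]
    have 0: "rel_vec g s P Q 0 \<eta> = 0"
      using rel_vec_scale_left[OF P Q hspace_zero[OF rmod_hspace[OF P]] that(2), of 0] by simp
    have "cspan A \<subseteq> {\<xi> \<in> carr (fst P). rel_vec g s P Q \<xi> \<eta> \<in> cspan ?G}"
    proof (rule complex_vector.span_minimal)
      show "A \<subseteq> {\<xi> \<in> carr (fst P). rel_vec g s P Q \<xi> \<eta> \<in> cspan ?G}"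
        using AP that by (auto intro!: complex_vector.span_base)
      show "csubspace {\<xi> \<in> carr (fst P). rel_vec g s P Q \<xi> \<eta> \<in> cspan ?G}"
        using sub that(2) 0 complex_vector.span_zero[of ?G]
        by (simp add: complex_vector.subspace_def rel_vec_add_left[OF P Q]
            rel_vec_scale_left[OF P Q] complex_vector.span_add complex_vector.span_scale)
    qed
    then show ?thesis using that A by auto
  qed
  then show "carr (rel_tensor g s P Q) \<subseteq> cspan ?G"
    unfolding carr_rel_tensor[OF P Q]
    by (intro complex_vector.span_minimal complex_vector.subspace_span) auto
qed

lemma carr_rel_tensor_right:
  assumes P: "rmod s P" and Q: "rmod (flip s) Q" and A: "carr (fst Q) = cspan A"
  shows "carr (rel_tensor g s P Q) = cspan ((\<lambda>(\<xi>, a). rel_vec g s P Q \<xi> a) ` (carr (fst P) \<times> A))"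
    (is "_ = cspan ?G")
proof
  have AQ: "A \<subseteq> carr (fst Q)" unfolding A by (rule complex_vector.span_superset)
  show "cspan ?G \<subseteq> carr (rel_tensor g s P Q)"
    unfolding carr_rel_tensor[OF P Q] using AQ by (intro complex_vector.span_mono image_mono) auto
  have "rel_vec g s P Q \<xi> \<eta> \<in> cspan ?G" if "\<xi> \<in> carr (fst P)" "\<eta> \<in> carr (fst Q)" for \<xi> \<eta>
  proof -
    note sub = hspace_subspace[OF rmod_hspace[OF Q]]
    have 0: "rel_vec g s P Q \<xi> 0 = 0"
      using rel_vec_scale_right[OF P Q that(1) hspace_zero[OF rmod_hspace[OF Q]], of 0] by simp
    have "cspan A \<subseteq> {\<eta> \<in> carr (fst Q). rel_vec g s P Q \<xi> \<eta> \<in> cspan ?G}"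
    proof (rule complex_vector.span_minimal)
      show "A \<subseteq> {\<eta> \<in> carr (fst Q). rel_vec g s P Q \<xi> \<eta> \<in> cspan ?G}"
        using AQ that by (auto intro!: complex_vector.span_base)
      show "csubspace {\<eta> \<in> carr (fst Q). rel_vec g s P Q \<xi> \<eta> \<in> cspan ?G}"
        using sub that(1) 0 complex_vector.span_zero[of ?G]
        by (simp add: complex_vector.subspace_def rel_vec_add_right[OF P Q]
            rel_vec_scale_right[OF P Q] complex_vector.span_add complex_vector.span_scale)
    qed
    then show ?thesis using that A by auto
  qed
  then show "carr (rel_tensor g s P Q) \<subseteq> cspan ?G"
    unfolding carr_rel_tensor[OF P Q]
    by (intro complex_vector.span_minimal complex_vector.subspace_span) auto
qed

text \<open>The graph of \<open>c_op\<close> runs over all middle vectors. As \<open>S\<close>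
  carries \<open>R(\<xi>)\<close> to \<open>R(S \<xi>)\<close> by \<open>rhom_Rz\<close>, absorbing
  the middle vector on the left has the same effect in both components, and the image of the graph
  of \<open>rel_op\<close> remains.\<close>

lemma transports_op:
  assumes P: "match s P P' \<Theta>" and Q: "match (flip s) Q Q' \<Theta>'"
    and M: "match s M M' \<Lambda>" and N: "match (flip s) N N' \<Lambda>'"
    and S: "rhom P M S S'" and T: "rhom Q N T T'"
    and F: "\<forall>x\<in>carr (fst P). F (\<Theta> x) = \<Lambda> (S x)"
    and G: "\<forall>x\<in>carr (fst Q). G (\<Theta>' x) = \<Lambda>' (T x)"
  shows "transports (rel_tensor g s P Q) (rel_tensor g s M N) (can s P Q P' Q' \<Theta> \<Theta>')
    (can s M N M' N' \<Lambda> \<Lambda>') (rel_op g s P Q M N S T) (c_op P' Q' M' N' F G)"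
proof -
  note mods = match_rmod[OF P] match_rmod[OF Q] match_rmod[OF M] match_rmod[OF N]
  note Pm = mods(1) and Qm = mods(2) and Mm = mods(3) and Nm = mods(4)
  let ?f = "\<lambda>(\<xi>, \<eta>). rel_vec g s P Q \<xi> \<eta>" and ?h = "\<lambda>(\<xi>, \<eta>). rel_vec g s M N (S \<xi>) (T \<eta>)"
  let ?I = "carr (fst P) \<times> carr (fst Q)"
  let ?c = "can s P Q P' Q' \<Theta> \<Theta>'" and ?d = "can s M N M' N' \<Lambda> \<Lambda>'"
  have ST: "S \<xi> \<in> carr (fst M)" "T \<eta> \<in> carr (fst N)" if "\<xi> \<in> carr (fst P)" "\<eta> \<in> carr (fst Q)" for \<xi> \<eta>
    using that S T by (auto simp: rhom_def dest: chom_carr)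
  have SR: "F \<circ> (\<Theta> \<circ> Rz s (snd P) \<xi>) = \<Lambda> \<circ> Rz s (snd M) (S \<xi>)" if "\<xi> \<in> carr (fst P)" for \<xi>
    using that by (simp add: fun_eq_iff F Rz_carr[OF Pm] rhom_Rz[OF Pm Mm S])
  have TR: "G \<circ> (\<Theta>' \<circ> Rz (flip s) (snd Q) \<eta>) = \<Lambda>' \<circ> Rz (flip s) (snd N) (T \<eta>)"
    if "\<eta> \<in> carr (fst Q)" for \<eta>
    using that by (simp add: fun_eq_iff G Rz_carr[OF Qm] rhom_Rz[OF Qm Nm T])
  have el: "(c_vec P' Q' (\<Theta> \<circ> Rz s (snd P) \<xi>) w (\<Theta>' \<circ> Rz (flip s) (snd Q) \<eta>),
      c_vec M' N' (F \<circ> (\<Theta> \<circ> Rz s (snd P) \<xi>)) w (G \<circ> (\<Theta>' \<circ> Rz (flip s) (snd Q) \<eta>))) =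
      (?c (?f (Rz s (snd P) \<xi> w, \<eta>)), ?d (?h (Rz s (snd P) \<xi> w, \<eta>)))"
    if "\<xi> \<in> carr (fst P)" "\<eta> \<in> carr (fst Q)" for \<xi> \<eta> w
    using that
    by (simp add: SR TR can_vec[OF P Q] can_vec[OF M N] ST Rz_carr[OF Pm] rhom_Rz[OF Pm Mm S]
        Rz_carr[OF Mm] flip: c_vec_left[OF P Q] c_vec_left[OF M N])
  have "{(c_vec P' Q' \<xi> w \<eta>, c_vec M' N' (F \<circ> \<xi>) w (G \<circ> \<eta>)) | \<xi> w \<eta>. \<xi> \<in> snd P' \<and> \<eta> \<in> snd Q'} =
      (\<lambda>i. (?c (?f i), ?d (?h i))) ` ?I" (is "?L = ?R")
  proof
    show "?L \<subseteq> ?R"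
    proof
      fix p assume "p \<in> ?L"
      then obtain \<xi> w \<eta> where c: "\<xi> \<in> carr (fst P)" "\<eta> \<in> carr (fst Q)"
        and p: "p = (c_vec P' Q' (\<Theta> \<circ> Rz s (snd P) \<xi>) w (\<Theta>' \<circ> Rz (flip s) (snd Q) \<eta>),
          c_vec M' N' (F \<circ> (\<Theta> \<circ> Rz s (snd P) \<xi>)) w (G \<circ> (\<Theta>' \<circ> Rz (flip s) (snd Q) \<eta>)))"
        unfolding match_fact[OF P] match_fact[OF Q] by blast
      show "p \<in> ?R"
        unfolding p el[OF c] by (rule imageI) (use c Rz_carr[OF Pm] in simp)
    qed
    show "?R \<subseteq> ?L"
    proof
      fix p assume "p \<in> ?R"
      then obtain \<xi> \<eta> where c: "\<xi> \<in> carr (fst P)" "\<eta> \<in> carr (fst Q)"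
        and p: "p = (?c (?f (\<xi>, \<eta>)), ?d (?h (\<xi>, \<eta>)))" by auto
      have "p = (c_vec P' Q' (\<Theta> \<circ> Rz s (snd P) \<xi>) z (\<Theta>' \<circ> Rz (flip s) (snd Q) \<eta>),
          c_vec M' N' (F \<circ> (\<Theta> \<circ> Rz s (snd P) \<xi>)) z (G \<circ> (\<Theta>' \<circ> Rz (flip s) (snd Q) \<eta>)))"
        unfolding p el[OF c] by (simp add: Rz_z[OF Pm] c)
      moreover have "\<Theta> \<circ> Rz s (snd P) \<xi> \<in> snd P'" "\<Theta>' \<circ> Rz (flip s) (snd Q) \<eta> \<in> snd Q'"
        using c by (simp_all add: match_fact[OF P] match_fact[OF Q])
      ultimately show "p \<in> ?L" by blast
    qed
  qed
  note graph = this
  have hom: "chom (rel_tensor g s P Q) (rel_tensor g s M N) (rel_op g s P Q M N S T)"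
    by (rule rel_op_chom[OF Pm Qm Mm Nm S T])
  show ?thesis
    unfolding transports_def c_op_def graph
  proof (intro ballI conjI)
    fix v assume v: "v \<in> carr (rel_tensor g s P Q)"
    then show "rel_op g s P Q M N S T v \<in> carr (rel_tensor g s M N)" by (rule chom_carr[OF hom])
    let ?E = "(\<lambda>(\<xi>, \<eta>). (rel_vec g s P Q \<xi> \<eta>, rel_vec g s M N (S \<xi>) (T \<eta>))) ` ?I"
    have "lin_ext ((\<lambda>(x, y). (?c x, ?d y)) ` ?E) (?c v) = ?d (lin_ext ?E v)"
    proof (rule lin_ext_transport[OF well_def_rel_op[OF Pm Qm Mm Nm S T] can_unitary[OF P Q]
          can_unitary[OF M N] _ hspace_rel_tensor[OF Pm Qm] hspace_rel_tensor[OF Mm Nm]])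
      show "v \<in> cspan (fst ` ?E)"
        using v by (simp add: carr_rel_tensor[OF Pm Qm] image_image case_prod_beta)
    qed (auto simp: rel_vec_carr[OF Pm Qm] rel_vec_carr[OF Mm Nm] ST)
    moreover have "(\<lambda>(x, y). (?c x, ?d y)) ` ?E = (\<lambda>i. (?c (?f i), ?d (?h i))) ` ?I"
      by (simp add: image_image case_prod_beta)
    ultimately show "lin_ext ((\<lambda>i. (?c (?f i), ?d (?h i))) ` ?I) (?c v) = ?d (rel_op g s P Q M N S T v)"
      by (simp add: rel_op_eq[OF Pm Qm Mm Nm S T])
  qed
qed

lemma match_whole: "match s (whole, \<kappa>) (whole, \<gamma>) id \<Longrightarrow> \<gamma> = range (Rz s \<kappa>)"
  using match_fact by fastforce

section \<open>Reassociation of threefold products\<close>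

context
  fixes s t and \<kappa> \<tau> \<epsilon> \<phi> :: "'n \<Rightarrow> 'h::fd_hilbert \<Rightarrow> 'h" and \<gamma> \<delta> \<epsilon>' \<phi>' :: "('k \<Rightarrow> 'h) set"
  assumes K: "match s (whole, \<kappa>) (whole, \<gamma>) id" and T: "match (flip s) (whole, \<tau>) (whole, \<delta>) id"
    and E: "match t (whole, \<epsilon>) (whole, \<epsilon>') id" and F: "match (flip t) (whole, \<phi>) (whole, \<phi>') id"
    and comm: "\<And>a b x. \<tau> a (\<epsilon> b x) = \<epsilon> b (\<tau> a x)"
begin

lemma commuting_TE: "commuting (whole, \<tau>) \<epsilon>"
  by (simp add: commuting_def comm)

lemma commuting_ET: "commuting (whole, \<epsilon>) \<tau>"
  by (simp add: commuting_def comm)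

abbreviation (input) "KT \<equiv> rel_leg2 g s (whole, \<kappa>) (whole, \<tau>) \<epsilon>"
abbreviation (input) "EF \<equiv> rel_leg1 g t (whole, \<epsilon>) (whole, \<phi>) \<tau>"
abbreviation (input) "KT' \<equiv> c_leg2 (whole, \<gamma>) (whole, \<delta>) \<epsilon>'"
abbreviation (input) "EF' \<equiv> c_leg1 (whole, \<epsilon>') (whole, \<phi>') \<delta>"
abbreviation (input) "can_KT \<equiv> can s (whole, \<kappa>) (whole, \<tau>) (whole, \<gamma>) (whole, \<delta>) id id"
abbreviation (input) "can_EF \<equiv> can t (whole, \<epsilon>) (whole, \<phi>) (whole, \<epsilon>') (whole, \<phi>') id id"
abbreviation (input) "KT_F \<equiv> \<lambda>(\<xi>, \<eta>, \<theta>). rel_vec g t KT (whole, \<phi>) (rel_vec g s (whole, \<kappa>) (whole, \<tau>) \<xi> \<eta>) \<theta>"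
abbreviation (input) "K_EF \<equiv> \<lambda>(\<xi>, \<eta>, \<theta>). rel_vec g s (whole, \<kappa>) EF \<xi> (rel_vec g t (whole, \<epsilon>) (whole, \<phi>) \<eta> \<theta>)"

lemma match_KT: "match t KT KT' can_KT"
  using match_leg2[OF K T _ commuting_TE] E by simp

lemma match_EF: "match (flip s) EF EF' can_EF"
  using match_leg1[OF E F _ commuting_ET] T by simp

lemmas K_mod = match_rmod[OF K] and T_mod = match_rmod[OF T] and E_mod = match_rmod[OF E]
  and F_mod = match_rmod[OF F] and KT_mod = match_rmod[OF match_KT] and EF_mod = match_rmod[OF match_EF]

lemma fst_KT: "fst KT = rel_tensor g s (whole, \<kappa>) (whole, \<tau>)"
  by (rule fst_rel_leg[OF K_mod T_mod])

lemma fst_EF: "fst EF = rel_tensor g t (whole, \<epsilon>) (whole, \<phi>)"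
  by (rule fst_rel_leg[OF E_mod F_mod])

lemma KT_carr: "rel_vec g s (whole, \<kappa>) (whole, \<tau>) \<xi> \<eta> \<in> carr (fst KT)"
  unfolding fst_KT by (rule rel_vec_carr[OF K_mod T_mod]) simp_all

lemma EF_carr: "rel_vec g t (whole, \<epsilon>) (whole, \<phi>) \<xi> \<eta> \<in> carr (fst EF)"
  unfolding fst_EF by (rule rel_vec_carr[OF E_mod F_mod]) simp_all

lemma carr_KT_F: "carr (rel_tensor g t KT (whole, \<phi>)) = cspan (range KT_F)"
proof -
  have "range KT_F = (\<lambda>(v, \<theta>). rel_vec g t KT (whole, \<phi>) v \<theta>) `
      ((\<lambda>(\<xi>, \<eta>). rel_vec g s (whole, \<kappa>) (whole, \<tau>) \<xi> \<eta>) ` (UNIV \<times> UNIV) \<times> UNIV)"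
    by (auto simp: image_iff) blast+
  then show ?thesis
    using carr_rel_tensor_left[OF KT_mod F_mod] carr_rel_tensor[OF K_mod T_mod] by (simp add: fst_KT)
qed

lemma carr_K_EF: "carr (rel_tensor g s (whole, \<kappa>) EF) = cspan (range K_EF)"
proof -
  have "range K_EF = (\<lambda>(\<xi>, v). rel_vec g s (whole, \<kappa>) EF \<xi> v) `
      (UNIV \<times> (\<lambda>(\<eta>, \<theta>). rel_vec g t (whole, \<epsilon>) (whole, \<phi>) \<eta> \<theta>) ` (UNIV \<times> UNIV))"
    by (auto simp: image_iff) blast+
  then show ?thesis
    using carr_rel_tensor_right[OF K_mod EF_mod] carr_rel_tensor[OF E_mod F_mod] by (simp add: fst_EF)
qed

text \<open>The outer legs enter only through their brackets, which act on the middle leg by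
  \<open>\<tau>\<close> and \<open>\<epsilon>\<close>. The two bracketings produce these actions in
  opposite order, and they commute.\<close>

lemma assoc_gram:
  "ip (rel_tensor g s (whole, \<kappa>) EF) (K_EF i) (K_EF j) = ip (rel_tensor g t KT (whole, \<phi>)) (KT_F i) (KT_F j)"
proof -
  obtain \<xi> \<eta> \<theta> \<xi>' \<eta>' \<theta>' where ij: "i = (\<xi>, \<eta>, \<theta>)" "j = (\<xi>', \<eta>', \<theta>')" by (metis prod_cases3)
  let ?a = "bracket s (whole, \<kappa>) \<xi> \<xi>'" and ?b = "bracket (flip t) (whole, \<phi>) \<theta> \<theta>'"
  have Tm: "rmod (flip s) (fst (whole, \<epsilon>), \<tau>)" and Em: "rmod t (fst (whole, \<tau>), \<epsilon>)"
    using T_mod E_mod by simp_all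
  have "ip (rel_tensor g s (whole, \<kappa>) EF) (K_EF i) (K_EF j) = cinner \<eta> (\<epsilon> ?b (\<tau> ?a \<eta>'))"
    using T EF_carr
    by (simp add: ij rel_ip[OF K_mod EF_mod] rel_kernel_right[OF K_mod EF_mod]
        rel_leg1_vec[OF E_mod F_mod Tm commuting_ET]
        fst_EF rel_ip[OF E_mod F_mod] rel_kernel_left[OF E_mod F_mod])
  moreover have "ip (rel_tensor g t KT (whole, \<phi>)) (KT_F i) (KT_F j) = cinner \<eta> (\<tau> ?a (\<epsilon> ?b \<eta>'))"
    using E KT_carr
    by (simp add: ij rel_ip[OF KT_mod F_mod] rel_kernel_left[OF KT_mod F_mod]
        rel_leg2_vec[OF K_mod T_mod Em commuting_TE]
        fst_KT rel_ip[OF K_mod T_mod] rel_kernel_right[OF K_mod T_mod])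
  ultimately show ?thesis by (simp add: comm)
qed

text \<open>\<open>c_assoc\<close> is defined by nested kets; on the relative side these are
  threefold elementary tensors with \<open>\<eta>\<close> as middle leg.\<close>

lemma ket_KT_F:
  "ket2 KT' (whole, \<phi>') (Rz (flip t) \<phi> \<theta>) (ket1 (whole, \<gamma>) (whole, \<delta>) (Rz s \<kappa> \<xi>) \<eta>) =
    can t KT (whole, \<phi>) KT' (whole, \<phi>') can_KT id (KT_F (\<xi>, \<eta>, \<theta>))"
  using ket2_eq[OF match_KT F KT_carr] ket1_eq[OF K T] by simp

lemma ket_K_EF:
  "ket1 (whole, \<gamma>) EF' (Rz s \<kappa> \<xi>) (ket2 (whole, \<epsilon>') (whole, \<phi>') (Rz (flip t) \<phi> \<theta>) \<eta>) =
    can s (whole, \<kappa>) EF (whole, \<gamma>) EF' id can_EF (K_EF (\<xi>, \<eta>, \<theta>))"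
  using ket1_eq[OF K match_EF _ EF_carr] ket2_eq[OF E F] by simp

lemma transports_assoc:
  "transports (rel_tensor g t KT (whole, \<phi>)) (rel_tensor g s (whole, \<kappa>) EF)
    (can t KT (whole, \<phi>) KT' (whole, \<phi>') can_KT id) (can s (whole, \<kappa>) EF (whole, \<gamma>) EF' id can_EF)
    (rel_assoc g s \<kappa> \<tau> t \<epsilon> \<phi>) (c_assoc \<gamma> \<delta> \<epsilon>' \<phi>')"
  unfolding rel_assoc_def c_assoc_def Let_def
proof (rule transports_lin_ext[OF hspace_rel_tensor[OF KT_mod F_mod] hspace_rel_tensor[OF K_mod EF_mod]
      can_unitary[OF match_KT F] can_unitary[OF K match_EF] carr_KT_F carr_K_EF])
  show "well_def (range (\<lambda>i. (KT_F i, K_EF i)))"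
    by (rule well_def_gram[OF hspace_rel_tensor[OF KT_mod F_mod] hspace_rel_tensor[OF K_mod EF_mod]
        _ carr_K_EF assoc_gram]) (simp add: carr_KT_F complex_vector.span_superset)
  show "{(ket2 KT' (whole, \<phi>') \<eta> (ket1 (whole, \<gamma>) (whole, \<delta>) \<xi> x),
      ket1 (whole, \<gamma>) EF' \<xi> (ket2 (whole, \<epsilon>') (whole, \<phi>') \<eta> x)) | \<xi> \<eta> x. \<xi> \<in> \<gamma> \<and> \<eta> \<in> \<phi>'} =
    range (\<lambda>i. (can t KT (whole, \<phi>) KT' (whole, \<phi>') can_KT id (KT_F i),
      can s (whole, \<kappa>) EF (whole, \<gamma>) EF' id can_EF (K_EF i)))"
    unfolding set_triples_range[OF match_whole[OF K] match_whole[OF F]]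
    by (simp add: case_prod_beta ket_KT_F ket_K_EF)
qed (subst set_triples, simp add: case_prod_beta)

lemma transports_assoc_inv:
  "transports (rel_tensor g s (whole, \<kappa>) EF) (rel_tensor g t KT (whole, \<phi>))
    (can s (whole, \<kappa>) EF (whole, \<gamma>) EF' id can_EF) (can t KT (whole, \<phi>) KT' (whole, \<phi>') can_KT id)
    (rel_assoc_inv g s \<kappa> \<tau> t \<epsilon> \<phi>) (c_assoc_inv \<gamma> \<delta> \<epsilon>' \<phi>')"
  unfolding rel_assoc_inv_def c_assoc_inv_def Let_def
proof (rule transports_lin_ext[OF hspace_rel_tensor[OF K_mod EF_mod] hspace_rel_tensor[OF KT_mod F_mod]
      can_unitary[OF K match_EF] can_unitary[OF match_KT F] carr_K_EF carr_KT_F])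
  show "well_def (range (\<lambda>i. (K_EF i, KT_F i)))"
    by (rule well_def_gram[OF hspace_rel_tensor[OF K_mod EF_mod] hspace_rel_tensor[OF KT_mod F_mod]
        _ carr_KT_F assoc_gram[symmetric]]) (simp add: carr_K_EF complex_vector.span_superset)
  show "{(ket1 (whole, \<gamma>) EF' \<xi> (ket2 (whole, \<epsilon>') (whole, \<phi>') \<eta> x),
      ket2 KT' (whole, \<phi>') \<eta> (ket1 (whole, \<gamma>) (whole, \<delta>) \<xi> x)) | \<xi> \<eta> x. \<xi> \<in> \<gamma> \<and> \<eta> \<in> \<phi>'} =
    range (\<lambda>i. (can s (whole, \<kappa>) EF (whole, \<gamma>) EF' id can_EF (K_EF i),
      can t KT (whole, \<phi>) KT' (whole, \<phi>') can_KT id (KT_F i)))"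
    unfolding set_triples_range[OF match_whole[OF K] match_whole[OF F]]
    by (simp add: case_prod_beta ket_KT_F ket_K_EF)
qed (subst set_triples, simp add: case_prod_beta)

end

end

section \<open>The flip of a twofold product\<close>

context bicyclic_frame
begin

context
  fixes s and \<kappa> \<tau> :: "'n \<Rightarrow> 'h::fd_hilbert \<Rightarrow> 'h" and \<gamma> \<delta> :: "('k \<Rightarrow> 'h) set"
  assumes K: "match s (whole, \<kappa>) (whole, \<gamma>) id" and T: "match (flip s) (whole, \<tau>) (whole, \<delta>) id"
begin

lemma match_flip_flip: "match (flip (flip s)) (whole, \<kappa>) (whole, \<gamma>) id"
  using K by simp

lemmas flip_K = match_rmod[OF K] and flip_T = match_rmod[OF T] and flip_K' = match_rmod[OF match_flip_flip]

lemma carr_rel_tensor_whole: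
  "carr (rel_tensor g s (whole, \<kappa>) (whole, \<tau>)) =
    cspan (range (\<lambda>(\<xi>, \<eta>). rel_vec g s (whole, \<kappa>) (whole, \<tau>) \<xi> \<eta>))"
  using carr_rel_tensor[OF flip_K flip_T] by simp

lemma carr_rel_tensor_whole_flip:
  "carr (rel_tensor g (flip s) (whole, \<tau>) (whole, \<kappa>)) =
    cspan (range (\<lambda>(\<xi>, \<eta>). rel_vec g (flip s) (whole, \<tau>) (whole, \<kappa>) \<eta> \<xi>))"
proof -
  have "range (\<lambda>(\<xi>, \<eta>). rel_vec g (flip s) (whole, \<tau>) (whole, \<kappa>) \<eta> \<xi>) =
      range (\<lambda>(\<xi>, \<eta>). rel_vec g (flip s) (whole, \<tau>) (whole, \<kappa>) \<xi> \<eta>)"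
    by (auto simp: image_def)
  then show ?thesis using carr_rel_tensor[OF flip_T flip_K'] by simp
qed

text \<open>The same bracket acts on the same leg whichever factor is written first:
  \<open>rel_kernel_right\<close> on one side is \<open>rel_kernel_left\<close> on the
  other.\<close>

lemma flip_gram:
  "ip (rel_tensor g (flip s) (whole, \<tau>) (whole, \<kappa>))
      ((\<lambda>(\<xi>, \<eta>). rel_vec g (flip s) (whole, \<tau>) (whole, \<kappa>) \<eta> \<xi>) i)
      ((\<lambda>(\<xi>, \<eta>). rel_vec g (flip s) (whole, \<tau>) (whole, \<kappa>) \<eta> \<xi>) j) =
    ip (rel_tensor g s (whole, \<kappa>) (whole, \<tau>))
      ((\<lambda>(\<xi>, \<eta>). rel_vec g s (whole, \<kappa>) (whole, \<tau>) \<xi> \<eta>) i)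
      ((\<lambda>(\<xi>, \<eta>). rel_vec g s (whole, \<kappa>) (whole, \<tau>) \<xi> \<eta>) j)"
  by (cases i; cases j; simp add: rel_ip[OF flip_T flip_K'] rel_ip[OF flip_K flip_T]
      rel_kernel_right[OF flip_T flip_K'] rel_kernel_left[OF flip_K flip_T])

lemma rel_flip_eq: "rel_flip g s (whole, \<kappa>) (whole, \<tau>) = lin_ext (range (\<lambda>i.
    ((\<lambda>(\<xi>, \<eta>). rel_vec g s (whole, \<kappa>) (whole, \<tau>) \<xi> \<eta>) i,
     (\<lambda>(\<xi>, \<eta>). rel_vec g (flip s) (whole, \<tau>) (whole, \<kappa>) \<eta> \<xi>) i)))"
  unfolding rel_flip_def by (rule arg_cong[where f = lin_ext]) (auto simp: image_def)

lemma rel_flip_unitary: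
  "unitary_op (rel_tensor g s (whole, \<kappa>) (whole, \<tau>)) (rel_tensor g (flip s) (whole, \<tau>) (whole, \<kappa>))
    (rel_flip g s (whole, \<kappa>) (whole, \<tau>))"
  unfolding rel_flip_eq
  by (rule unitary_lin_ext[OF hspace_rel_tensor[OF flip_K flip_T] hspace_rel_tensor[OF flip_T flip_K']
        carr_rel_tensor_whole carr_rel_tensor_whole_flip flip_gram])

lemma well_def_rel_flip: "well_def (range (\<lambda>i.
    ((\<lambda>(\<xi>, \<eta>). rel_vec g s (whole, \<kappa>) (whole, \<tau>) \<xi> \<eta>) i,
     (\<lambda>(\<xi>, \<eta>). rel_vec g (flip s) (whole, \<tau>) (whole, \<kappa>) \<eta> \<xi>) i)))"
  by (rule well_def_gram[OF hspace_rel_tensor[OF flip_K flip_T] hspace_rel_tensor[OF flip_T flip_K']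
        _ carr_rel_tensor_whole_flip flip_gram])
    (simp add: carr_rel_tensor_whole complex_vector.span_superset)

lemma rel_flip_vec: "rel_flip g s (whole, \<kappa>) (whole, \<tau>) (rel_vec g s (whole, \<kappa>) (whole, \<tau>) \<xi> \<eta>) =
    rel_vec g (flip s) (whole, \<tau>) (whole, \<kappa>) \<eta> \<xi>"
  unfolding rel_flip_eq by (rule lin_ext_base[OF well_def_rel_flip]) (auto simp: image_def)

lemma transports_flip:
  "transports (rel_tensor g s (whole, \<kappa>) (whole, \<tau>)) (rel_tensor g (flip s) (whole, \<tau>) (whole, \<kappa>))
    (can s (whole, \<kappa>) (whole, \<tau>) (whole, \<gamma>) (whole, \<delta>) id id)
    (can (flip s) (whole, \<tau>) (whole, \<kappa>) (whole, \<delta>) (whole, \<gamma>) id id)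
    (rel_flip g s (whole, \<kappa>) (whole, \<tau>)) (c_flip (whole, \<gamma>) (whole, \<delta>))"
proof -
  let ?c = "can s (whole, \<kappa>) (whole, \<tau>) (whole, \<gamma>) (whole, \<delta>) id id"
  let ?d = "can (flip s) (whole, \<tau>) (whole, \<kappa>) (whole, \<delta>) (whole, \<gamma>) id id"
  \<comment> \<open>The middle vector goes into the factor over \<open>\<kappa>\<close> in both
    products, on the left before and on the right after the flip, so both components stay
    parametrized by the same vectors.\<close>
  have 1: "c_vec (whole, \<gamma>) (whole, \<delta>) (Rz s \<kappa> \<xi>) w (Rz (flip s) \<tau> \<eta>) =
      ?c (rel_vec g s (whole, \<kappa>) (whole, \<tau>) (Rz s \<kappa> \<xi> w) \<eta>)" for \<xi> w \<eta>
    using c_vec_left[OF K T, of \<xi> \<eta> w] can_vec[OF K T] by simp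
  have 2: "c_vec (whole, \<delta>) (whole, \<gamma>) (Rz (flip s) \<tau> \<eta>) w (Rz s \<kappa> \<xi>) =
      ?d (rel_vec g (flip s) (whole, \<tau>) (whole, \<kappa>) \<eta> (Rz s \<kappa> \<xi> w))" for \<xi> w \<eta>
    using c_vec_right[OF T match_flip_flip, of \<eta> \<xi> w] can_vec[OF T match_flip_flip] by simp
  have 3: "Rz s \<kappa> \<xi> z = \<xi>" for \<xi> using Rz_z[OF flip_K] by simp
  have "{(c_vec (whole, \<gamma>) (whole, \<delta>) \<xi> w \<eta>, c_vec (whole, \<delta>) (whole, \<gamma>) \<eta> w \<xi>) | \<xi> w \<eta>.
      \<xi> \<in> \<gamma> \<and> \<eta> \<in> \<delta>} =
    {(?c (rel_vec g s (whole, \<kappa>) (whole, \<tau>) (Rz s \<kappa> \<xi> w) \<eta>),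
      ?d (rel_vec g (flip s) (whole, \<tau>) (whole, \<kappa>) \<eta> (Rz s \<kappa> \<xi> w))) | \<xi> w \<eta>. True}"
    unfolding 1[symmetric] 2[symmetric] using match_whole[OF K] match_whole[OF T] by blast
  also have "\<dots> = {(?c (rel_vec g s (whole, \<kappa>) (whole, \<tau>) \<xi> \<eta>),
      ?d (rel_vec g (flip s) (whole, \<tau>) (whole, \<kappa>) \<eta> \<xi>)) | \<xi> \<eta>. True}"
    using 3 by (metis (no_types, lifting))
  also have "\<dots> = range (\<lambda>i. (?c ((\<lambda>(\<xi>, \<eta>). rel_vec g s (whole, \<kappa>) (whole, \<tau>) \<xi> \<eta>) i),
     ?d ((\<lambda>(\<xi>, \<eta>). rel_vec g (flip s) (whole, \<tau>) (whole, \<kappa>) \<eta> \<xi>) i)))"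
    by (auto simp: image_def)
  finally show ?thesis
    unfolding rel_flip_eq c_flip_def snd_conv
    by (intro transports_lin_ext[OF hspace_rel_tensor[OF flip_K flip_T] hspace_rel_tensor[OF flip_T flip_K']
        can_unitary[OF K T] can_unitary[OF T match_flip_flip] carr_rel_tensor_whole
        carr_rel_tensor_whole_flip well_def_rel_flip refl])
qed

end

lemma transports_op_left:
  assumes P: "match s P P' \<Theta>" and Q: "match (flip s) (whole, \<tau>) (whole, \<delta>) id" and M: "match s M M' \<Lambda>"
    and S: "rhom P M S S'" and F: "\<forall>x\<in>carr (fst P). F (\<Theta> x) = \<Lambda> (S x)"
  shows "transports (rel_tensor g s P (whole, \<tau>)) (rel_tensor g s M (whole, \<tau>))
    (can s P (whole, \<tau>) P' (whole, \<delta>) \<Theta> id) (can s M (whole, \<tau>) M' (whole, \<delta>) \<Lambda> id)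
    (rel_op g s P (whole, \<tau>) M (whole, \<tau>) S id) (c_op P' (whole, \<delta>) M' (whole, \<delta>) F id)"
  by (rule transports_op[OF P Q M Q S rhom_id F]) simp

lemma transports_op_right:
  assumes P: "match (flip s) P P' \<Theta>" and Q: "match s (whole, \<tau>) (whole, \<delta>) id"
    and M: "match (flip s) M M' \<Lambda>"
    and S: "rhom P M S S'" and F: "\<forall>x\<in>carr (fst P). F (\<Theta> x) = \<Lambda> (S x)"
  shows "transports (rel_tensor g s (whole, \<tau>) P) (rel_tensor g s (whole, \<tau>) M)
    (can s (whole, \<tau>) P (whole, \<delta>) P' id \<Theta>) (can s (whole, \<tau>) M (whole, \<delta>) M' id \<Lambda>)
    (rel_op g s (whole, \<tau>) P (whole, \<tau>) M id S) (c_op (whole, \<delta>) P' (whole, \<delta>) M' id F)"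
  by (rule transports_op[OF Q P Q M rhom_id S _ F]) simp

section \<open>Equivalence of the two notions\<close>

context
  fixes \<rho> \<sigma> \<sigma>h :: "'n \<Rightarrow> 'h::fd_hilbert \<Rightarrow> 'h" and \<alpha> \<beta> \<beta>h :: "('k \<Rightarrow> 'h) set"
  assumes R: "match Opp (whole, \<rho>) (whole, \<alpha>) id" and S: "match Alg (whole, \<sigma>) (whole, \<beta>) id"
    and Sh: "match Alg (whole, \<sigma>h) (whole, \<beta>h) id"
    and \<rho>\<sigma>: "\<And>a b x. \<rho> a (\<sigma> b x) = \<sigma> b (\<rho> a x)" and \<rho>\<sigma>h: "\<And>a b x. \<rho> a (\<sigma>h b x) = \<sigma>h b (\<rho> a x)"
    and \<sigma>\<sigma>h: "\<And>a b x. \<sigma> a (\<sigma>h b x) = \<sigma>h b (\<sigma> a x)"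
begin

lemma R': "match (flip Alg) (whole, \<rho>) (whole, \<alpha>) id"
  and S': "match (flip Opp) (whole, \<sigma>) (whole, \<beta>) id"
  using R S by simp_all

lemmas R_mod = match_rmod[OF R'] and S_mod = match_rmod[OF S'] and Sh_mod = match_rmod[OF Sh]
  and R_mod' = match_rmod[OF R] and S_mod' = match_rmod[OF S]

lemma leg_commuting: "commuting (whole, \<rho>) \<sigma>" "commuting (whole, \<rho>) \<sigma>h" "commuting (whole, \<sigma>) \<rho>"
  "commuting (whole, \<sigma>) \<sigma>h" "commuting (whole, \<sigma>h) \<rho>" "commuting (whole, \<sigma>h) \<sigma>"
  by (simp_all add: commuting_def \<rho>\<sigma> \<rho>\<sigma>h \<sigma>\<sigma>h)

abbreviation (input) "\<Phi> \<equiv> can Alg (whole, \<sigma>h) (whole, \<rho>) (whole, \<beta>h) (whole, \<alpha>) id id"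
abbreviation (input) "\<Psi> \<equiv> can Opp (whole, \<rho>) (whole, \<sigma>) (whole, \<alpha>) (whole, \<beta>) id id"
abbreviation (input) "domV \<equiv> rel_tensor g Alg (whole, \<sigma>h) (whole, \<rho>)"
abbreviation (input) "ranV \<equiv> rel_tensor g Opp (whole, \<rho>) (whole, \<sigma>)"

lemma fst_legs: "fst (rel_leg1 g Alg (whole, \<sigma>h) (whole, \<rho>) r) = domV"
  "fst (rel_leg2 g Alg (whole, \<sigma>h) (whole, \<rho>) r) = domV"
  "fst (rel_leg1 g Opp (whole, \<rho>) (whole, \<sigma>) r) = ranV"
  "fst (rel_leg2 g Opp (whole, \<rho>) (whole, \<sigma>) r) = ranV"
  by (simp_all add: rel_leg1_def rel_leg2_def)

text \<open>These are the factorizations of the domain in the C*-conditions, with the leg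
  representations that they encode; \<open>match_ran\<close> lists their counterparts in the same
  order.\<close>

lemma match_dom:
  "match Opp (rel_leg1 g Alg (whole, \<sigma>h) (whole, \<rho>) \<rho>) (c_leg1 (whole, \<beta>h) (whole, \<alpha>) \<alpha>) \<Phi>"
  "match Alg (rel_leg1 g Alg (whole, \<sigma>h) (whole, \<rho>) \<sigma>) (c_leg1 (whole, \<beta>h) (whole, \<alpha>) \<beta>) \<Phi>"
  "match Alg (rel_leg2 g Alg (whole, \<sigma>h) (whole, \<rho>) \<sigma>) (c_leg2 (whole, \<beta>h) (whole, \<alpha>) \<beta>) \<Phi>"
  "match Alg (rel_leg2 g Alg (whole, \<sigma>h) (whole, \<rho>) \<sigma>h) (c_leg2 (whole, \<beta>h) (whole, \<alpha>) \<beta>h) \<Phi>"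
  by (rule match_leg1[OF Sh R'] match_leg2[OF Sh R']; simp add: R S Sh leg_commuting)+

lemma match_ran:
  "match Opp (rel_leg2 g Opp (whole, \<rho>) (whole, \<sigma>) \<rho>) (c_leg2 (whole, \<alpha>) (whole, \<beta>) \<alpha>) \<Psi>"
  "match Alg (rel_leg1 g Opp (whole, \<rho>) (whole, \<sigma>) \<sigma>) (c_leg1 (whole, \<alpha>) (whole, \<beta>) \<beta>) \<Psi>"
  "match Alg (rel_leg1 g Opp (whole, \<rho>) (whole, \<sigma>) \<sigma>h) (c_leg1 (whole, \<alpha>) (whole, \<beta>) \<beta>h) \<Psi>"
  "match Alg (rel_leg2 g Opp (whole, \<rho>) (whole, \<sigma>) \<sigma>h) (c_leg2 (whole, \<alpha>) (whole, \<beta>) \<beta>h) \<Psi>"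
  by (rule match_leg1[OF R S'] match_leg2[OF R S']; simp add: R S Sh leg_commuting)+

lemma match_SR:
  "match Opp (rel_leg1 g Alg (whole, \<sigma>) (whole, \<rho>) \<rho>) (c_leg1 (whole, \<beta>) (whole, \<alpha>) \<alpha>)
    (can Alg (whole, \<sigma>) (whole, \<rho>) (whole, \<beta>) (whole, \<alpha>) id id)"
  by (rule match_leg1[OF S R']; simp add: R leg_commuting)

text \<open>The second and third legs enter the Gram matrices through their brackets, acting on the
  first leg by \<open>\<rho>\<close> and \<open>\<sigma>h\<close>. The two products differ in the
  order of these commuting actions.\<close>

lemma transports_flip23:
  "transports (rel_tensor g Alg (rel_leg1 g Opp (whole, \<rho>) (whole, \<sigma>) \<sigma>h) (whole, \<rho>))
    (rel_tensor g Opp (rel_leg1 g Alg (whole, \<sigma>h) (whole, \<rho>) \<rho>) (whole, \<sigma>))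
    (can Alg (rel_leg1 g Opp (whole, \<rho>) (whole, \<sigma>) \<sigma>h) (whole, \<rho>)
      (c_leg1 (whole, \<alpha>) (whole, \<beta>) \<beta>h) (whole, \<alpha>) \<Psi> id)
    (can Opp (rel_leg1 g Alg (whole, \<sigma>h) (whole, \<rho>) \<rho>) (whole, \<sigma>)
      (c_leg1 (whole, \<beta>h) (whole, \<alpha>) \<alpha>) (whole, \<beta>) \<Phi> id)
    (rel_flip23 g \<rho> \<sigma> \<sigma>h) (c_flip23 \<alpha> \<beta> \<beta>h)"
proof -
  let ?L = "rel_leg1 g Opp (whole, \<rho>) (whole, \<sigma>) \<sigma>h" and ?M = "rel_leg1 g Alg (whole, \<sigma>h) (whole, \<rho>) \<rho>"
  let ?L' = "c_leg1 (whole, \<alpha>) (whole, \<beta>) \<beta>h" and ?M' = "c_leg1 (whole, \<beta>h) (whole, \<alpha>) \<alpha>"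
  let ?X = "rel_tensor g Alg ?L (whole, \<rho>)" and ?Y = "rel_tensor g Opp ?M (whole, \<sigma>)"
  let ?c = "can Alg ?L (whole, \<rho>) ?L' (whole, \<alpha>) \<Psi> id" and ?d = "can Opp ?M (whole, \<sigma>) ?M' (whole, \<beta>) \<Phi> id"
  \<comment> \<open>The order in the triple, with the leg over \<open>\<beta>\<close> first, then
    the first leg, then the leg over \<open>\<alpha>\<close>, is the one produced by
    \<open>set_triples_range\<close>.\<close>
  let ?f = "\<lambda>(\<eta>, \<xi>, \<theta>). rel_vec g Alg ?L (whole, \<rho>) (rel_vec g Opp (whole, \<rho>) (whole, \<sigma>) \<xi> \<eta>) \<theta>"
  let ?h = "\<lambda>(\<eta>, \<xi>, \<theta>). rel_vec g Opp ?M (whole, \<sigma>) (rel_vec g Alg (whole, \<sigma>h) (whole, \<rho>) \<xi> \<theta>) \<eta>"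
  note L = match_ran(3) and M = match_dom(1)
  note L_mod = match_rmod[OF L] and M_mod = match_rmod[OF M]
  note hX = hspace_rel_tensor[OF L_mod R_mod] and hY = hspace_rel_tensor[OF M_mod S_mod]
  have Lc: "rel_vec g Opp (whole, \<rho>) (whole, \<sigma>) \<xi> \<eta> \<in> carr ranV" for \<xi> \<eta>
    by (rule rel_vec_carr[OF R_mod' S_mod]) simp_all
  have Mc: "rel_vec g Alg (whole, \<sigma>h) (whole, \<rho>) \<xi> \<eta> \<in> carr domV" for \<xi> \<eta>
    by (rule rel_vec_carr[OF Sh_mod R_mod]) simp_all
  have "range ?f = (\<lambda>(v, \<theta>). rel_vec g Alg ?L (whole, \<rho>) v \<theta>) `
      ((\<lambda>(\<xi>, \<eta>). rel_vec g Opp (whole, \<rho>) (whole, \<sigma>) \<xi> \<eta>) ` (UNIV \<times> UNIV) \<times> UNIV)"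
    by (auto simp: image_def)
  then have X: "carr ?X = cspan (range ?f)"
    using carr_rel_tensor_left[OF L_mod R_mod] carr_rel_tensor[OF R_mod' S_mod] by (simp add: fst_legs)
  have "range ?h = (\<lambda>(v, \<eta>). rel_vec g Opp ?M (whole, \<sigma>) v \<eta>) `
      ((\<lambda>(\<xi>, \<theta>). rel_vec g Alg (whole, \<sigma>h) (whole, \<rho>) \<xi> \<theta>) ` (UNIV \<times> UNIV) \<times> UNIV)"
    by (auto simp: image_def)
  then have Y: "carr ?Y = cspan (range ?h)"
    using carr_rel_tensor_left[OF M_mod S_mod] carr_rel_tensor[OF Sh_mod R_mod] by (simp add: fst_legs)
  have gram: "ip ?Y (?h i) (?h j) = ip ?X (?f i) (?f j)" for i j
  proof -
    obtain \<eta> \<xi> \<theta> \<eta>' \<xi>' \<theta>' where ij: "i = (\<eta>, \<xi>, \<theta>)" "j = (\<eta>', \<xi>', \<theta>')" by (metis prod_cases3)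
    have r: "rmod Opp (fst (whole, \<sigma>h), \<rho>)" and sh: "rmod Alg (fst (whole, \<rho>), \<sigma>h)"
      using R_mod' Sh_mod by simp_all
    have "ip ?X (?f i) (?f j) =
        cinner \<xi> (\<rho> (bracket Alg (whole, \<sigma>) \<eta> \<eta>') (\<sigma>h (bracket Opp (whole, \<rho>) \<theta> \<theta>') \<xi>'))"
      by (simp add: ij rel_ip[OF L_mod R_mod] rel_kernel_left[OF L_mod R_mod] Lc fst_legs
          rel_leg1_vec[OF R_mod' S_mod sh leg_commuting(2)] rel_ip[OF R_mod' S_mod]
          rel_kernel_left[OF R_mod' S_mod])
    moreover have "ip ?Y (?h i) (?h j) =
        cinner \<xi> (\<sigma>h (bracket Opp (whole, \<rho>) \<theta> \<theta>') (\<rho> (bracket Alg (whole, \<sigma>) \<eta> \<eta>') \<xi>'))"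
      by (simp add: ij rel_ip[OF M_mod S_mod] rel_kernel_left[OF M_mod S_mod] Mc fst_legs
          rel_leg1_vec[OF Sh_mod R_mod r leg_commuting(5)] rel_ip[OF Sh_mod R_mod]
          rel_kernel_left[OF Sh_mod R_mod])
    ultimately show ?thesis by (simp add: \<rho>\<sigma>h)
  qed
  have k1: "ket2 ?L' (whole, \<alpha>) (Rz Opp \<rho> \<theta>) (ket2 (whole, \<alpha>) (whole, \<beta>) (Rz Alg \<sigma> \<eta>) \<xi>) = ?c (?f (\<eta>, \<xi>, \<theta>))"
    for \<theta> \<eta> \<xi>
    using ket2_eq[OF L R', of "rel_vec g Opp (whole, \<rho>) (whole, \<sigma>) \<xi> \<eta>" \<theta>] ket2_eq[OF R S', of \<xi> \<eta>] Lc
    by (simp add: fst_legs)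
  have k2: "ket2 ?M' (whole, \<beta>) (Rz Alg \<sigma> \<eta>) (ket2 (whole, \<beta>h) (whole, \<alpha>) (Rz Opp \<rho> \<theta>) \<xi>) = ?d (?h (\<eta>, \<xi>, \<theta>))"
    for \<theta> \<eta> \<xi>
    using ket2_eq[OF M S', of "rel_vec g Alg (whole, \<sigma>h) (whole, \<rho>) \<xi> \<theta>" \<eta>] ket2_eq[OF Sh R', of \<xi> \<theta>] Mc
    by (simp add: fst_legs)
  show ?thesis
    unfolding rel_flip23_def c_flip23_def Let_def
  proof (rule transports_lin_ext[OF hX hY can_unitary[OF L R'] can_unitary[OF M S'] X Y])
    show "well_def (range (\<lambda>i. (?f i, ?h i)))"
      by (rule well_def_gram[OF hX hY _ Y gram]) (simp add: X complex_vector.span_superset)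
    show "{(rel_vec g Alg ?L (whole, \<rho>) (rel_vec g Opp (whole, \<rho>) (whole, \<sigma>) \<xi> \<eta>) \<theta>,
        rel_vec g Opp ?M (whole, \<sigma>) (rel_vec g Alg (whole, \<sigma>h) (whole, \<rho>) \<xi> \<theta>) \<eta>) | \<xi> \<eta> \<theta>. True} =
        range (\<lambda>i. (?f i, ?h i))"
      by (auto simp: image_def)
    show "{(ket2 ?L' (whole, \<alpha>) \<eta> (ket2 (whole, \<alpha>) (whole, \<beta>) \<xi> x),
        ket2 ?M' (whole, \<beta>) \<xi> (ket2 (whole, \<beta>h) (whole, \<alpha>) \<eta> x)) | \<xi> \<eta> x. \<xi> \<in> \<beta> \<and> \<eta> \<in> \<alpha>} =
        range (\<lambda>i. (?c (?f i), ?d (?h i)))"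
      unfolding set_triples_range[OF match_whole[OF S] match_whole[OF R]]
      by (simp add: case_prod_beta k1 k2)
  qed
qed

context
  fixes V W
  assumes W: "unitary_op domV ranV W" and V: "\<And>x. x \<in> carr domV \<Longrightarrow> V (\<Phi> x) = \<Psi> (W x)"
begin

text \<open>The intertwining conditions make \<open>W\<close> a module map for each of the leg
  representations, which gives its tensor products with the identity a meaning. Every arrow of the
  composites then has a transport square, and the pasted squares translate one pentagon into the
  other.\<close>

lemma pentagon_iff:
  assumes 1: "\<forall>b. \<forall>x\<in>carr domV. W (snd (rel_leg1 g Alg (whole, \<sigma>h) (whole, \<rho>) \<rho>) b x) =
      snd (rel_leg2 g Opp (whole, \<rho>) (whole, \<sigma>) \<rho>) b (W x)"
    and 2: "\<forall>b. \<forall>x\<in>carr domV. W (snd (rel_leg1 g Alg (whole, \<sigma>h) (whole, \<rho>) \<sigma>) b x) =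
      snd (rel_leg1 g Opp (whole, \<rho>) (whole, \<sigma>) \<sigma>) b (W x)"
    and 3: "\<forall>b. \<forall>x\<in>carr domV. W (snd (rel_leg2 g Alg (whole, \<sigma>h) (whole, \<rho>) \<sigma>) b x) =
      snd (rel_leg1 g Opp (whole, \<rho>) (whole, \<sigma>) \<sigma>h) b (W x)"
    and 4: "\<forall>b. \<forall>x\<in>carr domV. W (snd (rel_leg2 g Alg (whole, \<sigma>h) (whole, \<rho>) \<sigma>h) b x) =
      snd (rel_leg2 g Opp (whole, \<rho>) (whole, \<sigma>) \<sigma>h) b (W x)"
  shows "(\<forall>v\<in>carr (rel_tensor g Alg (rel_leg2 g Alg (whole, \<sigma>h) (whole, \<rho>) \<sigma>h) (whole, \<rho>)).
        rel_assoc g Opp \<rho> \<sigma> Opp \<rho> \<sigma> (pmu_second g \<rho> \<sigma> \<sigma>h W v) = pmu_first g \<rho> \<sigma> \<sigma>h W v) \<longleftrightarrow>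
    (\<forall>v\<in>carr (c_tensor (c_leg2 (whole, \<beta>h) (whole, \<alpha>) \<beta>h) (whole, \<alpha>)).
        c_assoc \<alpha> \<beta> \<alpha> \<beta> (c_pmu_second \<alpha> \<beta> \<beta>h V v) = c_pmu_first \<alpha> \<beta> \<beta>h V v)"
proof -
  have hom: "rhom P P' W (inv_into (carr domV) W)"
    if "fst P = domV" "fst P' = ranV" "\<forall>b. \<forall>x\<in>carr domV. W (snd P b x) = snd P' b (W x)" for P P'
    using rhom_unitary[of P P' W] that W hspace_rel_tensor[OF Sh_mod R_mod] by simp
  note hom = hom[OF fst_legs(1) fst_legs(4) 1] hom[OF fst_legs(1) fst_legs(3) 2]
    hom[OF fst_legs(2) fst_legs(3) 3] hom[OF fst_legs(2) fst_legs(4) 4]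
  have dom: "match (flip Alg) (rel_leg1 g Alg (whole, \<sigma>h) (whole, \<rho>) \<rho>) (c_leg1 (whole, \<beta>h) (whole, \<alpha>) \<alpha>) \<Phi>"
    "match (flip Opp) (rel_leg1 g Alg (whole, \<sigma>h) (whole, \<rho>) \<sigma>) (c_leg1 (whole, \<beta>h) (whole, \<alpha>) \<beta>) \<Phi>"
    using match_dom by simp_all
  have ran: "match (flip Alg) (rel_leg2 g Opp (whole, \<rho>) (whole, \<sigma>) \<rho>) (c_leg2 (whole, \<alpha>) (whole, \<beta>) \<alpha>) \<Psi>"
    "match (flip Opp) (rel_leg1 g Opp (whole, \<rho>) (whole, \<sigma>) \<sigma>) (c_leg1 (whole, \<alpha>) (whole, \<beta>) \<beta>) \<Psi>"
    using match_ran by simp_all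
  have SR: "match (flip Alg) (rel_leg1 g Alg (whole, \<sigma>) (whole, \<rho>) \<rho>) (c_leg1 (whole, \<beta>) (whole, \<alpha>) \<alpha>)
      (can Alg (whole, \<sigma>) (whole, \<rho>) (whole, \<beta>) (whole, \<alpha>) id id)"
    using match_SR by simp
  have VW: "\<forall>x\<in>carr (fst (rel_leg1 g Alg (whole, \<sigma>h) (whole, \<rho>) r)). V (\<Phi> x) = \<Psi> (W x)"
    "\<forall>x\<in>carr (fst (rel_leg2 g Alg (whole, \<sigma>h) (whole, \<rho>) r)). V (\<Phi> x) = \<Psi> (W x)" for r
    using V by (simp_all add: fst_legs)
  let ?flip = "rel_flip g Opp (whole, \<rho>) (whole, \<sigma>)"
  have flip: "unitary_op ranV (rel_tensor g Alg (whole, \<sigma>) (whole, \<rho>)) ?flip"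
    using rel_flip_unitary[OF R S'] by simp
  \<comment> \<open>Exchanging the legs turns the action of \<open>\<rho>\<close> on the second leg
    into its action on the first, so the flip is a module map and can be tensored with the
    identity.\<close>
  have flip_op: "?flip (snd (rel_leg2 g Opp (whole, \<rho>) (whole, \<sigma>) \<rho>) b x) =
      snd (rel_leg1 g Alg (whole, \<sigma>) (whole, \<rho>) \<rho>) b (?flip x)" if "x \<in> carr ranV" for b x
  proof -
    let ?P = "rel_leg2 g Opp (whole, \<rho>) (whole, \<sigma>) \<rho>" and ?Q = "rel_leg1 g Alg (whole, \<sigma>) (whole, \<rho>) \<rho>"
    have r: "rmod Opp (fst (whole, \<sigma>), \<rho>)" using R_mod' by simp
    have Q: "fst ?Q = rel_tensor g Alg (whole, \<sigma>) (whole, \<rho>)" by (simp add: rel_leg1_def)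
    have "(?flip \<circ> snd ?P b) x = (snd ?Q b \<circ> ?flip) x"
    proof (rule chom_eqI[OF carr_rel_tensor[OF R_mod' S_mod] _ _ _ that])
      show "chom ranV (rel_tensor g Alg (whole, \<sigma>) (whole, \<rho>)) (?flip \<circ> snd ?P b)"
        using rmod_chom[OF match_rmod[OF match_ran(1)], of b] unitary_chom[OF flip]
        by (intro chom_compose) (auto simp: fst_legs)
      show "chom ranV (rel_tensor g Alg (whole, \<sigma>) (whole, \<rho>)) (snd ?Q b \<circ> ?flip)"
        using rmod_chom[OF match_rmod[OF match_SR], of b] unitary_chom[OF flip]
        by (intro chom_compose) (auto simp: Q)
      fix v assume "v \<in> (\<lambda>(\<xi>, \<eta>). rel_vec g Opp (whole, \<rho>) (whole, \<sigma>) \<xi> \<eta>) ` (carr (fst (whole, \<rho>)) \<times> carr (fst (whole, \<sigma>)))"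
      then obtain \<xi> \<eta> where v: "v = rel_vec g Opp (whole, \<rho>) (whole, \<sigma>) \<xi> \<eta>" by auto
      show "(?flip \<circ> snd ?P b) v = (snd ?Q b \<circ> ?flip) v"
        using rel_flip_vec[OF R S'] rel_leg2_vec[OF R_mod' S_mod r leg_commuting(3)]
          rel_leg1_vec[OF S_mod' R_mod r leg_commuting(3)]
        by (simp add: v)
    qed
    then show ?thesis by simp
  qed
  have flip_hom: "rhom (rel_leg2 g Opp (whole, \<rho>) (whole, \<sigma>) \<rho>) (rel_leg1 g Alg (whole, \<sigma>) (whole, \<rho>) \<rho>)
      ?flip (inv_into (carr ranV) ?flip)"
    using rhom_unitary[of "rel_leg2 g Opp (whole, \<rho>) (whole, \<sigma>) \<rho>" "rel_leg1 g Alg (whole, \<sigma>) (whole, \<rho>) \<rho>" ?flip]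
      flip flip_op hspace_rel_tensor[OF R_mod' S_mod]
    by (simp add: rel_leg1_def rel_leg2_def)
  have flip_can: "\<forall>x\<in>carr (fst (rel_leg2 g Opp (whole, \<rho>) (whole, \<sigma>) \<rho>)).
      c_flip (whole, \<alpha>) (whole, \<beta>) (\<Psi> x) =
      can Alg (whole, \<sigma>) (whole, \<rho>) (whole, \<beta>) (whole, \<alpha>) id id (?flip x)"
    using transports_flip[OF R S'] by (simp add: transports_def fst_legs)
  \<comment> \<open>The squares follow the arrows: \<open>t1\<close> to \<open>t3\<close> form the
    first composite, \<open>u1\<close> to \<open>u7\<close> the second. \<open>u8\<close> rebrackets
    the end of the second, which is bracketed to the left.\<close>
  note t1 = transports_op_left[where F = V, OF match_dom(4) R' match_ran(4) hom(4), OF VW(2)]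
  note t2 = transports_assoc[OF R S' Sh R', OF \<sigma>\<sigma>h]
  note t3 = transports_op_right[where F = V, OF dom(2) R ran(2) hom(2), OF VW(1)]
  note u1 = transports_assoc[OF Sh R' Sh R', OF \<rho>\<sigma>h]
  note u2 = transports_op_right[where F = V, OF dom(1) Sh ran(1) hom(1), OF VW(1)]
  note u3 = transports_op_right[where F = "c_flip (whole, \<alpha>) (whole, \<beta>)", OF ran(1) Sh SR flip_hom, OF flip_can]
  note u4 = transports_assoc_inv[OF Sh R' S R', OF \<rho>\<sigma>]
  note u5 = transports_op_left[where F = V, OF match_dom(3) R' match_ran(3) hom(3), OF VW(2)]
  note u6 = transports_flip23
  note u7 = transports_op_left[where F = V, OF match_dom(1) S' match_ran(1) hom(1), OF VW(1)]
  note u8 = transports_assoc[OF R S' R S', OF \<rho>\<sigma>[symmetric]]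
  note first = transports_comp[OF t1 transports_comp[OF t2 t3]]
  note second = transports_comp[OF u1 transports_comp[OF u2 transports_comp[OF u3 transports_comp[OF u4
    transports_comp[OF u5 transports_comp[OF u6 transports_comp[OF u7 u8]]]]]]]
  show ?thesis
    using transports_iff[OF second first can_unitary[OF match_dom(4) R']
        can_unitary[OF R ran(2)]]
    by (simp add: pmu_first_def pmu_second_def c_pmu_first_def c_pmu_second_def Let_def)
qed

text \<open>A C*-condition is paired with the operator condition on the leg representations whose
  intertwiner spaces it mentions, and \<open>intertwine_iff\<close> settles each pair. The pentagons
  are compared once all four conditions hold.\<close>

lemma pseudo_mult_unitary_iff:
  assumes V': "unitary_op (c_tensor (whole, \<beta>h) (whole, \<alpha>)) (c_tensor (whole, \<alpha>) (whole, \<beta>)) V"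
  shows "pseudo_mult_unitary g \<rho> \<sigma> \<sigma>h W \<longleftrightarrow> cstar_pseudo_mult_unitary \<alpha> \<beta> \<beta>h V"
proof -
  have 1: "(\<lambda>\<xi>. V \<circ> \<xi>) ` fact_left (whole, \<beta>h) (whole, \<alpha>) \<alpha> = fact_right (whole, \<alpha>) (whole, \<beta>) \<alpha> \<longleftrightarrow>
      (\<forall>b. \<forall>x\<in>carr domV. W (snd (rel_leg1 g Alg (whole, \<sigma>h) (whole, \<rho>) \<rho>) b x) =
        snd (rel_leg2 g Opp (whole, \<rho>) (whole, \<sigma>) \<rho>) b (W x))"
    using intertwine_iff[OF match_dom(1) match_ran(1), where V = V and W = W] W V
    by (simp add: fst_legs c_leg1_def c_leg2_def)
  have 2: "(\<lambda>\<xi>. V \<circ> \<xi>) ` fact_left (whole, \<beta>h) (whole, \<alpha>) \<beta> = fact_left (whole, \<alpha>) (whole, \<beta>) \<beta> \<longleftrightarrow>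
      (\<forall>b. \<forall>x\<in>carr domV. W (snd (rel_leg1 g Alg (whole, \<sigma>h) (whole, \<rho>) \<sigma>) b x) =
        snd (rel_leg1 g Opp (whole, \<rho>) (whole, \<sigma>) \<sigma>) b (W x))"
    using intertwine_iff[OF match_dom(2) match_ran(2), where V = V and W = W] W V
    by (simp add: fst_legs c_leg1_def c_leg2_def)
  have 3: "(\<lambda>\<xi>. V \<circ> \<xi>) ` fact_right (whole, \<beta>h) (whole, \<alpha>) \<beta> = fact_left (whole, \<alpha>) (whole, \<beta>) \<beta>h \<longleftrightarrow>
      (\<forall>b. \<forall>x\<in>carr domV. W (snd (rel_leg2 g Alg (whole, \<sigma>h) (whole, \<rho>) \<sigma>) b x) =
        snd (rel_leg1 g Opp (whole, \<rho>) (whole, \<sigma>) \<sigma>h) b (W x))"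
    using intertwine_iff[OF match_dom(3) match_ran(3), where V = V and W = W] W V
    by (simp add: fst_legs c_leg1_def c_leg2_def)
  have 4: "(\<lambda>\<xi>. V \<circ> \<xi>) ` fact_right (whole, \<beta>h) (whole, \<alpha>) \<beta>h = fact_right (whole, \<alpha>) (whole, \<beta>) \<beta>h \<longleftrightarrow>
      (\<forall>b. \<forall>x\<in>carr domV. W (snd (rel_leg2 g Alg (whole, \<sigma>h) (whole, \<rho>) \<sigma>h) b x) =
        snd (rel_leg2 g Opp (whole, \<rho>) (whole, \<sigma>) \<sigma>h) b (W x))"
    using intertwine_iff[OF match_dom(4) match_ran(4), where V = V and W = W] W V
    by (simp add: fst_legs c_leg1_def c_leg2_def)
  have rel: "pseudo_mult_unitary g \<rho> \<sigma> \<sigma>h W \<longleftrightarrow> unitary_op domV ranV W \<and>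
      (\<forall>b. \<forall>x\<in>carr domV. W (snd (rel_leg1 g Alg (whole, \<sigma>h) (whole, \<rho>) \<rho>) b x) =
        snd (rel_leg2 g Opp (whole, \<rho>) (whole, \<sigma>) \<rho>) b (W x)) \<and>
      (\<forall>b. \<forall>x\<in>carr domV. W (snd (rel_leg1 g Alg (whole, \<sigma>h) (whole, \<rho>) \<sigma>) b x) =
        snd (rel_leg1 g Opp (whole, \<rho>) (whole, \<sigma>) \<sigma>) b (W x)) \<and>
      (\<forall>b. \<forall>x\<in>carr domV. W (snd (rel_leg2 g Alg (whole, \<sigma>h) (whole, \<rho>) \<sigma>) b x) =
        snd (rel_leg1 g Opp (whole, \<rho>) (whole, \<sigma>) \<sigma>h) b (W x)) \<and>
      (\<forall>b. \<forall>x\<in>carr domV. W (snd (rel_leg2 g Alg (whole, \<sigma>h) (whole, \<rho>) \<sigma>h) b x) =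
        snd (rel_leg2 g Opp (whole, \<rho>) (whole, \<sigma>) \<sigma>h) b (W x)) \<and>
      (\<forall>v\<in>carr (rel_tensor g Alg (rel_leg2 g Alg (whole, \<sigma>h) (whole, \<rho>) \<sigma>h) (whole, \<rho>)).
        rel_assoc g Opp \<rho> \<sigma> Opp \<rho> \<sigma> (pmu_second g \<rho> \<sigma> \<sigma>h W v) = pmu_first g \<rho> \<sigma> \<sigma>h W v)"
    unfolding pseudo_mult_unitary_def Let_def by (simp only: rel_leg1_def rel_leg2_def snd_conv)
  show ?thesis
    unfolding rel cstar_pseudo_mult_unitary_def Let_def 1 2 3 4
    using W V' pentagon_iff by argo
qed

end

end

end

section \<open>C*-factorizations over a bicyclic vector\<close>

lemma cinner_adj_whole: "clinear T \<Longrightarrow> cinner (adj whole whole T y) x = cinner y (T x)"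
  using cinner_adj[OF hspace_whole, of T y x] by simp

lemma cinner_adj_whole_right:
  assumes "clinear T"
  shows "cinner y (adj whole whole T x) = cinner (T y) x"
proof -
  have "cinner y (adj whole whole T x) = cnj (cinner (adj whole whole T x) y)"
    by (rule cinner_commute)
  also have "\<dots> = cnj (cinner x (T y))" by (simp add: cinner_adj_whole[OF assms])
  also have "\<dots> = cinner (T y) x" by (rule cinner_commute[symmetric])
  finally show ?thesis .
qed

context
  fixes C Cd :: "('k::fd_hilbert \<Rightarrow> 'k) set" and \<gamma> :: "('k \<Rightarrow> 'h::fd_hilbert) set"
  assumes fact: "cstar_factorization C Cd whole \<gamma>"
begin

lemma fact_linear: "\<xi> \<in> \<gamma> \<Longrightarrow> clinear \<xi>"
  using fact by (simp add: cstar_factorization_def)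

lemma fact_subspace: "csubspace \<gamma>"
  using fact by (simp add: cstar_factorization_def)

lemma fact_span: "cspan {\<xi> w | \<xi> w. \<xi> \<in> \<gamma>} = UNIV"
  using fact by (simp add: cstar_factorization_def)

lemma fact_carr: "carr whole = cspan {\<xi> w | \<xi> w. \<xi> \<in> \<gamma>}"
  by (rule trans[OF carr_whole fact_span[symmetric]])

lemma fact_inner: "\<xi> \<in> \<gamma> \<Longrightarrow> \<xi>' \<in> \<gamma> \<Longrightarrow> adj whole whole \<xi> \<circ> \<xi>' \<in> C"
  using fact unfolding cstar_factorization_def
  by (elim conjE) (blast intro: complex_vector.span_base)

lemma fact_right: "\<xi> \<in> \<gamma> \<Longrightarrow> c \<in> C \<Longrightarrow> \<xi> \<circ> c \<in> \<gamma>"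
  using fact unfolding cstar_factorization_def
  by (elim conjE) (blast intro: complex_vector.span_base)

lemma fact_base: "cstar_base C Cd"
  using fact by (simp add: cstar_factorization_def)

lemma base_linear: "c \<in> C \<Longrightarrow> clinear c" "d \<in> Cd \<Longrightarrow> clinear d"
  using fact_base by (simp_all add: cstar_base_def cstar_subalgebra_def)

lemma base_commute: "c \<in> C \<Longrightarrow> d \<in> Cd \<Longrightarrow> c (d w) = d (c w)"
  using fact_base by (auto simp: cstar_base_def fun_eq_iff)

text \<open>The adjoint of \<open>\<xi>'\<close> composed with \<open>\<xi>\<close> lies in
  \<open>C\<close>, so \<open>d\<close> commutes with it and moves across the inner product.\<close>

lemma fact_adjoint:
  assumes \<xi>: "\<xi> \<in> \<gamma>" "\<xi>' \<in> \<gamma>" and d: "d \<in> Cd"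
  shows "cinner (\<xi>' w') (\<xi> (d w)) = cinner (\<xi>' (adj whole whole d w')) (\<xi> w)"
proof -
  have "cinner (\<xi>' v) (\<xi> w) = cinner v ((adj whole whole \<xi>' \<circ> \<xi>) w)" for v w
    by (simp add: cinner_adj_whole_right[OF fact_linear[OF \<xi>(2)]])
  then show ?thesis
    using base_commute[OF fact_inner[OF \<xi>(2,1)] d, of w]
    by (simp add: cinner_adj_whole[OF base_linear(2)[OF d]])
qed

text \<open>A vector may be \<open>\<xi> w\<close> in many ways, so well-definedness is at stake. By
  \<open>fact_adjoint\<close> the adjoint on generators replaces \<open>w'\<close> in
  \<open>\<xi>' w'\<close> by its image under the adjoint of \<open>d\<close>.\<close>

lemma fact_rep_apply:
  assumes d: "d \<in> Cd" and \<xi>: "\<xi> \<in> \<gamma>"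
  shows "fact_rep \<gamma> d (\<xi> w) = \<xi> (d w)"
proof -
  have "well_def {(\<xi> w, \<xi> (d w)) | \<xi> w. \<xi> \<in> \<gamma>}"
  proof (rule well_defI[OF hspace_whole hspace_whole])
    show "carr whole = cspan {\<xi> w | \<xi> w. \<xi> \<in> \<gamma>}" by (rule fact_carr)
    fix y' assume "y' \<in> {\<xi> w | \<xi> w. \<xi> \<in> \<gamma>}"
    then obtain \<xi>' w' where "\<xi>' \<in> \<gamma>" "y' = \<xi>' w'" by blast
    then show "\<exists>x'\<in>carr whole. \<forall>(x, y)\<in>{(\<xi> w, \<xi> (d w)) | \<xi> w. \<xi> \<in> \<gamma>}. ip whole y' y = ip whole x' x"
      by (intro bexI[of _ "\<xi>' (adj whole whole d w')"]) (auto simp: fact_adjoint[OF _ _ d])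
  qed auto
  then show ?thesis
    unfolding fact_rep_def using \<xi> by (intro lin_ext_base) auto
qed

text \<open>\<open>C\<close> is spanned by adjoints of elements of \<open>\<gamma>\<close> composed
  with elements of \<open>\<gamma>\<close>, so all of \<open>C\<close> identifies \<open>v\<close>
  and \<open>w\<close>. Being nondegenerate and closed under adjoints, \<open>C\<close> separates
  points.\<close>

lemma fact_separating:
  assumes eq: "\<And>\<xi>. \<xi> \<in> \<gamma> \<Longrightarrow> \<xi> v = \<xi> w"
  shows "v = w"
proof (rule hspace_eqI[OF hspace_whole])
  have C: "cspan {adj whole whole \<xi> \<circ> \<xi>' | \<xi> \<xi>'. \<xi> \<in> \<gamma> \<and> \<xi>' \<in> \<gamma>} = C"
    using fact by (simp add: cstar_factorization_def)
  have "adj whole whole \<xi> (\<xi>' v) = adj whole whole \<xi> (\<xi>' w)" if "\<xi>' \<in> \<gamma>" for \<xi> \<xi>'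
    by (simp only: eq[OF that])
  then have "C \<subseteq> {c. c v = c w}"
    unfolding C[symmetric]
    by (intro complex_vector.span_minimal) (auto simp: complex_vector.subspace_def scaleC_fun_apply)
  moreover have "adj whole whole c \<in> C" if "c \<in> C" for c
    using fact_base that by (simp add: cstar_base_def cstar_subalgebra_def)
  ultimately have adj: "adj whole whole c v = adj whole whole c w" if "c \<in> C" for c
    using that by blast
  have "cinner (c u) v = cinner (c u) w" if c: "c \<in> C" for c u
  proof -
    show ?thesis by (simp add: adj[OF c] flip: cinner_adj_whole_right[OF base_linear(1)[OF c]])
  qed
  then show "ip whole b v = ip whole b w" if "b \<in> {c u | c u. c \<in> C}" for b
    using that by auto
  show "carr whole = cspan {c u | c u. c \<in> C}"
    using fact_base by (simp add: cstar_base_def)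
qed simp_all

context
  fixes z :: 'k
  assumes bicyclic: "bicyclic C Cd z"
begin

text \<open>The vectors \<open>c z\<close> form a subspace, so a cyclic vector reaches every vector
  by a single element of \<open>C\<close>.\<close>

lemma cyclic: "\<exists>c\<in>C. c z = w"
proof -
  have "cspan ((\<lambda>c. c z) ` C) = (\<lambda>c. c z) ` C"
    using fact_base
    by (intro cspan_linear_graph) (auto simp: cstar_base_def cstar_subalgebra_def scaleC_fun_apply)
  moreover have "cspan ((\<lambda>c. c z) ` C) = UNIV"
    using bicyclic by (simp add: bicyclic_def image_def Bex_def conj_commute)
  ultimately have "w \<in> (\<lambda>c. c z) ` C" by simp
  then show ?thesis by auto
qed

text \<open>Every vector is some \<open>c z\<close>, and \<open>d\<close> commutes with
  \<open>c\<close>: cyclic for \<open>C\<close> implies separating for \<open>Cd\<close>.\<close>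

lemma separating: "d \<in> Cd \<Longrightarrow> d z = 0 \<Longrightarrow> d w = 0"
  using cyclic[of w] base_commute[of _ d z] clinear_zero[OF base_linear(1)] by auto

text \<open>Writing \<open>w = c z\<close> makes \<open>\<xi> w\<close> the value at
  \<open>z\<close> of \<open>\<xi> \<circ> c\<close>, again in \<open>\<gamma>\<close>. Such values
  form a subspace, which therefore contains a spanning set.\<close>

lemma fact_surj: "\<exists>\<xi>\<in>\<gamma>. \<xi> z = x"
proof -
  have sub: "{\<xi> w | \<xi> w. \<xi> \<in> \<gamma>} \<subseteq> (\<lambda>\<xi>. \<xi> z) ` \<gamma>"
  proof clarify
    fix \<xi> w assume \<xi>: "\<xi> \<in> \<gamma>"
    obtain c where c: "c \<in> C" "c z = w" using cyclic by blast
    then show "\<xi> w \<in> (\<lambda>\<xi>. \<xi> z) ` \<gamma>"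
      using fact_right[OF \<xi> c(1)] by (intro image_eqI[of _ _ "\<xi> \<circ> c"]) auto
  qed
  have span: "cspan ((\<lambda>\<xi>. \<xi> z) ` \<gamma>) = (\<lambda>\<xi>. \<xi> z) ` \<gamma>"
    by (rule cspan_linear_graph[OF fact_subspace]) (simp_all add: scaleC_fun_apply)
  have "(\<lambda>\<xi>. \<xi> z) ` \<gamma> = UNIV"
    using complex_vector.span_mono[OF sub] unfolding fact_span span by blast
  then show ?thesis by (metis UNIV_I imageE)
qed

end

end

text \<open>
  The transported representation \<open>k\<close> inherits all algebraic properties from \<open>\<kappa>\<close>, because
  elements of the factorization separate the points of the base. In particular, nothing about the
  modular conjugation needs to be known for \<open>k = \<pi>\<^sub>\<mu>\<^sup>o\<^sup>p\<close>.
\<close>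

definition side_rep :: "side \<Rightarrow> ('n::fd_cstar_algebra \<Rightarrow> 'h::fd_hilbert \<Rightarrow> 'h) \<Rightarrow> bool"
  where "side_rep s \<kappa> \<longleftrightarrow> (\<forall>b. clinear (\<kappa> b)) \<and> clinear \<kappa> \<and>
    (\<forall>a b. \<kappa> (side_mult s a b) = \<kappa> a \<circ> \<kappa> b) \<and> (\<forall>b. \<kappa> (star b) = adj whole whole (\<kappa> b))"

lemma side_rep_Alg: "cstar_rep \<kappa> \<Longrightarrow> side_rep Alg \<kappa>"
  by (simp add: cstar_rep_def side_rep_def)

lemma side_rep_Opp: "cstar_opp_rep \<kappa> \<Longrightarrow> side_rep Opp \<kappa>"
  by (simp add: cstar_opp_rep_def side_rep_def)

lemma side_rep_star: "side_rep s \<kappa> \<Longrightarrow> cinner (\<kappa> (star b) x) y = cinner x (\<kappa> b y)"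
  by (simp add: side_rep_def cinner_adj_whole)

lemma side_rep_linear_left: "side_rep s \<kappa> \<Longrightarrow> clinear (\<lambda>b. \<kappa> b x)"
  by (simp add: side_rep_def clinear_iff scaleC_fun_apply)

context
  fixes C Cd :: "('k::fd_hilbert \<Rightarrow> 'k) set" and \<gamma> :: "('k \<Rightarrow> 'h::fd_hilbert) set"
    and \<kappa> :: "'n::fd_cstar_algebra \<Rightarrow> 'h \<Rightarrow> 'h" and k :: "'n \<Rightarrow> 'k \<Rightarrow> 'k" and s
  assumes fact: "cstar_factorization C Cd whole \<gamma>" and \<kappa>: "side_rep s \<kappa>"
    and k: "\<And>b. k b \<in> Cd" and \<kappa>_eq: "\<And>b. \<kappa> b = fact_rep \<gamma> (k b)"
begin

lemma fact_intertwine: "\<xi> \<in> \<gamma> \<Longrightarrow> \<kappa> b (\<xi> w) = \<xi> (k b w)"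
  by (simp add: \<kappa>_eq fact_rep_apply[OF fact k])

lemma transported_linear: "clinear (k b)"
  by (rule base_linear(2)[OF fact k])

lemma transported_linear_left: "clinear (\<lambda>b. k b w)"
  unfolding clinear_iff
proof (intro conjI allI)
  note lin = side_rep_linear_left[OF \<kappa>]
  show "k (a + b) w = k a w + k b w" for a b
  proof (rule fact_separating[OF fact])
    fix \<xi> assume \<xi>: "\<xi> \<in> \<gamma>"
    have "\<kappa> (a + b) (\<xi> w) = \<kappa> a (\<xi> w) + \<kappa> b (\<xi> w)" by (rule clinear_add[OF lin])
    then show "\<xi> (k (a + b) w) = \<xi> (k a w + k b w)"
      using \<xi> by (simp add: fact_intertwine clinear_add[OF fact_linear[OF fact]])
  qed
  show "k (c *\<^sub>C b) w = c *\<^sub>C k b w" for c b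
  proof (rule fact_separating[OF fact])
    fix \<xi> assume \<xi>: "\<xi> \<in> \<gamma>"
    have "\<kappa> (c *\<^sub>C b) (\<xi> w) = c *\<^sub>C \<kappa> b (\<xi> w)" by (rule clinear_scale[OF lin])
    then show "\<xi> (k (c *\<^sub>C b) w) = \<xi> (c *\<^sub>C k b w)"
      using \<xi> by (simp add: fact_intertwine clinear_scale[OF fact_linear[OF fact]])
  qed
qed

lemma transported_mult: "k (side_mult s a b) w = k a (k b w)"
proof (rule fact_separating[OF fact])
  fix \<xi> assume "\<xi> \<in> \<gamma>"
  moreover have "\<kappa> (side_mult s a b) (\<xi> w) = \<kappa> a (\<kappa> b (\<xi> w))"
    using \<kappa> by (simp add: side_rep_def)
  ultimately show "\<xi> (k (side_mult s a b) w) = \<xi> (k a (k b w))"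
    by (simp add: fact_intertwine)
qed

text \<open>After applying \<open>\<xi>\<close>, the identity can be tested against vectors
  \<open>\<xi>' w'\<close>, where it is the star property of \<open>\<kappa>\<close> combined with
  \<open>fact_adjoint\<close>.\<close>

lemma transported_star: "cinner (k (star b) v) w = cinner v (k b w)"
proof -
  have "k (star b) v = adj whole whole (k b) v"
  proof (rule fact_separating[OF fact])
    fix \<xi> assume \<xi>: "\<xi> \<in> \<gamma>"
    show "\<xi> (k (star b) v) = \<xi> (adj whole whole (k b) v)"
    proof (rule hspace_eqI[OF hspace_whole])
      show "carr whole = cspan {\<xi> w | \<xi> w. \<xi> \<in> \<gamma>}" by (rule fact_carr[OF fact])
      fix y assume "y \<in> {\<xi> w | \<xi> w. \<xi> \<in> \<gamma>}"
      then obtain \<xi>' w' where y: "\<xi>' \<in> \<gamma>" "y = \<xi>' w'" by blast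
      have "cinner (\<xi> (k (star b) v)) (\<xi>' w') = cinner (\<xi> (adj whole whole (k b) v)) (\<xi>' w')"
        using \<xi> y side_rep_star[OF \<kappa>, of b "\<xi> v" "\<xi>' w'"]
        by (simp add: fact_intertwine fact_adjoint[OF fact _ _ k])
      then show "ip whole y (\<xi> (k (star b) v)) = ip whole y (\<xi> (adj whole whole (k b) v))"
        using y by simp (metis cinner_commute)
    qed simp_all
  qed
  then show ?thesis by (simp add: cinner_adj_whole[OF transported_linear])
qed

text \<open>If \<open>k b\<close> vanishes, then \<open>\<kappa> b\<close> kills all vectors
  \<open>\<xi> w\<close>, and these span.\<close>

lemma transported_inj:
  assumes inj: "inj \<kappa>" and 0: "\<And>w. k b w = 0"
  shows "b = 0"
proof -
  have "\<kappa> b x = 0" for x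
  proof (rule chom_eqI[where X = whole and Y = whole and S = "\<kappa> b" and T = "\<lambda>_. 0"])
    show "carr whole = cspan {\<xi> w | \<xi> w. \<xi> \<in> \<gamma>}" by (rule fact_carr[OF fact])
    show "chom whole whole (\<kappa> b)" using \<kappa> by (simp add: chom_whole side_rep_def)
  qed (auto simp: chom_def fact_intertwine 0 clinear_zero[OF fact_linear[OF fact]])
  moreover have "\<kappa> 0 = (\<lambda>_. 0)"
    using \<kappa> clinear_zero[of \<kappa>] by (simp add: side_rep_def zero_fun_def)
  ultimately have "\<kappa> b = \<kappa> 0" by auto
  then show ?thesis using inj by (simp add: inj_eq)
qed

end

section \<open>Factorizations as spaces of intertwiners\<close>

context bicyclic_frame
begin

text \<open>Elements of \<open>\<gamma>\<close> intertwine \<open>l s\<close> with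
  \<open>\<kappa>\<close>, so each of them is \<open>Rz\<close> of its value at \<open>z\<close>; by
  \<open>fact_surj\<close> these values exhaust the space.\<close>

lemma match_factorization:
  fixes \<gamma> :: "('k \<Rightarrow> 'h::fd_hilbert) set"
  assumes fact: "cstar_factorization C Cd whole \<gamma>" and bicyclic: "bicyclic C Cd z"
    and \<kappa>: "side_rep s \<kappa>" "nondegenerate \<kappa>"
    and l: "\<And>b. l s b \<in> Cd" and \<kappa>_eq: "\<And>b. \<kappa> b = fact_rep \<gamma> (l s b)"
  shows "match s (whole, \<kappa>) (whole, \<gamma>) id"
proof -
  note intertwine = fact_intertwine[OF fact \<kappa>(1) l \<kappa>_eq]
  have e: "side_mult s e b = b" for b
    by (rule l_inject[of s]) (simp add: l_mult l_unit)
  \<comment> \<open>Nondegeneracy enters here: \<open>e\<close> is a left unit for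
    \<open>side_mult s\<close>, so it fixes the vectors \<open>\<kappa> b x\<close>, and these
    span.\<close>
  have unit: "\<kappa> e x = x" for x
  proof (rule chom_eqI[where X = whole and Y = whole and S = "\<kappa> e" and T = "\<lambda>x. x"])
    show "carr whole = cspan {\<kappa> b x | b x. True}" using \<kappa>(2) by (simp add: nondegenerate_def)
    show "chom whole whole (\<kappa> e)" using \<kappa>(1) by (simp add: chom_whole side_rep_def)
    fix y assume "y \<in> {\<kappa> b x | b x. True}"
    then obtain b x where y: "y = \<kappa> b x" by blast
    have "\<kappa> (side_mult s e b) = \<kappa> e \<circ> \<kappa> b" using \<kappa>(1) by (simp add: side_rep_def)
    then show "\<kappa> e y = y" by (simp add: e y fun_eq_iff)
  qed (simp_all add: chom_id)
  have mod: "rmod s (whole, \<kappa>)"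
    using \<kappa>(1) unit side_rep_star[OF \<kappa>(1)] side_rep_linear_left[OF \<kappa>(1)]
    by (simp add: rmod_def hspace_whole chom_whole side_rep_def)
  have R: "Rz s \<kappa> (\<xi> z) = \<xi>" if "\<xi> \<in> \<gamma>" for \<xi>
    using that Rz_eq[OF mod] by (simp add: fun_eq_iff intertwine l_coord)
  have "\<gamma> = range (Rz s \<kappa>)"
  proof
    show "\<gamma> \<subseteq> range (Rz s \<kappa>)" using R by (metis rangeI subsetI)
    show "range (Rz s \<kappa>) \<subseteq> \<gamma>" using fact_surj[OF fact bicyclic] R by (metis image_subsetI)
  qed
  then show ?thesis
    using mod by (simp add: match_def id_def comp_def hspace_whole unitary_id)
qed

lemma canonical_unitary_eq:
  "canonical_unitary g U z s \<kappa> \<tau> \<gamma> \<delta> = can s (whole, \<kappa>) (whole, \<tau>) (whole, \<gamma>) (whole, \<delta>) id id"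
  unfolding canonical_unitary_def can_def
  by (rule arg_cong[where f = lin_ext]) (auto simp: Rz_def image_def)

end

theorem proposition4p1:
  fixes \<mu> :: "'n::fd_cstar_algebra \<Rightarrow> complex"
    and \<pi>\<^sub>\<mu> :: "'n \<Rightarrow> 'm::fd_hilbert \<Rightarrow> 'm" and \<zeta>\<^sub>\<mu> :: 'm
    and \<rho> \<sigma> \<sigma>h :: "'n \<Rightarrow> 'h::fd_hilbert \<Rightarrow> 'h"
    and B Bd :: "('k::fd_hilbert \<Rightarrow> 'k) set" and \<zeta> :: 'k
    and \<alpha> \<beta> \<beta>h :: "('k \<Rightarrow> 'h) set"
    and U :: "'k \<Rightarrow> 'm"
    and V :: "('k, 'h, 'h) cten \<Rightarrow> ('k, 'h, 'h) cten"
  defines "g \<equiv> (\<pi>\<^sub>\<mu>, \<zeta>\<^sub>\<mu>)"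
    and "Ad_U_star \<equiv> \<lambda>x. adj whole whole U \<circ> x \<circ> U"
    and "\<Phi> \<equiv> canonical_unitary (\<pi>\<^sub>\<mu>, \<zeta>\<^sub>\<mu>) U \<zeta> Alg \<sigma>h \<rho> \<beta>h \<alpha>"
    and "\<Psi> \<equiv> canonical_unitary (\<pi>\<^sub>\<mu>, \<zeta>\<^sub>\<mu>) U \<zeta> Opp \<rho> \<sigma> \<alpha> \<beta>"
  assumes state: "faithful_state \<mu>"
    and gns: "gns_representation \<mu> g"
    and \<rho>: "cstar_opp_rep \<rho>" "nondegenerate \<rho>" "inj \<rho>"
    and \<sigma>: "cstar_rep \<sigma>" "nondegenerate \<sigma>" "inj \<sigma>"
    and \<sigma>h: "cstar_rep \<sigma>h" "nondegenerate \<sigma>h" "inj \<sigma>h"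
    and commute: "\<forall>x y. \<rho> x \<circ> \<sigma> y = \<sigma> y \<circ> \<rho> x" "\<forall>x y. \<rho> x \<circ> \<sigma>h y = \<sigma>h y \<circ> \<rho> x"
      "\<forall>x y. \<sigma> x \<circ> \<sigma>h y = \<sigma>h y \<circ> \<sigma> x"
    and base: "cstar_base B Bd" "bicyclic B Bd \<zeta>"
    and factorizations: "cstar_factorization B Bd whole \<alpha>"
      "cstar_factorization Bd B whole \<beta>" "cstar_factorization Bd B whole \<beta>h"
    and compat: "compatible Bd \<alpha> B \<beta>" "compatible Bd \<alpha> B \<beta>h" "compatible B \<beta> B \<beta>h"
    and U: "unitary_op whole whole U"
      "{U \<circ> b \<circ> adj whole whole U | b. b \<in> B} = range \<pi>\<^sub>\<mu>"
      "{U \<circ> b \<circ> adj whole whole U | b. b \<in> Bd} = range (gns_op g)"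
      "U \<zeta> = \<zeta>\<^sub>\<mu>"
    and \<rho>_eq: "\<forall>b. \<rho> b = fact_rep \<alpha> (Ad_U_star (gns_op g b))"
    and \<sigma>_eq: "\<forall>b. \<sigma> b = fact_rep \<beta> (Ad_U_star (\<pi>\<^sub>\<mu> b))"
    and \<sigma>h_eq: "\<forall>b. \<sigma>h b = fact_rep \<beta>h (Ad_U_star (\<pi>\<^sub>\<mu> b))"
    and V: "unitary_op (c_tensor (whole, \<beta>h) (whole, \<alpha>)) (c_tensor (whole, \<alpha>) (whole, \<beta>)) V"
  shows "pseudo_mult_unitary g \<rho> \<sigma> \<sigma>h
      (inv_into (carr (rel_tensor g Opp (whole, \<rho>) (whole, \<sigma>))) \<Psi> \<circ> V \<circ> \<Phi>)
    \<longleftrightarrow> cstar_pseudo_mult_unitary \<alpha> \<beta> \<beta>h V"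
proof -
  \<comment> \<open>Both sides of the GNS-representation are pulled back along \<open>U\<close>, to
    act on the space of the base with images \<open>B\<close> and \<open>Bd\<close>.\<close>
  define l where "l = (\<lambda>s b. Ad_U_star (gns_side g s b))"
  have UU: "adj whole whole U (U x) = x" for x
    using unitary_ip[OF U(1)] by (intro adj_eqI) simp
  have UU': "U (adj whole whole U y) = y" for y
    using unitary_surj[OF U(1)] UU by (metis carr_whole imageE iso_tuple_UNIV_I)
  have conj: "Ad_U_star (U \<circ> b \<circ> adj whole whole U) = b" for b
    by (simp add: Ad_U_star_def fun_eq_iff UU)
  have U_l: "gns_side g s b (U w) = U (l s b w)" for s b w
    by (simp add: l_def Ad_U_star_def UU')
  have l_Alg: "range (l Alg) = B"
  proof -
    have "range (l Alg) = Ad_U_star ` range \<pi>\<^sub>\<mu>" by (auto simp: l_def g_def)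
    also have "\<dots> = B" unfolding U(2)[symmetric] by (auto simp: conj image_def)
    finally show ?thesis .
  qed
  have l_Opp: "range (l Opp) = Bd"
  proof -
    have "range (l Opp) = Ad_U_star ` range (gns_op g)" by (auto simp: l_def)
    also have "\<dots> = Bd" unfolding U(3)[symmetric] by (auto simp: conj image_def)
    finally show ?thesis .
  qed
  have \<rho>_l: "\<rho> b = fact_rep \<alpha> (l Opp b)" and \<sigma>_l: "\<sigma> b = fact_rep \<beta> (l Alg b)"
    and \<sigma>h_l: "\<sigma>h b = fact_rep \<beta>h (l Alg b)" for b
    using \<rho>_eq \<sigma>_eq \<sigma>h_eq by (simp_all add: l_def g_def)
  note reps = side_rep_Opp[OF \<rho>(1)] side_rep_Alg[OF \<sigma>(1)] side_rep_Alg[OF \<sigma>h(1)]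
  have mem: "l Opp b \<in> Bd" "l Alg b \<in> B" for b using l_Opp l_Alg by auto
  have bic: "bicyclic Bd B \<zeta>" using base(2) by (simp add: bicyclic_def)
  note opp = factorizations(1) reps(1) mem(1) \<rho>_l and alg = factorizations(2) reps(2) mem(2) \<sigma>_l
  have comm: "l Alg a (l Opp b w) = l Opp b (l Alg a w)" for a b w
    by (rule base_commute[OF factorizations(1) mem(2,1)])
  have surj: "\<exists>b. l s b \<zeta> = w" for s w
  proof (cases s)
    case Alg
    obtain c where "c \<in> B" "c \<zeta> = w" using cyclic[OF factorizations(1) base(2)] by blast
    then show ?thesis unfolding l_Alg[symmetric] Alg by auto
  next
    case Opp
    obtain c where "c \<in> Bd" "c \<zeta> = w" using cyclic[OF factorizations(2) bic] by blast
    then show ?thesis unfolding l_Opp[symmetric] Opp by auto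
  qed
  \<comment> \<open>\<open>\<zeta>\<close> is cyclic for the other algebra, hence separating for
    this one, so \<open>l s b\<close> vanishes; then \<open>\<sigma>\<close> or
    \<open>\<rho>\<close> being faithful gives \<open>b = 0\<close>.\<close>
  have inj: "b = 0" if "l s b \<zeta> = 0" for s b
  proof (cases s)
    case Alg
    then show ?thesis
      using that separating[OF factorizations(2) bic mem(2)] transported_inj[OF alg \<sigma>(3)] by blast
  next
    case Opp
    then show ?thesis
      using that separating[OF factorizations(1) base(2) mem(1)] transported_inj[OF opp \<rho>(3)] by blast
  qed
  have lin_left: "clinear (\<lambda>b. l s b w)"
    and mult: "l s (side_mult s a b) w = l s a (l s b w)"
    and star: "cinner (l s (star b) v) w = cinner v (l s b w)" for s a b v w
    using transported_linear_left[OF opp] transported_linear_left[OF alg] transported_mult[OF opp] transported_mult[OF alg]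
      transported_star[OF opp] transported_star[OF alg]
    by (cases s; simp)+
  \<comment> \<open>The class of C*-algebras provides no unit. \<open>e\<close> is chosen to fix
    \<open>\<zeta>\<close>; commutation with \<open>l Opp\<close>, for which \<open>\<zeta>\<close>
    is cyclic, spreads this to all vectors.\<close>
  obtain e where e: "l Alg e \<zeta> = \<zeta>" using surj by blast
  have e_Alg: "l Alg e w = w" for w
  proof -
    obtain b where "l Opp b \<zeta> = w" using surj by blast
    then show ?thesis using comm[of e b \<zeta>] e by simp
  qed
  \<comment> \<open>\<open>l Opp\<close> reverses products, so a right unit of \<open>N\<close> is
    what makes \<open>l Opp e\<close> the identity below.\<close>
  have e_right: "b * e = b" for b
  proof -
    have "l Alg (b * e - b) \<zeta> = 0"
      using mult[of Alg b e \<zeta>] by (simp add: clinear_diff[OF lin_left] e)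
    then show ?thesis using inj by force
  qed
  have e_Opp: "l Opp e w = w" for w
  proof -
    obtain b where "l Opp b \<zeta> = w" using surj by blast
    then show ?thesis using mult[of Opp e b \<zeta>] by (simp add: e_right)
  qed
  have comm': "l (flip s) a (l s b w) = l s b (l (flip s) a w)" for s a b w
    by (cases s) (simp_all add: comm)
  have unit: "l s e w = w" for s w
    by (cases s) (simp_all add: e_Alg e_Opp)
  have z: "U \<zeta> = snd g" by (simp add: g_def U(4))
  interpret bicyclic_frame g U \<zeta> e l
    by (rule bicyclic_frame.intro) (fact U(1) z U_l lin_left mult star comm' surj inj unit)+
  have R: "match Opp (whole, \<rho>) (whole, \<alpha>) id"
    by (rule match_factorization[OF factorizations(1) base(2) reps(1) \<rho>(2) mem(1) \<rho>_l])
  have S: "match Alg (whole, \<sigma>) (whole, \<beta>) id"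
    by (rule match_factorization[OF factorizations(2) bic reps(2) \<sigma>(2) mem(2) \<sigma>_l])
  have Sh: "match Alg (whole, \<sigma>h) (whole, \<beta>h) id"
    by (rule match_factorization[OF factorizations(3) bic reps(3) \<sigma>h(2) mem(2) \<sigma>h_l])
  have c: "\<rho> a (\<sigma> b x) = \<sigma> b (\<rho> a x)" "\<rho> a (\<sigma>h b x) = \<sigma>h b (\<rho> a x)" "\<sigma> a (\<sigma>h b x) = \<sigma>h b (\<sigma> a x)"
    for a b x
    using commute by (simp_all add: fun_eq_iff)
  let ?\<Phi> = "can Alg (whole, \<sigma>h) (whole, \<rho>) (whole, \<beta>h) (whole, \<alpha>) id id"
  let ?\<Psi> = "can Opp (whole, \<rho>) (whole, \<sigma>) (whole, \<alpha>) (whole, \<beta>) id id"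
  have \<Phi>_eq: "\<Phi> = ?\<Phi>" and \<Psi>_eq: "\<Psi> = ?\<Psi>"
    unfolding \<Phi>_def \<Psi>_def by (simp_all add: canonical_unitary_eq flip: g_def)
  have \<Phi>: "unitary_op (rel_tensor g Alg (whole, \<sigma>h) (whole, \<rho>)) (c_tensor (whole, \<beta>h) (whole, \<alpha>)) \<Phi>"
    unfolding \<Phi>_eq by (rule can_unitary[OF Sh]) (simp add: R)
  have \<Psi>: "unitary_op (rel_tensor g Opp (whole, \<rho>) (whole, \<sigma>)) (c_tensor (whole, \<alpha>) (whole, \<beta>)) \<Psi>"
    unfolding \<Psi>_eq by (rule can_unitary[OF R]) (simp add: S)
  let ?W = "inv_into (carr (rel_tensor g Opp (whole, \<rho>) (whole, \<sigma>))) \<Psi> \<circ> V \<circ> \<Phi>"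
  have sub: "csubspace (carr (rel_tensor g Opp (whole, \<rho>) (whole, \<sigma>)))"
    using hspace_subspace[OF hspace_rel_tensor[OF match_rmod[OF R]]] match_rmod[OF S] by simp
  have W: "unitary_op (rel_tensor g Alg (whole, \<sigma>h) (whole, \<rho>)) (rel_tensor g Opp (whole, \<rho>) (whole, \<sigma>)) ?W"
    using unitary_compose[OF unitary_compose[OF \<Phi> V] unitary_inv_into[OF \<Psi> sub]] by (simp add: comp_assoc)
  \<comment> \<open>\<open>V (\<Phi> x)\<close> lies in the image of the carrier under
    \<open>\<Psi>\<close>, where \<open>inv_into\<close> is a genuine right inverse.\<close>
  have VW: "V (?\<Phi> x) = ?\<Psi> (?W x)" if "x \<in> carr (rel_tensor g Alg (whole, \<sigma>h) (whole, \<rho>))" for x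
  proof -
    have "V (\<Phi> x) \<in> \<Psi> ` carr (rel_tensor g Opp (whole, \<rho>) (whole, \<sigma>))"
      unfolding unitary_surj[OF \<Psi>] by (rule unitary_carr[OF V unitary_carr[OF \<Phi> that]])
    then show ?thesis by (simp add: f_inv_into_f flip: \<Phi>_eq \<Psi>_eq)
  qed
  show ?thesis
    by (rule pseudo_mult_unitary_iff[OF R S Sh c W VW V])
qed

end
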